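(* Let $N\ge16$ be an integer, let $(n_0,n_1,E_0,E_1)$ satisfy, for some $\epsilon\le\epsilon_0$, $$\sum_{|I|\leq N+1}\big\|\langle x\rangle^{|I|+3}\nabla^I n_0\big\|+\sum_{|I|\leq N}\big\|\langle x\rangle^{|I|+3}\nabla^I n_1\big\|+\sum_{|I|\leq N+2}\big\|\langle x\rangle^{15}\nabla^I E_0\big\|+\sum_{|I|\leq N+1}\big\|\langle x\rangle^{15}\nabla^I E_1\big\|<\epsilon ,$$ with $\epsilon_0>0$ sufficiently small, and let $(n,E)$ be the global solution of $$-\Box n=\Delta|E|^2,\qquad -\Box E+E=-nE,\qquad (n,\partial_tn,E,\partial_tE)(1)=(n_0,n_1,E_0,E_1).$$ If $\int_{\mathbb{R}^2}n_1\,dx\ne0$, then there exists $C>0$ such that for all sufficiently large $t$ $$\|n(t)\|\ge C\,(\log t)^{1/2}\,\Big|\int_{\mathbb{R}^2}n_1\,dx\Big|,\qquad \|\partial n(t)\|\le C\epsilon .$$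
   Context: $-\Box=\partial_t^2-\Delta$ on $\mathbb{R}^{1+2}$; $n$ is real-valued, $E$ is $\mathbb{R}^2$-valued; $\nabla=(\partial_{x_1},\partial_{x_2})$; $\partial=(\partial_t,\partial_{x_1},\partial_{x_2})$; $\|\cdot\|$ is the $L^2(\mathbb{R}^2)$ norm in $x$; $\langle a\rangle=\sqrt{1+|a|^2}$. For $\epsilon_0$ small the Cauchy problem has a global solution on $[1,\infty)\times\mathbb{R}^2$ with, for a constant $C'$, $|n|\le C'\epsilon\langle t+|x|\rangle^{-1/2}\langle t-|x|\rangle^{-1/2}$, $|E|\le C'\epsilon\langle t+|x|\rangle^{-1}$ and $\|(\partial_tn,\nabla n)\|_{H^N}+\|E\|_{H^{N+2}}+\|\partial_tE\|_{H^{N+1}}\le C'\epsilon$; $(n,E)$ denotes this solution. *)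

theory Defs
  imports "HOL-Analysis.Analysis"
begin

section \<open>Brackets and classical derivatives\<close>

definition japanese :: "'a::real_normed_vector \<Rightarrow> real" where
  "japanese a = sqrt (1 + (norm a)\<^sup>2)"

text \<open>
  \<open>Ck_on k S f\<close>: \<open>f\<close> is of class \<open>C\<^sup>k\<close> on \<open>S\<close>. Derivatives are taken within \<open>S\<close>, so that they are
  one-sided at boundary points. It is only used for \<open>S\<close> the whole space or the closed half space
  \<open>[1,\<infinity>) \<times> \<real>\<^sup>2\<close>, where the derivative within \<open>S\<close> is unique.
\<close>

primrec Ck_on :: "nat \<Rightarrow> 'a::euclidean_space set \<Rightarrow> ('a \<Rightarrow> 'b::real_normed_vector) \<Rightarrow> bool" where
  "Ck_on 0 S f \<longleftrightarrow> continuous_on S f"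
| "Ck_on (Suc k) S f \<longleftrightarrow>
     f differentiable_on S \<and> (\<forall>b\<in>Basis. Ck_on k S (\<lambda>x. frechet_derivative f (at x within S) b))"

definition partial :: "2 \<Rightarrow> (real^2 \<Rightarrow> 'b::real_normed_vector) \<Rightarrow> real^2 \<Rightarrow> 'b" where
  "partial i f x = frechet_derivative f (at x) (axis i 1)"

definition gradient :: "(real^2 \<Rightarrow> real) \<Rightarrow> real^2 \<Rightarrow> real^2" where
  "gradient f x = (\<chi> i. partial i f x)"

definition laplacian :: "(real^2 \<Rightarrow> 'b::real_normed_vector) \<Rightarrow> real^2 \<Rightarrow> 'b" where
  "laplacian f x = (\<Sum>i\<in>UNIV. partial i (partial i f) x)"

text \<open>Functions of \<open>(t,x)\<close> live on \<open>[1,\<infinity>) \<times> \<real>\<^sup>2\<close>; the time derivative at \<open>t = 1\<close> is one-sided.\<close>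

definition time_deriv ::
    "(real \<Rightarrow> real^2 \<Rightarrow> 'b::real_normed_vector) \<Rightarrow> real \<Rightarrow> real^2 \<Rightarrow> 'b" where
  "time_deriv u t x = vector_derivative (\<lambda>s. u s x) (at t within {1..})"

definition neg_box ::
    "(real \<Rightarrow> real^2 \<Rightarrow> 'b::real_normed_vector) \<Rightarrow> real \<Rightarrow> real^2 \<Rightarrow> 'b" where
  "neg_box u t x = time_deriv (time_deriv u) t x - laplacian (u t) x"

definition spacetime_grad ::
    "(real \<Rightarrow> real^2 \<Rightarrow> real) \<Rightarrow> real \<Rightarrow> real^2 \<Rightarrow> real \<times> (real^2)" where
  "spacetime_grad u t x = (time_deriv u t x, gradient (u t) x)"

section \<open>\<open>L\<^sup>2\<close> norms, weak derivatives and Sobolev norms\<close>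

definition L2 :: "(real^2 \<Rightarrow> 'b::euclidean_space) \<Rightarrow> bool" where
  "L2 f \<longleftrightarrow> f \<in> borel_measurable lborel \<and> integrable lborel (\<lambda>x. (norm (f x))\<^sup>2)"

text \<open>Meaningful only when the square is integrable (otherwise the value is \<open>0\<close>).\<close>

definition L2norm :: "(real^2 \<Rightarrow> 'b::euclidean_space) \<Rightarrow> real" where
  "L2norm f = sqrt (LINT x|lborel. (norm (f x))\<^sup>2)"

definition locally_integrable :: "(real^2 \<Rightarrow> 'b::euclidean_space) \<Rightarrow> bool" where
  "locally_integrable f \<longleftrightarrow> (\<forall>K. compact K \<longrightarrow> set_integrable lborel K f)"

definition test_function :: "(real^2 \<Rightarrow> real) \<Rightarrow> bool" where
  "test_function \<phi> \<longleftrightarrow> (\<forall>k. Ck_on k UNIV \<phi>) \<and> compact (closure {x. \<phi> x \<noteq> 0})"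

text \<open>Multi-indices are pairs \<open>I = (a,b)\<close>, with \<open>\<nabla>\<^sup>I = \<partial>\<^sub>1\<^sup>a \<partial>\<^sub>2\<^sup>b\<close> and \<open>|I| = a + b\<close>.\<close>

definition mi_order :: "nat \<times> nat \<Rightarrow> nat" where
  "mi_order I = fst I + snd I"

definition multi_partial ::
    "nat \<times> nat \<Rightarrow> (real^2 \<Rightarrow> 'b::real_normed_vector) \<Rightarrow> real^2 \<Rightarrow> 'b" where
  "multi_partial I f = (partial 1 ^^ fst I) ((partial 2 ^^ snd I) f)"

definition has_weak_deriv ::
    "(real^2 \<Rightarrow> 'b::euclidean_space) \<Rightarrow> nat \<times> nat \<Rightarrow> (real^2 \<Rightarrow> 'b) \<Rightarrow> bool" where
  "has_weak_deriv f I g \<longleftrightarrow> locally_integrable f \<and> locally_integrable g \<and>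
     (\<forall>\<phi>. test_function \<phi> \<longrightarrow>
        (LINT x|lborel. multi_partial I \<phi> x *\<^sub>R f x) =
          (- 1) ^ mi_order I *\<^sub>R (LINT x|lborel. \<phi> x *\<^sub>R g x))"

text \<open>A weak derivative is unique up to null sets, so norms do not depend on the choice made here.\<close>

definition weak_deriv ::
    "nat \<times> nat \<Rightarrow> (real^2 \<Rightarrow> 'b::euclidean_space) \<Rightarrow> real^2 \<Rightarrow> 'b" where
  "weak_deriv I f = (SOME g. has_weak_deriv f I g)"

text \<open>
  The norm \<open>\<Sum>\<^bsub>|I| \<le> m\<^esub> \<parallel>\<langle>x\<rangle>\<^bsup>w |I|\<^esup> \<nabla>\<^sup>I f\<parallel>\<close>, and the predicate that all its terms exist and are finite.
\<close>

definition in_weighted_sobolev ::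
    "(nat \<Rightarrow> nat) \<Rightarrow> nat \<Rightarrow> (real^2 \<Rightarrow> 'b::euclidean_space) \<Rightarrow> bool" where
  "in_weighted_sobolev w m f \<longleftrightarrow> (\<forall>I. mi_order I \<le> m \<longrightarrow>
     (\<exists>g. has_weak_deriv f I g) \<and>
     L2 (\<lambda>x. japanese x ^ w (mi_order I) *\<^sub>R weak_deriv I f x))"

definition weighted_sobolev_norm ::
    "(nat \<Rightarrow> nat) \<Rightarrow> nat \<Rightarrow> (real^2 \<Rightarrow> 'b::euclidean_space) \<Rightarrow> real" where
  "weighted_sobolev_norm w m f =
     (\<Sum>I | mi_order I \<le> m. L2norm (\<lambda>x. japanese x ^ w (mi_order I) *\<^sub>R weak_deriv I f x))"

definition in_H :: "nat \<Rightarrow> (real^2 \<Rightarrow> 'b::euclidean_space) \<Rightarrow> bool" where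
  "in_H m f \<longleftrightarrow> (\<forall>I. mi_order I \<le> m \<longrightarrow> (\<exists>g. has_weak_deriv f I g) \<and> L2 (weak_deriv I f))"

definition Hnorm :: "nat \<Rightarrow> (real^2 \<Rightarrow> 'b::euclidean_space) \<Rightarrow> real" where
  "Hnorm m f = sqrt (\<Sum>I | mi_order I \<le> m. (L2norm (weak_deriv I f))\<^sup>2)"

section \<open>The Klein-Gordon-Zakharov system\<close>

definition small_data :: "nat \<Rightarrow> real \<Rightarrow> (real^2 \<Rightarrow> real) \<Rightarrow> (real^2 \<Rightarrow> real) \<Rightarrow>
    (real^2 \<Rightarrow> real^2) \<Rightarrow> (real^2 \<Rightarrow> real^2) \<Rightarrow> bool" where
  "small_data N \<epsilon> n0 n1 E0 E1 \<longleftrightarrow>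
     in_weighted_sobolev (\<lambda>k. k + 3) (N + 1) n0 \<and>
     in_weighted_sobolev (\<lambda>k. k + 3) N n1 \<and>
     in_weighted_sobolev (\<lambda>k. 15) (N + 2) E0 \<and>
     in_weighted_sobolev (\<lambda>k. 15) (N + 1) E1 \<and>
     weighted_sobolev_norm (\<lambda>k. k + 3) (N + 1) n0 +
     weighted_sobolev_norm (\<lambda>k. k + 3) N n1 +
     weighted_sobolev_norm (\<lambda>k. 15) (N + 2) E0 +
     weighted_sobolev_norm (\<lambda>k. 15) (N + 1) E1 < \<epsilon>"

text \<open>
  Classical solutions on \<open>[1,\<infinity>) \<times> \<real>\<^sup>2\<close>: at the regularity of the data the solution is of class
  \<open>C\<^sup>2\<close> by Sobolev embedding. The data are Sobolev functions, hence determined up to null sets, and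
  are attained in this sense.
\<close>

definition kgz_solution :: "(real^2 \<Rightarrow> real) \<Rightarrow> (real^2 \<Rightarrow> real) \<Rightarrow>
    (real^2 \<Rightarrow> real^2) \<Rightarrow> (real^2 \<Rightarrow> real^2) \<Rightarrow>
    (real \<Rightarrow> real^2 \<Rightarrow> real) \<Rightarrow> (real \<Rightarrow> real^2 \<Rightarrow> real^2) \<Rightarrow> bool" where
  "kgz_solution n0 n1 E0 E1 n E \<longleftrightarrow>
     Ck_on 2 ({1..} \<times> UNIV) (\<lambda>(t, x). n t x) \<and>
     Ck_on 2 ({1..} \<times> UNIV) (\<lambda>(t, x). E t x) \<and>
     (\<forall>t\<ge>1. \<forall>x. neg_box n t x = laplacian (\<lambda>y. (norm (E t y))\<^sup>2) x) \<and>
     (\<forall>t\<ge>1. \<forall>x. neg_box E t x + E t x = - (n t x *\<^sub>R E t x)) \<and>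
     (AE x in lborel. n 1 x = n0 x \<and> time_deriv n 1 x = n1 x \<and>
                      E 1 x = E0 x \<and> time_deriv E 1 x = E1 x)"

definition kgz_bounds :: "nat \<Rightarrow> real \<Rightarrow> real \<Rightarrow>
    (real \<Rightarrow> real^2 \<Rightarrow> real) \<Rightarrow> (real \<Rightarrow> real^2 \<Rightarrow> real^2) \<Rightarrow> bool" where
  "kgz_bounds N C' \<epsilon> n E \<longleftrightarrow> (\<forall>t\<ge>1.
     (\<forall>x. \<bar>n t x\<bar> \<le> C' * \<epsilon> * japanese (t + norm x) powr (- 1/2)
                                  * japanese (t - norm x) powr (- 1/2)) \<and>
     (\<forall>x. norm (E t x) \<le> C' * \<epsilon> * japanese (t + norm x) powr (- 1)) \<and>
     in_H N (spacetime_grad n t) \<and> in_H (N + 2) (E t) \<and> in_H (N + 1) (time_deriv E t) \<and>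
     Hnorm N (spacetime_grad n t) + Hnorm (N + 2) (E t) + Hnorm (N + 1) (time_deriv E t)
       \<le> C' * \<epsilon>)"

end

theory Submission
  imports Defs "HOL-Computational_Algebra.Polynomial"
begin

text \<open>
  The lower bound is obtained by duality. For \<open>a > 0\<close> the function
  \<open>Re (log (z + sqrt (z\<^sup>2 + |x|\<^sup>2)))\<close>, \<open>z = a - i s\<close>, solves the free wave equation in \<open>(s, x)\<close>. Take
  \<open>a = sqrt t\<close> and let \<open>w\<close> be half the difference of its values at times \<open>2t - s\<close> and \<open>s\<close>: a wave that
  vanishes at \<open>s = t\<close>. The pairing of \<open>(n, \<partial>\<^sub>t n)\<close> with
  \<open>(\<partial>\<^sub>s w, w)\<close> changes only through \<open>\<integral> |E|\<^sup>2 \<Delta> w\<close>, and \<open>|\<Delta> w| \<le> 1/t\<close>, so that it varies by a bounded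
  amount on \<open>[1, t]\<close>. At \<open>s = 1\<close> it equals \<open>(log t)/4 * \<integral> n\<^sub>1\<close> up to a bounded error, because \<open>w\<close> is
  almost constant on the region where the data live. At \<open>s = t\<close> it is at most
  \<open>\<parallel>n(t)\<parallel> \<parallel>\<partial>\<^sub>s w(t)\<parallel>\<close>, and an explicit radial integral gives \<open>\<parallel>\<partial>\<^sub>s w(t)\<parallel>\<^sup>2 = (\<pi>/2) log (1 + t)\<close>.
  Dividing yields the growth \<open>(log t)\<^bsup>1/2\<^esup>\<close>. Since \<open>n\<close> decays only like \<open>1/|x|\<close>, the pairing is truncated
  at radius \<open>sqrt S\<close>, and \<open>S\<close> is sent to infinity. The junk value of \<open>L2norm\<close> on functions that are not
  square integrable makes it necessary to show that \<open>n(t)\<close> is square integrable.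
\<close>


subsection \<open>Classes of continuously differentiable functions\<close>

text \<open>As a tends to 0, the time derivative of the wave tends, for s > 0, to (s^2 -
  |x|^2)^(-1/2) inside the light cone and to 0 outside. This is 2 pi times the fundamental solution
  of the planar wave operator. Its square just fails to be integrable at the cone, so smoothing at
  scale a makes the squared norm a logarithm of s/a: this accounts for the half power of log t. The
  scale a balances two demands. Over [1, t] the source contributes at most t / a^2 times a bound for
  the integral of |E|^2, which stays bounded if a is at least of order sqrt t. The value of w at s =
  1 and x = 0 is about log (2t/a) / 2, which remains a multiple of log t as long as a is at most a
  power of t with exponent below 1. The choice a = sqrt t meets both. The equation says that the
  second time derivative of n is the Laplacian of n + |E|^2, so it is the decay of this sum that
  controls the truncation.\<close>

lemma Ck_on_cong:
  assumes "\<And>x. x \<in> S \<Longrightarrow> f x = g x"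
  shows "Ck_on k S f \<longleftrightarrow> Ck_on k S g"
  using assms
proof (induction k arbitrary: f g)
  case 0
  then show ?case by (simp cong: continuous_on_cong)
next
  case (Suc k)
  have hd: "(f has_derivative D) (at x within S) \<longleftrightarrow> (g has_derivative D) (at x within S)" if "x \<in> S" for x D
    using has_derivative_transform[of x S f g D] has_derivative_transform[of x S g f D] Suc.prems that by auto
  then have fd: "frechet_derivative f (at x within S) = frechet_derivative g (at x within S)" if "x \<in> S" for x
    using that by (simp add: frechet_derivative_def)
  have "f differentiable_on S \<longleftrightarrow> g differentiable_on S"
    using hd by (simp add: differentiable_on_def differentiable_def)
  moreover have "Ck_on k S (\<lambda>x. frechet_derivative f (at x within S) b)
      \<longleftrightarrow> Ck_on k S (\<lambda>x. frechet_derivative g (at x within S) b)" for b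
    by (rule Suc.IH) (simp add: fd)
  ultimately show ?case by simp
qed

lemma Ck_on_Suc_imp: "Ck_on (Suc k) S f \<Longrightarrow> Ck_on k S f"
proof (induction k arbitrary: f)
  case 0
  then show ?case by (simp add: differentiable_imp_continuous_on)
next
  case (Suc k)
  then show ?case by (metis Ck_on.simps(2))
qed

text \<open>The condition that makes derivatives within \<open>S\<close> unique.\<close>

definition axis_accessible :: "'a::euclidean_space set \<Rightarrow> bool" where
  "axis_accessible S \<longleftrightarrow>
     (\<forall>x\<in>S. \<forall>i\<in>Basis. \<forall>e>0. \<exists>d. 0 < \<bar>d\<bar> \<and> \<bar>d\<bar> < e \<and> x + d *\<^sub>R i \<in> S)"

lemma axis_accessible_UNIV [simp]: "axis_accessible UNIV"
  unfolding axis_accessible_def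
proof (intro ballI allI impI)
  fix x i :: 'a and e :: real assume "0 < e"
  then show "\<exists>d. 0 < \<bar>d\<bar> \<and> \<bar>d\<bar> < e \<and> x + d *\<^sub>R i \<in> UNIV"
    by (intro exI[of _ "e/2"]) auto
qed

lemma axis_accessible_halfspace [simp]: "axis_accessible ({1..} \<times> (UNIV :: 'a::euclidean_space set) :: (real \<times> 'a) set)"
  unfolding axis_accessible_def
proof (intro ballI allI impI)
  fix x :: "real \<times> 'a" and i :: "real \<times> 'a" and e :: real
  assume "x \<in> {1..} \<times> UNIV" "i \<in> Basis" "0 < e"
  then show "\<exists>d. 0 < \<bar>d\<bar> \<and> \<bar>d\<bar> < e \<and> x + d *\<^sub>R i \<in> {1..} \<times> UNIV"
    by (intro exI[of _ "e/2"]) (auto simp: Basis_prod_def)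
qed

lemma frechet_derivative_within_eq:
  assumes "axis_accessible S" "x \<in> S" "(f has_derivative D) (at x within S)"
  shows "frechet_derivative f (at x within S) = D"
proof (rule frechet_derivative_unique_within[OF _ assms(3)])
  show "(f has_derivative frechet_derivative f (at x within S)) (at x within S)"
    using assms(3) by (metis differentiableI frechet_derivative_works)
  show "\<exists>d. 0 < \<bar>d\<bar> \<and> \<bar>d\<bar> < e \<and> x + d *\<^sub>R i \<in> S" if "i \<in> Basis" "e > 0" for i e
    using assms(1,2) that unfolding axis_accessible_def by blast
qed

text \<open>\<open>Ck_on\<close> speaks of a chosen derivative; since derivatives within
  \<open>S\<close> are unique by \<open>axis_accessible\<close>, any explicit family
  \<open>D\<close> may take its place. Smoothness proofs thereby become inductions on
  \<open>k\<close>.\<close>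

lemma Ck_on_SucI:
  assumes "axis_accessible S"
    and "\<And>x. x \<in> S \<Longrightarrow> (f has_derivative D x) (at x within S)"
    and "\<And>b. b \<in> Basis \<Longrightarrow> Ck_on k S (\<lambda>x. D x b)"
  shows "Ck_on (Suc k) S f"
proof -
  have "frechet_derivative f (at x within S) = D x" if "x \<in> S" for x
    using frechet_derivative_within_eq assms that by blast
  then have "Ck_on k S (\<lambda>x. frechet_derivative f (at x within S) b) \<longleftrightarrow> Ck_on k S (\<lambda>x. D x b)" for b
    by (intro Ck_on_cong) simp
  then show ?thesis
    using assms(2,3) by (auto simp: differentiable_on_def intro: differentiableI)
qed

lemma Ck_on_const: "axis_accessible S \<Longrightarrow> Ck_on k S (\<lambda>x. c)"
proof (induction k arbitrary: c)
  case (Suc k)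
  then show ?case by (intro Ck_on_SucI[where D = "\<lambda>x h. 0"]) (auto intro!: derivative_eq_intros)
qed simp

lemma Ck_on_add:
  assumes "axis_accessible S"
  shows "Ck_on k S f \<Longrightarrow> Ck_on k S g \<Longrightarrow> Ck_on k S (\<lambda>x. f x + g x)"
proof (induction k arbitrary: f g)
  case 0
  then show ?case by (auto intro: continuous_intros)
next
  case (Suc k)
  show ?case
  proof (rule Ck_on_SucI[OF assms])
    fix x assume "x \<in> S"
    then show "((\<lambda>x. f x + g x) has_derivative (\<lambda>h. frechet_derivative f (at x within S) h
        + frechet_derivative g (at x within S) h)) (at x within S)"
      using Suc.prems by (intro has_derivative_add) (auto simp: differentiable_on_def frechet_derivative_works)
  qed (use Suc in auto)
qed

text \<open>A general bounded product covers both uses: products of bump factors, and the inner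
  product that gives |E|^2.\<close>

lemma Ck_on_bilinear:
  fixes f :: "'d::euclidean_space \<Rightarrow> 'a::real_normed_vector" and g :: "'d \<Rightarrow> 'b::real_normed_vector"
    and prod :: "'a \<Rightarrow> 'b \<Rightarrow> 'c::real_normed_vector"
  assumes "bounded_bilinear prod" and "axis_accessible S"
  shows "Ck_on k S f \<Longrightarrow> Ck_on k S g \<Longrightarrow> Ck_on k S (\<lambda>x. prod (f x) (g x))"
proof (induction k arbitrary: f g)
  case 0
  then show ?case by (auto intro: bounded_bilinear.continuous_on[OF assms(1)])
next
  case (Suc k)
  have f: "Ck_on k S f" and g: "Ck_on k S g"
    using Suc.prems Ck_on_Suc_imp by blast+
  show ?case
  proof (rule Ck_on_SucI[OF assms(2)])
    fix x assume "x \<in> S"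
    then show "((\<lambda>x. prod (f x) (g x)) has_derivative (\<lambda>h. prod (f x) (frechet_derivative g (at x within S) h)
        + prod (frechet_derivative f (at x within S) h) (g x))) (at x within S)"
      using Suc.prems by (intro bounded_bilinear.FDERIV[OF assms(1)]) (auto simp: differentiable_on_def frechet_derivative_works)
  next
    fix b :: 'd assume "b \<in> Basis"
    then show "Ck_on k S (\<lambda>x. prod (f x) (frechet_derivative g (at x within S) b)
        + prod (frechet_derivative f (at x within S) b) (g x))"
      using Suc f g by (intro Ck_on_add[OF assms(2)] Suc.IH) auto
  qed
qed

subsection \<open>Time and space derivatives on the closed half space\<close>

abbreviation halfspace :: "(real \<times> (real^2)) set" where "halfspace \<equiv> {1..} \<times> UNIV"

abbreviation Ck_half :: "nat \<Rightarrow> (real \<Rightarrow> real^2 \<Rightarrow> 'b::real_normed_vector) \<Rightarrow> bool" where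
  "Ck_half k u \<equiv> Ck_on k halfspace (\<lambda>(t, x). u t x)"

text \<open>All claims come from one derivative \<open>F\<close> within the half space, composed
  with the curve s -> (s, x) and with the slice y -> (t, y). The slice is the whole plane, so space
  derivatives are two-sided even at t = 1.\<close>

lemma Ck_half_derivs:
  fixes u :: "real \<Rightarrow> real^2 \<Rightarrow> 'b::real_normed_vector"
  assumes "Ck_half (Suc k) u"
  shows has_time_deriv: "t \<ge> 1 \<Longrightarrow> ((\<lambda>s. u s x) has_vector_derivative time_deriv u t x) (at t within {1..})"
    and slice_differentiable: "t \<ge> 1 \<Longrightarrow> u t differentiable (at x)"
    and Ck_half_time_deriv: "Ck_half k (time_deriv u)"
    and Ck_half_partial: "Ck_half k (\<lambda>t. partial i (u t))"
proof -
  define F where "F p = frechet_derivative (\<lambda>(t, x). u t x) (at p within halfspace)" for p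
  have F: "((\<lambda>(t, x). u t x) has_derivative F p) (at p within halfspace)" if "p \<in> halfspace" for p
    using assms that by (auto simp: F_def differentiable_on_def frechet_derivative_works)
  have F_lin: "linear (F p)" if "p \<in> halfspace" for p
    using F[OF that] has_derivative_linear by blast
  have time: "((\<lambda>s. u s x) has_vector_derivative F (t, x) (1, 0)) (at t within {1..})" if "t \<ge> 1" for t x
  proof -
    have "((\<lambda>(t, x). u t x) \<circ> (\<lambda>s. (s, x)) has_derivative F (t, x) \<circ> (\<lambda>h. (h, 0))) (at t within {1..})"
    proof (rule diff_chain_within)
      show "((\<lambda>s. (s, x)) has_derivative (\<lambda>h. (h, 0))) (at t within {1..})"
        by (auto intro!: derivative_eq_intros)
      show "((\<lambda>(t, x). u t x) has_derivative F (t, x)) (at (t, x) within (\<lambda>s. (s, x)) ` {1..})"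
        by (rule has_derivative_subset[OF F]) (use that in auto)
    qed
    moreover have "F (t, x) \<circ> (\<lambda>h. (h, 0)) = (\<lambda>h. h *\<^sub>R F (t, x) (1, 0))"
    proof
      fix h
      have "F (t, x) (h *\<^sub>R (1, 0)) = h *\<^sub>R F (t, x) (1, 0)"
        by (rule linear_scale[OF F_lin]) (use that in simp)
      then show "(F (t, x) \<circ> (\<lambda>h. (h, 0))) h = h *\<^sub>R F (t, x) (1, 0)" by simp
    qed
    ultimately show ?thesis by (simp only: has_vector_derivative_def o_def prod.case)
  qed
  have td: "time_deriv u t x = F (t, x) (1, 0)" if "t \<ge> 1" for t x
    unfolding time_deriv_def
  proof (rule vector_derivative_within[OF _ time[OF that]])
    \<comment> \<open>A vector derivative within a set is unique only at a limit point; points to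
      the right of \<open>t\<close> suffice, which includes the endpoint t = 1.\<close>
    have "t islimpt {t<..<t+1}" by (simp add: islimpt_greaterThanLessThan1)
    then have "t islimpt {1..}" by (rule islimpt_subset) (use that in auto)
    then show "at t within {1..} \<noteq> bot" by (simp add: trivial_limit_within)
  qed
  show "((\<lambda>s. u s x) has_vector_derivative time_deriv u t x) (at t within {1..})" if "t \<ge> 1" for t x
    using time td that by simp
  have space: "(u t has_derivative (\<lambda>h. F (t, x) (0, h))) (at x)" if "t \<ge> 1" for t x
  proof -
    have "((\<lambda>(t, x). u t x) \<circ> (\<lambda>y. (t, y)) has_derivative F (t, x) \<circ> (\<lambda>h. (0, h))) (at x within UNIV)"
    proof (rule diff_chain_within)
      show "((\<lambda>y. (t, y)) has_derivative (\<lambda>h. (0, h))) (at x within UNIV)"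
        by (auto intro!: derivative_eq_intros)
      show "((\<lambda>(t, x). u t x) has_derivative F (t, x)) (at (t, x) within (\<lambda>y. (t, y)) ` UNIV)"
        by (rule has_derivative_subset[OF F]) (use that in auto)
    qed
    then show ?thesis by (simp add: o_def)
  qed
  then show "u t differentiable (at x)" if "t \<ge> 1" for t x
    using that differentiableI by blast
  have pd: "partial i (u t) x = F (t, x) (0, axis i 1)" if "t \<ge> 1" for i t x
    unfolding partial_def using frechet_derivative_at[OF space[OF that]] by metis
  have B: "(1, 0) \<in> (Basis :: (real \<times> (real^2)) set)" "(0, axis i 1) \<in> (Basis :: (real \<times> (real^2)) set)" for i
    by (auto simp: Basis_prod_def Basis_vec_def)
  have "Ck_on k halfspace (\<lambda>p. F p b)" if "b \<in> Basis" for b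
    using assms that by (simp add: F_def)
  note this[OF B(1)] this[OF B(2), of i]
  moreover have "Ck_half k (time_deriv u) \<longleftrightarrow> Ck_on k halfspace (\<lambda>p. F p (1, 0))"
    by (rule Ck_on_cong) (auto simp: td)
  moreover have "Ck_half k (\<lambda>t. partial i (u t)) \<longleftrightarrow> Ck_on k halfspace (\<lambda>p. F p (0, axis i 1))"
    by (rule Ck_on_cong) (auto simp: pd)
  ultimately show "Ck_half k (time_deriv u)" "Ck_half k (\<lambda>t. partial i (u t))" by simp_all
qed

lemma Ck_half_continuous: "Ck_half k u \<Longrightarrow> continuous_on halfspace (\<lambda>(t, x). u t x)"
  by (cases k) (auto simp: differentiable_imp_continuous_on)

lemma partial_line_derivative:
  fixes f :: "real^2 \<Rightarrow> 'b::real_normed_vector"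
  assumes "f differentiable (at x)"
  shows "((\<lambda>\<tau>. f (x + \<tau> *\<^sub>R axis i 1)) has_vector_derivative partial i f x) (at 0)"
proof -
  have "(f has_derivative frechet_derivative f (at x)) (at (x + 0 *\<^sub>R axis i 1))"
    using assms by (simp add: frechet_derivative_works)
  then have "((\<lambda>\<tau>. f (x + \<tau> *\<^sub>R axis i 1)) has_derivative
      (\<lambda>h. frechet_derivative f (at x) (h *\<^sub>R axis i 1))) (at 0)"
    by (rule has_derivative_compose[rotated]) (auto intro!: derivative_eq_intros)
  then show ?thesis
    using linear_scale[OF linear_frechet_derivative[OF assms]]
    by (simp add: has_vector_derivative_def partial_def)
qed

subsection \<open>Integration by parts\<close>

text \<open>The derivative is known at parameter 0 for every base point; moving the base point along
  the line gives it at every parameter.\<close>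

lemma line_derivative_shift:
  fixes f :: "'a::real_vector \<Rightarrow> real"
  assumes "\<And>x. ((\<lambda>\<tau>. f (x + \<tau> *\<^sub>R e)) has_vector_derivative f' x) (at 0)"
  shows "((\<lambda>\<tau>. f (x + \<tau> *\<^sub>R e)) has_real_derivative f' (x + s *\<^sub>R e)) (at s)"
proof -
  have "((\<lambda>\<tau>. f ((x + s *\<^sub>R e) + \<tau> *\<^sub>R e)) has_real_derivative f' (x + s *\<^sub>R e)) (at 0)"
    using assms by (simp add: has_real_derivative_iff_has_vector_derivative)
  then show ?thesis
    using DERIV_shift[of "\<lambda>\<tau>. f (x + \<tau> *\<^sub>R e)" "f' (x + s *\<^sub>R e)" 0 s] by (simp add: algebra_simps)
qed

text \<open>Translation invariance of Lebesgue measure makes the integral of each difference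
  quotient 0, and dominated convergence passes to the derivative. No iterated integrals
  enter.\<close>

lemma integral_line_derivative_eq_0:
  fixes f f' :: "'a::euclidean_space \<Rightarrow> real"
  assumes deriv: "\<And>x. ((\<lambda>\<tau>. f (x + \<tau> *\<^sub>R e)) has_vector_derivative f' x) (at 0)"
    and cont: "continuous_on UNIV f" "continuous_on UNIV f'"
    and supp: "\<And>x. norm x > R \<Longrightarrow> f x = 0"
    and e: "norm e = 1"
  shows "(LINT x|lborel. f' x) = 0"
proof -
  note deriv' = line_derivative_shift[OF deriv]
  have "compact (f' ` cball 0 (R + 1))"
    using cont(2) by (intro compact_continuous_image) (auto intro: continuous_on_subset)
  then obtain B where B: "\<And>x. x \<in> cball 0 (R + 1) \<Longrightarrow> \<bar>f' x\<bar> \<le> B"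
    by (metis bounded_real compact_imp_bounded image_eqI)
  \<comment> \<open>Outside the closed ball \<open>f\<close> vanishes near the point, so its line
    derivative there is 0.\<close>
  have f'0: "f' x = 0" if "norm x > R" for x
  proof -
    have "eventually (\<lambda>\<tau>. norm (x + \<tau> *\<^sub>R e) > R) (at 0)"
      by (rule order_tendstoD(1)[of _ "norm x"]) (use that in \<open>auto intro!: tendsto_eq_intros\<close>)
    then have "eventually (\<lambda>\<tau>. f (x + \<tau> *\<^sub>R e) = 0) (nhds 0)"
      using supp that by (auto simp: eventually_nhds_conv_at elim!: eventually_mono)
    then have "((\<lambda>\<tau>. f (x + \<tau> *\<^sub>R e)) has_real_derivative 0) (at 0)"
      using DERIV_cong_ev[of 0 0 "\<lambda>\<tau>. f (x + \<tau> *\<^sub>R e)" "\<lambda>_. 0" 0 0] by simp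
    then show ?thesis
      using deriv[of x] vector_derivative_unique_at
      by (metis has_real_derivative_iff_has_vector_derivative)
  qed
  define d where "d k = inverse (real (Suc k))" for k
  have d: "d k > 0" "d k \<le> 1" "d k \<noteq> 0" for k by (auto simp: d_def field_simps)
  have d0: "d \<longlonglongrightarrow> 0" unfolding d_def by (rule LIMSEQ_inverse_real_of_nat)
  define q where "q k x = (f (x + d k *\<^sub>R e) - f x) / d k" for k x
  have int_f: "integrable lborel f"
  proof -
    have "integrable lborel (\<lambda>x. indicator (cball 0 R) x *\<^sub>R f x)"
      using borel_integrable_compact[of "cball 0 R" f] cont(1) by (auto intro: continuous_on_subset)
    moreover have "(\<lambda>x. indicator (cball 0 R) x *\<^sub>R f x) = f"
      using supp by (force simp: indicator_def not_le)
    ultimately show ?thesis by simp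
  qed
  have shift: "(LINT x|lborel. f (x + a)) = (LINT x|lborel. f x)" "integrable lborel (\<lambda>x. f (x + a))" for a
  proof -
    have "(LINT x|lborel. f (x + a)) = (LINT x|distr lborel borel ((+) a). f x)"
      using cont(1) by (subst integral_distr) (auto simp: add.commute borel_measurable_continuous_onI)
    then show "(LINT x|lborel. f (x + a)) = (LINT x|lborel. f x)" by (simp add: lborel_distr_plus)
    have "integrable (distr lborel borel ((+) a)) f" using int_f by (simp add: lborel_distr_plus)
    then show "integrable lborel (\<lambda>x. f (x + a))"
      using cont(1) by (subst (asm) integrable_distr_eq) (auto simp: add.commute borel_measurable_continuous_onI)
  qed
  have "(LINT x|lborel. q k x) = 0" for k
    unfolding q_def using shift int_f by simp
  moreover have "(\<lambda>k. LINT x|lborel. q k x) \<longlonglongrightarrow> (LINT x|lborel. f' x)"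
  proof (rule integral_dominated_convergence[where w = "\<lambda>x. indicator (cball 0 (R + 1)) x *\<^sub>R B"])
    show "f' \<in> borel_measurable lborel" using cont(2) by (simp add: borel_measurable_continuous_onI)
    have [measurable]: "f \<in> borel_measurable borel" using cont(1) by (simp add: borel_measurable_continuous_onI)
    show "q k \<in> borel_measurable lborel" for k unfolding q_def by simp
    show "integrable lborel (\<lambda>x. indicator (cball 0 (R + 1)) x *\<^sub>R B)"
      by (rule borel_integrable_compact) auto
    show "AE x in lborel. (\<lambda>k. q k x) \<longlonglongrightarrow> f' x"
    proof (rule AE_I2)
      fix x
      have "((\<lambda>h. (f (x + h *\<^sub>R e) - f x) / h) \<longlongrightarrow> f' x) (at 0)"
        using deriv'[of x 0] by (simp add: DERIV_def)
      moreover have "filterlim d (at 0) sequentially"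
        using d0 d by (simp add: filterlim_at)
      ultimately show "(\<lambda>k. q k x) \<longlonglongrightarrow> f' x"
        unfolding q_def by (rule filterlim_compose)
    qed
    show "AE x in lborel. norm (q k x) \<le> indicator (cball 0 (R + 1)) x *\<^sub>R B" for k
    proof (rule AE_I2)
      fix x
      \<comment> \<open>The mean value theorem turns the quotient into a value of \<open>f'\<close>
        at distance less than 1 from \<open>x\<close>; hence the bound \<open>B\<close> and the
        radius \<open>R + 1\<close>, both independent of \<open>k\<close>.\<close>
      obtain \<xi> where xi: "0 < \<xi>" "\<xi> < d k" "f (x + d k *\<^sub>R e) - f (x + 0 *\<^sub>R e) = (d k - 0) * f' (x + \<xi> *\<^sub>R e)"
        using MVT2[of 0 "d k" "\<lambda>\<tau>. f (x + \<tau> *\<^sub>R e)" "\<lambda>s. f' (x + s *\<^sub>R e)"] d deriv' by metis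
      then have q: "q k x = f' (x + \<xi> *\<^sub>R e)" using d by (simp add: q_def)
      show "norm (q k x) \<le> indicator (cball 0 (R + 1)) x *\<^sub>R B"
      proof (cases "norm x \<le> R + 1")
        case True
        have "\<bar>f' (x + \<xi> *\<^sub>R e)\<bar> \<le> B"
        proof (cases "norm (x + \<xi> *\<^sub>R e) \<le> R")
          case True then show ?thesis by (intro B) auto
        next
          case False
          then show ?thesis using f'0 B[of x] True \<open>norm x \<le> R + 1\<close> by force
        qed
        then show ?thesis using q True by simp
      next
        case False
        have "norm x - norm (\<xi> *\<^sub>R e) \<le> norm (x + \<xi> *\<^sub>R e)" by (rule norm_diff_ineq)
        then have "norm (x + \<xi> *\<^sub>R e) > R" using e xi d(2)[of k] False by simp
        then show ?thesis using q f'0 False by simp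
      qed
    qed
  qed
  ultimately show ?thesis by (simp add: LIMSEQ_const_iff)
qed

text \<open>\<open>m1 * \<phi> - m * \<phi>1\<close> has line derivative
  \<open>m2 * \<phi> - m * \<phi>2\<close>, so a single use of the vanishing integral performs both
  integrations by parts. The bounded support of the second factor replaces any decay of
  \<open>m\<close>.\<close>

lemma integral_second_line_derivative:
  fixes m m1 m2 \<phi> \<phi>1 \<phi>2 :: "'a::euclidean_space \<Rightarrow> real"
  assumes m1: "\<And>x. ((\<lambda>\<tau>. m (x + \<tau> *\<^sub>R e)) has_vector_derivative m1 x) (at 0)"
    and m2: "\<And>x. ((\<lambda>\<tau>. m1 (x + \<tau> *\<^sub>R e)) has_vector_derivative m2 x) (at 0)"
    and p1: "\<And>x. ((\<lambda>\<tau>. \<phi> (x + \<tau> *\<^sub>R e)) has_vector_derivative \<phi>1 x) (at 0)"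
    and p2: "\<And>x. ((\<lambda>\<tau>. \<phi>1 (x + \<tau> *\<^sub>R e)) has_vector_derivative \<phi>2 x) (at 0)"
    and cont: "continuous_on UNIV m" "continuous_on UNIV m1" "continuous_on UNIV m2"
      "continuous_on UNIV \<phi>" "continuous_on UNIV \<phi>1" "continuous_on UNIV \<phi>2"
    and supp: "\<And>x. norm x > R \<Longrightarrow> \<phi> x = 0 \<and> \<phi>1 x = 0 \<and> \<phi>2 x = 0"
    and e: "norm e = 1"
  shows "integrable lborel (\<lambda>x. m2 x * \<phi> x)" "integrable lborel (\<lambda>x. m x * \<phi>2 x)"
    "(LINT x|lborel. m2 x * \<phi> x) = (LINT x|lborel. m x * \<phi>2 x)"
proof -
  have int: "integrable lborel (\<lambda>x. g x * h x)"
    if "continuous_on UNIV g" "continuous_on UNIV h" "\<And>x. norm x > R \<Longrightarrow> h x = 0" for g h :: "'a \<Rightarrow> real"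
  proof -
    have "integrable lborel (\<lambda>x. indicator (cball 0 R) x *\<^sub>R (g x * h x))"
      using that by (intro borel_integrable_compact) (auto intro!: continuous_intros intro: continuous_on_subset)
    moreover have "(\<lambda>x. indicator (cball 0 R) x *\<^sub>R (g x * h x)) = (\<lambda>x. g x * h x)"
      using that(3) by (force simp: indicator_def not_le)
    ultimately show ?thesis by simp
  qed
  show *: "integrable lborel (\<lambda>x. m2 x * \<phi> x)" "integrable lborel (\<lambda>x. m x * \<phi>2 x)"
    using cont supp by (auto intro!: int)
  have "(LINT x|lborel. m2 x * \<phi> x - m x * \<phi>2 x) = 0"
  proof (rule integral_line_derivative_eq_0[where f = "\<lambda>x. m1 x * \<phi> x - m x * \<phi>1 x" and e = e and R = R])
    fix x
    have "((\<lambda>\<tau>. m1 (x + \<tau> *\<^sub>R e) * \<phi> (x + \<tau> *\<^sub>R e) - m (x + \<tau> *\<^sub>R e) * \<phi>1 (x + \<tau> *\<^sub>R e))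
        has_vector_derivative ((m1 (x + 0 *\<^sub>R e) * \<phi>1 x + m2 x * \<phi> (x + 0 *\<^sub>R e))
          - (m (x + 0 *\<^sub>R e) * \<phi>2 x + m1 x * \<phi>1 (x + 0 *\<^sub>R e)))) (at 0)"
      by (intro has_vector_derivative_diff has_vector_derivative_mult m1 m2 p1 p2)
    then show "((\<lambda>\<tau>. m1 (x + \<tau> *\<^sub>R e) * \<phi> (x + \<tau> *\<^sub>R e) - m (x + \<tau> *\<^sub>R e) * \<phi>1 (x + \<tau> *\<^sub>R e))
        has_vector_derivative (m2 x * \<phi> x - m x * \<phi>2 x)) (at 0)"
      by (simp add: algebra_simps)
  qed (use cont supp e in \<open>auto intro!: continuous_intros\<close>)
  then show "(LINT x|lborel. m2 x * \<phi> x) = (LINT x|lborel. m x * \<phi>2 x)"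
    using * by simp
qed

subsection \<open>Radial functions in the plane\<close>

text \<open>The disc |x|^2 \<le> v has area pi v, so in the variable v = |x|^2 the area element is
  constant. Radial integrals thus reduce to the half line without polar coordinates.\<close>

lemma distr_norm_square:
  "distr lborel borel (\<lambda>x::real^2. (norm x)\<^sup>2) = density lborel (\<lambda>v. ennreal pi * indicator {0..} v)"
  (is "?M = ?N")
proof (rule measure_eqI_generator_eq[where E = "range atMost" and \<Omega> = UNIV and A = "\<lambda>k. {..real k}"])
  show "Int_stable (range atMost :: real set set)" by (auto simp: Int_stable_def)
  have *: "emeasure ?M {..v} = pi * max 0 v" for v
  proof (cases "v \<ge> 0")
    case True
    have "(\<lambda>x::real^2. (norm x)\<^sup>2) -` {..v} = cball 0 (sqrt v)"
      using True by (auto simp: real_le_rsqrt dist_norm) (metis abs_norm_cancel real_sqrt_abs real_sqrt_le_mono real_sqrt_le_iff)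
    then have "emeasure ?M {..v} = emeasure lborel (cball (0::real^2) (sqrt v))"
      by (subst emeasure_distr) auto
    also have "\<dots> = pi * v"
      using True by (subst emeasure_cball) (auto simp: unit_ball_vol_2 ennreal_mult)
    finally show ?thesis using True by simp
  next
    case False
    then have e: "(\<lambda>x::real^2. (norm x)\<^sup>2) -` {..v} = {}"
      by (auto simp: not_le) (smt (verit) zero_le_power2)
    show ?thesis using False by (subst emeasure_distr) (auto simp: e)
  qed
  show "emeasure ?M X = emeasure ?N X" if "X \<in> range atMost" for X
  proof -
    obtain v where X: "X = {..v}" using \<open>X \<in> range atMost\<close> by auto
    have "emeasure ?N X = (\<integral>\<^sup>+u. ennreal pi * indicator {0..v} u \<partial>lborel)"
      unfolding X by (subst emeasure_density) (auto intro!: nn_integral_cong simp: indicator_def)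
    also have "\<dots> = pi * max 0 v"
      by (subst nn_integral_cmult_indicator) (auto simp: ennreal_mult' max_def)
    finally show ?thesis using * X by simp
  qed
  show "sets ?M = sigma_sets UNIV (range atMost)" "sets ?N = sigma_sets UNIV (range atMost)"
    by (auto simp: borel_eq_atMost)
  show "(\<Union>k. {..real k}) = UNIV" using real_arch_simple by auto
  show "emeasure ?M {..real k} \<noteq> \<infinity>" for k by (simp add: *)
qed auto

lemma nn_integral_radial:
  assumes "f \<in> borel_measurable borel"
  shows "(\<integral>\<^sup>+x. f ((norm (x::real^2))\<^sup>2) \<partial>lborel) = ennreal pi * (\<integral>\<^sup>+v. f v * indicator {0..} v \<partial>lborel)"
proof -
  have "(\<integral>\<^sup>+x. f ((norm (x::real^2))\<^sup>2) \<partial>lborel) = (\<integral>\<^sup>+v. f v \<partial>distr lborel borel (\<lambda>x::real^2. (norm x)\<^sup>2))"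
    using assms by (subst nn_integral_distr) auto
  also have "\<dots> = (\<integral>\<^sup>+v. ennreal pi * (f v * indicator {0..} v) \<partial>lborel)"
    using assms by (simp add: distr_norm_square nn_integral_density mult_ac)
  also have "\<dots> = ennreal pi * (\<integral>\<^sup>+v. f v * indicator {0..} v \<partial>lborel)"
    using assms by (subst nn_integral_cmult) auto
  finally show ?thesis .
qed

subsection \<open>Smooth bump functions\<close>

text \<open>The polynomial is there to close the family under differentiation, so that smoothness
  becomes an induction over all \<open>p\<close> at once.\<close>

definition flat_exp :: "real poly \<Rightarrow> real \<Rightarrow> real" where
  "flat_exp p x = (if x > 0 then poly p (1 / x) * exp (- (1 / x)) else 0)"

lemma poly_times_exp_tendsto_0: "((\<lambda>y::real. poly p y * exp (- y)) \<longlongrightarrow> 0) at_top"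
proof -
  have "((\<lambda>y. \<Sum>i\<le>degree p. coeff p i * (y ^ i / exp y)) \<longlongrightarrow> (\<Sum>i\<le>degree p. coeff p i * 0)) at_top"
    by (intro tendsto_sum tendsto_mult tendsto_const tendsto_power_div_exp_0)
  then show ?thesis
    by (simp add: poly_altdef sum_distrib_right exp_minus divide_inverse mult.assoc)
qed

lemma flat_exp_tendsto_0: "((\<lambda>x. flat_exp p x) \<longlongrightarrow> 0) (at 0)"
proof (rule filterlim_split_at_real)
  have "((\<lambda>x. poly p (1/x) * exp (- (1/x))) \<longlongrightarrow> 0) (at_right 0)"
    using filterlim_compose[OF poly_times_exp_tendsto_0 filterlim_inverse_at_top_right, of p]
    by (simp add: inverse_eq_divide)
  then show "(flat_exp p \<longlongrightarrow> 0) (at_right 0)"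
    by (rule Lim_transform_eventually) (auto simp: flat_exp_def eventually_at_filter)
  show "(flat_exp p \<longlongrightarrow> 0) (at_left 0)"
    by (rule Lim_transform_eventually[OF tendsto_const]) (auto simp: flat_exp_def eventually_at_filter)
qed

text \<open>With y = 1/x the operator d/dx is -y^2 d/dy, which sends p(y) exp(-y) to y^2 (p - p')(y)
  exp(-y). At 0 the difference quotient is again of this form, with y p(y) in place of p(y), and
  tends to 0.\<close>

lemma flat_exp_has_derivative:
  "(flat_exp p has_real_derivative flat_exp (monom 1 2 * (p - pderiv p)) x) (at x)"
proof -
  consider "x > 0" | "x < 0" | "x = 0" by linarith
  then show ?thesis
  proof cases
    case 1
    have "((\<lambda>x. poly p (1 / x) * exp (- (1 / x))) has_real_derivative
        flat_exp (monom 1 2 * (p - pderiv p)) x) (at x)"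
      using 1 by (auto intro!: derivative_eq_intros poly_DERIV DERIV_chain2[of "poly p"]
          simp: flat_exp_def poly_monom field_simps power2_eq_square)
    then show ?thesis
      by (rule has_field_derivative_transform_within_open[of _ _ _ "{0<..}"]) (use 1 in \<open>auto simp: flat_exp_def\<close>)
  next
    case 2
    then have "((\<lambda>x. 0) has_real_derivative flat_exp (monom 1 2 * (p - pderiv p)) x) (at x)"
      by (simp add: flat_exp_def)
    then show ?thesis
      by (rule has_field_derivative_transform_within_open[of _ _ _ "{..<0}"]) (use 2 in \<open>auto simp: flat_exp_def\<close>)
  next
    case 3
    have "(flat_exp p h - flat_exp p 0) / h = flat_exp (monom 1 1 * p) h" for h
      by (auto simp: flat_exp_def poly_monom)
    then show ?thesis
      using flat_exp_tendsto_0[of "monom 1 1 * p"] 3 by (simp add: DERIV_def) (simp add: flat_exp_def)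
  qed
qed

lemma Ck_on_flat_exp: "Ck_on k UNIV (\<lambda>x::real^2. flat_exp p (c * x $ i + d))"
proof (induction k arbitrary: p)
  case 0
  have "continuous_on UNIV (flat_exp p)"
    using flat_exp_has_derivative by (meson DERIV_continuous_on has_field_derivative_at_within)
  then show ?case
    by (auto intro!: continuous_intros continuous_on_compose2[of UNIV "flat_exp p"])
next
  case (Suc k)
  show ?case
  proof (rule Ck_on_SucI)
    fix x :: "real^2"
    let ?D = "flat_exp (monom 1 2 * (p - pderiv p)) (c * x $ i + d)"
    have "((\<lambda>x::real^2. c * x $ i + d) has_derivative (\<lambda>h. c * h $ i)) (at x)"
      by (auto intro!: derivative_eq_intros bounded_linear_imp_has_derivative bounded_linear_vec_nth)
    from has_derivative_compose[OF this flat_exp_has_derivative[unfolded has_field_derivative_def]]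
    show "((\<lambda>x. flat_exp p (c * x $ i + d)) has_derivative (\<lambda>h. ?D * (c * h $ i))) (at x within UNIV)"
      by simp
  next
    fix b :: "real^2"
    show "Ck_on k UNIV (\<lambda>x. flat_exp (monom 1 2 * (p - pderiv p)) (c * x $ i + d) * (c * b $ i))"
      by (intro Ck_on_bilinear[OF bounded_bilinear_mult] Suc Ck_on_const) auto
  qed simp
qed

text \<open>Dilating the argument by \<open>Suc k\<close> drives exp (-1/y) to 1 at each interior
  point, so these test functions tend to the indicator of the open box.\<close>

definition box_bump :: "real^2 \<Rightarrow> real^2 \<Rightarrow> nat \<Rightarrow> real^2 \<Rightarrow> real" where
  "box_bump a b k x = (\<Prod>i\<in>UNIV. flat_exp 1 (real (Suc k) * (x $ i - a $ i)) * flat_exp 1 (real (Suc k) * (b $ i - x $ i)))"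

lemma box_bump_range: "0 \<le> box_bump a b k x" "box_bump a b k x \<le> indicator (box a b) x"
proof -
  have f: "0 \<le> flat_exp 1 y" "flat_exp 1 y \<le> 1" for y by (auto simp: flat_exp_def)
  then show "0 \<le> box_bump a b k x" unfolding box_bump_def by (intro prod_nonneg) auto
  have "box_bump a b k x \<le> 1" unfolding box_bump_def
    by (intro prod_le_1) (auto simp: f intro!: mult_le_one)
  moreover have "box_bump a b k x = 0" if "x \<notin> box a b"
  proof -
    have "\<not> (\<forall>i. a $ i < x $ i \<and> x $ i < b $ i)" using that by (simp add: mem_box_cart)
    then obtain i where "x $ i \<le> a $ i \<or> b $ i \<le> x $ i" by (metis not_less)
    then have "flat_exp 1 (real (Suc k) * (x $ i - a $ i)) * flat_exp 1 (real (Suc k) * (b $ i - x $ i)) = 0"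
      by (auto simp: flat_exp_def zero_less_mult_iff)
    then show ?thesis unfolding box_bump_def by (intro prod_zero) auto
  qed
  ultimately show "box_bump a b k x \<le> indicator (box a b) x" by (auto simp: indicator_def)
qed

lemma box_bump_tendsto: "(\<lambda>k. box_bump a b k x) \<longlonglongrightarrow> indicator (box a b) x"
proof (cases "x \<in> box a b")
  case True
  have "(\<lambda>k. flat_exp 1 (real (Suc k) * y)) \<longlonglongrightarrow> 1" if "y > 0" for y
  proof -
    have "(\<lambda>k. exp (- (inverse (real (Suc k)) * (1 / y)))) \<longlonglongrightarrow> exp (- (0 * (1 / y)))"
      by (intro tendsto_intros LIMSEQ_inverse_real_of_nat)
    moreover have "flat_exp 1 (real (Suc k) * y) = exp (- (inverse (real (Suc k)) * (1 / y)))" for k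
      using that by (simp add: flat_exp_def divide_inverse)
    ultimately show ?thesis by simp
  qed
  then have "(\<lambda>k. box_bump a b k x) \<longlonglongrightarrow> (\<Prod>i\<in>(UNIV::2 set). 1 * 1)"
    unfolding box_bump_def using True by (intro tendsto_prod tendsto_mult) (auto simp: mem_box_cart)
  then show ?thesis using True by simp
next
  case False
  then have "box_bump a b k x = 0" for k
    using box_bump_range[of a b k x] by simp
  then show ?thesis using False by simp
qed

lemma test_function_box_bump: "test_function (box_bump a b k)"
proof -
  have "Ck_on m UNIV (\<lambda>x. flat_exp 1 (c * (x $ i - a $ i)))" "Ck_on m UNIV (\<lambda>x. flat_exp 1 (c * (b $ i - x $ i)))"
    for m i c
    using Ck_on_flat_exp[of m 1 c i "- c * a $ i"] Ck_on_flat_exp[of m 1 "- c" i "c * b $ i"]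
    by (simp_all add: algebra_simps)
  then have "Ck_on m UNIV (box_bump a b k)" for m
    unfolding box_bump_def UNIV_2
    by (simp add: prod.insert del: prod.insert_remove) (intro Ck_on_bilinear[OF bounded_bilinear_mult]; simp)
  moreover have "{x. box_bump a b k x \<noteq> 0} \<subseteq> cbox a b"
    using box_bump_range[of a b k] box_subset_cbox[of a b]
    by (smt (verit, best) indicator_simps(2) mem_Collect_eq subset_iff)
  then have "closure {x. box_bump a b k x \<noteq> 0} \<subseteq> cbox a b"
    by (rule closure_minimal) (rule closed_cbox)
  then have "compact (closure {x. box_bump a b k x \<noteq> 0})"
    by (meson closed_closure compact_cbox bounded_subset bounded_cbox compact_eq_bounded_closed)
  ultimately show ?thesis by (simp add: test_function_def)
qed

subsection \<open>The weak derivative of order zero\<close>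

text \<open>Open boxes form an intersection-stable generator of the Borel sets. Hence the measures
  whose densities are the positive and the negative part of \<open>h\<close>, cut to a large box to
  be finite there, coincide, and so do the densities almost everywhere.\<close>

lemma AE_zero_of_box_integrals_real:
  fixes h :: "'a::euclidean_space \<Rightarrow> real"
  assumes loc: "\<And>a b. set_integrable lborel (cbox a b) h"
    and zero: "\<And>a b. (LINT x:box a b|lborel. h x) = 0"
  shows "AE x in lborel. h x = 0"
proof -
  define B where "B k = box (- (real k *\<^sub>R One)) (real k *\<^sub>R One :: 'a)" for k
  have loc': "set_integrable lborel (box a b) h" for a b
    by (rule set_integrable_subset[OF loc[of a b]]) (auto simp: box_subset_cbox)
  have ae_k: "AE x in lborel. indicator (B k) x * h x = 0" for k
  proof -
    let ?g = "\<lambda>x. indicator (B k) x * h x"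
    have g: "integrable lborel ?g" using loc' by (simp add: B_def set_integrable_def)
    then have gm [measurable]: "?g \<in> borel_measurable borel" by auto
    let ?P = "density lborel (\<lambda>x. ennreal (?g x))" and ?N = "density lborel (\<lambda>x. ennreal (- ?g x))"
    have eq: "(\<integral>\<^sup>+x. ennreal (?g x) * indicator X x \<partial>lborel) = (\<integral>\<^sup>+x. ennreal (- ?g x) * indicator X x \<partial>lborel)"
      and fin: "(\<integral>\<^sup>+x. ennreal (?g x) * indicator X x \<partial>lborel) \<noteq> \<infinity>"
      if X: "X \<in> range (\<lambda>(a, b). box a b)" for X
    proof -
      obtain a b where ab: "X = box a b" using X by auto
      obtain c d where cd: "box a b \<inter> B k = box c d" unfolding B_def box_Int_box by blast
      have i: "integrable lborel (\<lambda>x. indicator X x *\<^sub>R ?g x)"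
        using integrable_real_mult_indicator[OF _ g, of X] ab by (simp add: mult.commute)
      have "(LINT x|lborel. indicator X x *\<^sub>R ?g x) = (LINT x:box c d|lborel. h x)"
        unfolding set_lebesgue_integral_def ab cd[symmetric]
        by (intro Bochner_Integration.integral_cong) (auto simp: indicator_def)
      then have z: "(LINT x|lborel. indicator X x *\<^sub>R ?g x) = 0" using zero by simp
      define p where "p = (\<integral>\<^sup>+x. ennreal (indicator X x *\<^sub>R ?g x) \<partial>lborel)"
      define n where "n = (\<integral>\<^sup>+x. ennreal (- (indicator X x *\<^sub>R ?g x)) \<partial>lborel)"
      have "p \<noteq> \<infinity>" "n \<noteq> \<infinity>"
        using i unfolding p_def n_def real_integrable_def by auto
      moreover have "enn2real p - enn2real n = 0"
        using real_lebesgue_integral_def[OF i] z unfolding p_def n_def by simp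
      ultimately have "p = n"
        by (metis eq_iff_diff_eq_0 ennreal_enn2real_if infinity_ennreal_def)
      moreover have "(\<integral>\<^sup>+x. ennreal (?g x) * indicator X x \<partial>lborel) = p"
        "(\<integral>\<^sup>+x. ennreal (- ?g x) * indicator X x \<partial>lborel) = n"
        unfolding p_def n_def by (auto intro!: nn_integral_cong simp: indicator_def)
      ultimately show "(\<integral>\<^sup>+x. ennreal (?g x) * indicator X x \<partial>lborel) = (\<integral>\<^sup>+x. ennreal (- ?g x) * indicator X x \<partial>lborel)"
        "(\<integral>\<^sup>+x. ennreal (?g x) * indicator X x \<partial>lborel) \<noteq> \<infinity>"
        using \<open>p \<noteq> \<infinity>\<close> by simp_all
    qed
    have "?P = ?N"
    proof (rule measure_eqI_generator_eq[where E = "range (\<lambda>(a, b). box a b)" and \<Omega> = UNIV and A = B])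
      show "Int_stable (range (\<lambda>(a, b). box a b :: 'a set))"
        by (auto simp: Int_stable_def box_Int_box)
      show "emeasure ?P X = emeasure ?N X" if "X \<in> range (\<lambda>(a, b). box a b)" for X
      proof -
        have "X \<in> sets borel" using that by auto
        then show ?thesis using eq[OF that] gm by (simp add: emeasure_density)
      qed
      show "emeasure ?P (B k) \<noteq> \<infinity>" for k
      proof -
        have "B k \<in> range (\<lambda>(a, b). box a b)" by (auto simp: B_def)
        moreover have "B k \<in> sets borel" by (simp add: B_def)
        ultimately show ?thesis using fin[of "B k"] gm by (simp add: emeasure_density)
      qed
      show "(\<Union>k. B k) = UNIV"
        using UN_box_eq_UNIV by (simp add: B_def)
    qed (auto simp: borel_eq_box B_def)
    \<comment> \<open>\<open>ennreal\<close> sends negative numbers to 0, so this equates the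
      positive and the negative part, and both must vanish.\<close>
    then have "AE x in lborel. ennreal (?g x) = ennreal (- ?g x)"
      by (subst (asm) sigma_finite_measure.density_unique_iff[OF sigma_finite_lborel]) auto
    then show ?thesis
    proof eventually_elim
      case (elim x)
      then show ?case by (cases "0 \<le> ?g x") (auto simp: ennreal_neg not_le)
    qed
  qed
  have "AE x in lborel. \<forall>k. indicator (B k) x * h x = 0" unfolding AE_all_countable using ae_k by (rule allI)
  then show ?thesis
  proof eventually_elim
    case (elim x)
    have "x \<in> (\<Union>k. B k)" unfolding B_def using UN_box_eq_UNIV by auto
    then obtain k where "x \<in> B k" by auto
    then show ?case using elim[rule_format, of k] by simp
  qed
qed

lemma AE_zero_of_box_integrals:
  fixes h :: "'a::euclidean_space \<Rightarrow> 'b::euclidean_space"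
  assumes loc: "\<And>a b. set_integrable lborel (cbox a b) h"
    and zero: "\<And>a b. (LINT x:box a b|lborel. h x) = 0"
  shows "AE x in lborel. h x = 0"
proof -
  have loc': "set_integrable lborel (box a b) h" for a b
    by (rule set_integrable_subset[OF loc[of a b]]) (auto simp: box_subset_cbox)
  have "AE x in lborel. h x \<bullet> i = 0" for i
  proof (rule AE_zero_of_box_integrals_real)
    show "set_integrable lborel (cbox a b) (\<lambda>x. h x \<bullet> i)" for a b
      using integrable_inner_left[of i lborel, OF loc[of a b, unfolded set_integrable_def]]
      by (simp add: set_integrable_def)
    have "(LINT x:box a b|lborel. h x \<bullet> i) = (LINT x:box a b|lborel. h x) \<bullet> i" for a b
      using integral_inner_left[of i lborel, OF loc'[of a b, unfolded set_integrable_def]]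
      by (simp add: set_lebesgue_integral_def)
    then show "(LINT x:box a b|lborel. h x \<bullet> i) = 0" for a b using zero by simp
  qed
  then have "AE x in lborel. \<forall>i\<in>Basis. h x \<bullet> i = 0"
    by (simp add: AE_finite_allI)
  then show ?thesis by eventually_elim (simp add: euclidean_all_zero_iff)
qed

text \<open>\<open>in_H\<close> and \<open>in_weighted_sobolev\<close> bound
  \<open>weak_deriv (0, 0) f\<close>, which is an arbitrary choice; identifying it with
  \<open>f\<close> almost everywhere is what gives access to \<open>f\<close>. The bumps are
  dominated by the indicator of the closed box, so testing passes to the limit of box
  integrals.\<close>

lemma has_weak_deriv_0_AE_eq:
  fixes f g :: "real^2 \<Rightarrow> 'b::euclidean_space"
  assumes "has_weak_deriv f (0, 0) g"
  shows "AE x in lborel. g x = f x"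
proof -
  have loc: "set_integrable lborel (cbox a b) f" "set_integrable lborel (cbox a b) g" for a b
    using assms by (auto simp: has_weak_deriv_def locally_integrable_def)
  have "AE x in lborel. g x - f x = 0"
  proof (rule AE_zero_of_box_integrals)
    show "set_integrable lborel (cbox a b) (\<lambda>x. g x - f x)" for a b
      using loc by (intro set_integral_diff)
    fix a b :: "real^2"
    have bump [measurable]: "box_bump a b k \<in> borel_measurable borel" for k
      using test_function_box_bump[of a b k] unfolding test_function_def
      by (metis Ck_on.simps(1) borel_measurable_continuous_onI)
    have bound: "norm (box_bump a b k x *\<^sub>R y) \<le> norm (indicator (cbox a b) x *\<^sub>R y)" for k x and y :: 'b
    proof -
      have "box_bump a b k x \<le> indicator (cbox a b) x"
      proof (cases "x \<in> box a b")
        case True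
        then show ?thesis using box_bump_range(2)[of a b k x] box_subset_cbox[of a b] by auto
      next
        case False
        then show ?thesis using box_bump_range(2)[of a b k x] by (auto intro: order_trans)
      qed
      then show ?thesis
        using box_bump_range(1)[of a b k x] by (simp add: mult_right_mono)
    qed
    have i: "integrable lborel (\<lambda>x. box_bump a b k x *\<^sub>R u x)"
      if "set_integrable lborel (cbox a b) u" for k and u :: "real^2 \<Rightarrow> 'b"
    proof (rule Bochner_Integration.integrable_bound[OF that(1)[unfolded set_integrable_def]])
      \<comment> \<open>Local integrability gives measurability only for \<open>u\<close> cut off to
        compact sets. The bump vanishes off the box, so the indicator can be inserted without
        changing the product.\<close>
      have "(\<lambda>x. indicator (cbox a b) x *\<^sub>R u x) \<in> borel_measurable borel"
        using that by (auto simp: set_integrable_def)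
      then have "(\<lambda>x. box_bump a b k x *\<^sub>R (indicator (cbox a b) x *\<^sub>R u x)) \<in> borel_measurable lborel"
        using borel_measurable_scaleR[OF bump[of k]] by (simp del: scaleR_scaleR)
      moreover have "(\<lambda>x. box_bump a b k x *\<^sub>R (indicator (cbox a b) x *\<^sub>R u x)) = (\<lambda>x. box_bump a b k x *\<^sub>R u x)"
      proof
        fix x show "box_bump a b k x *\<^sub>R (indicator (cbox a b) x *\<^sub>R u x) = box_bump a b k x *\<^sub>R u x"
          using bound[of k x "u x"] by (cases "x \<in> cbox a b") (auto simp: mult_le_0_iff)
      qed
      ultimately show "(\<lambda>x. box_bump a b k x *\<^sub>R u x) \<in> borel_measurable lborel" by (simp only:)
    qed (use bound in auto)
    have "(LINT x|lborel. box_bump a b k x *\<^sub>R (g x - f x)) = 0" for k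
    proof -
      have "(LINT x|lborel. box_bump a b k x *\<^sub>R f x) = (LINT x|lborel. box_bump a b k x *\<^sub>R g x)"
        using assms test_function_box_bump[of a b k]
        by (auto simp: has_weak_deriv_def multi_partial_def mi_order_def)
      then show ?thesis using i loc by (simp add: scaleR_diff_right)
    qed
    moreover have "(\<lambda>k. LINT x|lborel. box_bump a b k x *\<^sub>R (g x - f x)) \<longlonglongrightarrow> (LINT x|lborel. indicator (box a b) x *\<^sub>R (g x - f x))"
    proof (rule integral_dominated_convergence[where w = "\<lambda>x. norm (indicator (cbox a b) x *\<^sub>R (g x - f x))"])
      have d: "set_integrable lborel (cbox a b) (\<lambda>x. g x - f x)"
        using loc by (intro set_integral_diff)
      then show "integrable lborel (\<lambda>x. norm (indicator (cbox a b) x *\<^sub>R (g x - f x)))"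
        unfolding set_integrable_def by (rule integrable_norm)
      show "(\<lambda>x. box_bump a b k x *\<^sub>R (g x - f x)) \<in> borel_measurable lborel" for k
        using i[OF d] by (rule borel_measurable_integrable)
      have "set_integrable lborel (box a b) (\<lambda>x. g x - f x)"
        by (rule set_integrable_subset[OF d]) (auto simp: box_subset_cbox)
      then show "(\<lambda>x. indicator (box a b) x *\<^sub>R (g x - f x)) \<in> borel_measurable lborel"
        unfolding set_integrable_def by (rule borel_measurable_integrable)
      show "AE x in lborel. norm (box_bump a b k x *\<^sub>R (g x - f x)) \<le> norm (indicator (cbox a b) x *\<^sub>R (g x - f x))" for k
        using bound by blast
    qed (intro AE_I2 tendsto_scaleR box_bump_tendsto tendsto_const)
    ultimately show "(LINT x:box a b|lborel. g x - f x) = 0"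
      by (simp add: set_lebesgue_integral_def LIMSEQ_const_iff)
  qed
  then show ?thesis by simp
qed


section \<open>Norms of weak derivatives read as norms of the functions themselves\<close>

lemma weak_deriv_0_AE_eq:
  "\<exists>g. has_weak_deriv f (0, 0) g \<Longrightarrow> AE x in lborel. weak_deriv (0, 0) f x = f x"
  unfolding weak_deriv_def by (rule has_weak_deriv_0_AE_eq, erule someI_ex)

lemma L2norm_cong_AE:
  assumes "AE x in lborel. f x = g x" "f \<in> borel_measurable lborel" "g \<in> borel_measurable lborel"
  shows "L2norm f = L2norm g" "L2 f \<longleftrightarrow> L2 g"
proof -
  have ae: "AE x in lborel. (norm (f x))\<^sup>2 = (norm (g x))\<^sup>2" using assms(1) by eventually_elim simp
  show "L2norm f = L2norm g"
    unfolding L2norm_def using assms ae by (subst integral_cong_AE[of _ _ "\<lambda>x. (norm (g x))\<^sup>2"]) auto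
  have "integrable lborel (\<lambda>x. (norm (f x))\<^sup>2) \<longleftrightarrow> integrable lborel (\<lambda>x. (norm (g x))\<^sup>2)"
    using assms ae by (intro integrable_cong_AE) auto
  then show "L2 f \<longleftrightarrow> L2 g" using assms by (simp add: L2_def)
qed

lemma finite_mi_order_le: "finite {I. mi_order I \<le> m}"
  by (rule finite_subset[of _ "{..m} \<times> {..m}"]) (auto simp: mi_order_def)

lemma in_H_imp_L2:
  assumes "in_H m f" "f \<in> borel_measurable lborel"
  shows "L2 f" "L2norm f \<le> Hnorm m f"
proof -
  have 0: "(\<exists>g. has_weak_deriv f (0, 0) g)" "L2 (weak_deriv (0, 0) f)"
    using assms(1) by (auto simp: in_H_def mi_order_def)
  note eq = L2norm_cong_AE[OF weak_deriv_0_AE_eq[OF 0(1)] _ assms(2)]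
  have m: "weak_deriv (0, 0) f \<in> borel_measurable lborel" using 0(2) by (simp add: L2_def)
  show "L2 f" using eq m 0 by simp
  have "(L2norm (weak_deriv (0, 0) f))\<^sup>2 \<le> (\<Sum>I | mi_order I \<le> m. (L2norm (weak_deriv I f))\<^sup>2)"
    by (rule member_le_sum) (auto simp: mi_order_def finite_mi_order_le[unfolded mi_order_def])
  then have "\<bar>L2norm (weak_deriv (0, 0) f)\<bar> \<le> Hnorm m f"
    unfolding Hnorm_def by (metis real_sqrt_abs real_sqrt_le_mono)
  then show "L2norm f \<le> Hnorm m f" using eq m by simp
qed

lemma in_weighted_sobolev_imp_L2:
  fixes f g :: "real^2 \<Rightarrow> 'b::euclidean_space"
  assumes "in_weighted_sobolev w m f" and ae: "AE x in lborel. g x = f x" and meas: "g \<in> borel_measurable lborel"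
  shows "L2 (\<lambda>x. japanese x ^ w 0 *\<^sub>R g x)"
proof -
  have 0: "(\<exists>g. has_weak_deriv f (0, 0) g)" "L2 (\<lambda>x. japanese x ^ w 0 *\<^sub>R weak_deriv (0, 0) f x)"
    using assms(1)[unfolded in_weighted_sobolev_def, rule_format, of "(0, 0)"] by (auto simp: mi_order_def)
  have j: "(\<lambda>x::real^2. japanese x ^ w 0) \<in> borel_measurable borel"
    unfolding japanese_def by simp
  have "AE x in lborel. japanese x ^ w 0 *\<^sub>R weak_deriv (0, 0) f x = japanese x ^ w 0 *\<^sub>R g x"
    using weak_deriv_0_AE_eq[OF 0(1)] ae by eventually_elim simp
  moreover have "(\<lambda>x. japanese x ^ w 0 *\<^sub>R g x) \<in> borel_measurable lborel"
    using j meas by simp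
  moreover have "(\<lambda>x. japanese x ^ w 0 *\<^sub>R weak_deriv (0, 0) f x) \<in> borel_measurable lborel"
    using 0(2) unfolding L2_def by blast
  ultimately show ?thesis
    using 0(2) L2norm_cong_AE(2)[of "\<lambda>x. japanese x ^ w 0 *\<^sub>R weak_deriv (0, 0) f x"
        "\<lambda>x. japanese x ^ w 0 *\<^sub>R g x"] by iprover
qed

subsection \<open>The potential and its derivatives\<close>

text \<open>For \<open>Re z > 0\<close> and real u \<ge> 0 the radicand avoids the cut of the
  principal root, so the expressions built on it are differentiable there, and the root lies in the
  open right half plane.\<close>

definition radical :: "complex \<Rightarrow> complex \<Rightarrow> complex" where
  "radical z u = csqrt (z\<^sup>2 + u)"

text \<open>For real u > 0 this is arsinh (z / sqrt u) + (ln u) / 2, an antiderivative of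
  \<open>1 / radical z u\<close> in \<open>z\<close> that stays regular at u = 0.\<close>

definition log_potential :: "complex \<Rightarrow> complex \<Rightarrow> complex" where
  "log_potential z u = Ln (z + radical z u)"

section \<open>Bounds for the radical off its branch cut\<close>

context
  fixes z :: complex and v :: real
  assumes z: "Re z > 0" and v: "v \<ge> 0"
begin

lemma radicand_not_nonpos: "z\<^sup>2 + of_real v \<notin> \<real>\<^sub>\<le>\<^sub>0"
proof
  assume "z\<^sup>2 + of_real v \<in> \<real>\<^sub>\<le>\<^sub>0"
  then have "Re (z\<^sup>2) + v \<le> 0" "Im (z\<^sup>2) = 0" by (auto simp: complex_nonpos_Reals_iff)
  then have "Im z = 0" "(Re z)\<^sup>2 - (Im z)\<^sup>2 + v \<le> 0" using z by (auto simp: power2_eq_square)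
  then show False using z v by (smt (verit) zero_less_power2 power2_eq_square mult_zero_left)
qed

lemma radical_sq: "(radical z (of_real v))\<^sup>2 = z\<^sup>2 + of_real v"
  by (simp add: radical_def)

lemma radical_nonzero: "radical z (of_real v) \<noteq> 0"
  using radicand_not_nonpos by (auto simp: radical_def)

lemma Re_radical_pos: "Re (radical z (of_real v)) > 0"
proof -
  have "Re (radical z (of_real v)) \<noteq> 0"
  proof
    assume r: "Re (radical z (of_real v)) = 0"
    then have "(radical z (of_real v))\<^sup>2 = - of_real ((Im (radical z (of_real v)))\<^sup>2)"
      by (auto simp: complex_eq_iff power2_eq_square)
    then have "z\<^sup>2 + of_real v \<in> \<real>\<^sub>\<le>\<^sub>0"
      by (simp add: radical_sq complex_nonpos_Reals_iff)
    then show False using radicand_not_nonpos by simp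
  qed
  moreover have "Re (radical z (of_real v)) \<ge> 0"
    using csqrt_principal[of "z\<^sup>2 + of_real v"] unfolding radical_def by auto
  ultimately show ?thesis by simp
qed

lemma radical_sum_not_nonpos: "z + radical z (of_real v) \<notin> \<real>\<^sub>\<le>\<^sub>0"
  using z Re_radical_pos by (auto simp: complex_nonpos_Reals_iff)

lemma radical_sum_nonzero: "z + radical z (of_real v) \<noteq> 0"
  using radical_sum_not_nonpos by auto

text \<open>Let Q be the radical. Q^2 and z^2 have the same imaginary part and both real parts of Q
  and z are positive, so \<open>Im z\<close> and Im Q do not have opposite signs. The cross term in
  |z + Q|^2 is then nonnegative, and |z|^2 + |Q|^2 dominates |Q^2 - z^2| = v.\<close>

lemma norm_radical_sum_ge: "(cmod (z + radical z (of_real v)))\<^sup>2 \<ge> v"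
proof -
  let ?Q = "radical z (of_real v)"
  have "Im (?Q\<^sup>2) = Im (z\<^sup>2)" by (simp add: radical_sq)
  then have "Re ?Q * Im ?Q = Re z * Im z" by (simp add: power2_eq_square mult.commute)
  then have "Re ?Q * (Im z * Im ?Q) = Re z * (Im z)\<^sup>2" by (simp add: power2_eq_square algebra_simps)
  then have "Re ?Q * (Im z * Im ?Q) \<ge> 0" using z by simp
  then have "Im z * Im ?Q \<ge> 0" using Re_radical_pos by (simp add: zero_le_mult_iff)
  then have c: "Re z * Re ?Q + Im z * Im ?Q \<ge> 0" using z Re_radical_pos by simp
  have "v = cmod (?Q\<^sup>2 - z\<^sup>2)" using v by (simp add: radical_sq)
  also have "\<dots> \<le> (cmod ?Q)\<^sup>2 + (cmod z)\<^sup>2" using norm_triangle_ineq4[of "?Q\<^sup>2" "z\<^sup>2"] by (simp add: norm_power)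
  also have "\<dots> \<le> (cmod (z + ?Q))\<^sup>2"
    using c by (simp add: cmod_power2) (simp add: power2_eq_square algebra_simps)
  finally show ?thesis .
qed

text \<open>After squaring, with z = a + i s, the claim is a^2 (a^2 + s^2) \<le> (a^2 - s^2 + v)^2 +
  4 a^2 s^2. If s^2 \<le> a^2, omitting v leaves |z|^4 on the right; otherwise the term 4 a^2 s^2
  alone suffices.\<close>

lemma norm_radical_ge: "(cmod (radical z (of_real v)))\<^sup>2 \<ge> Re z * cmod z"
proof -
  let ?a = "Re z" and ?s = "Im z"
  have e: "(cmod (radical z (of_real v)))\<^sup>2 = cmod (z\<^sup>2 + of_real v)"
    by (metis norm_power radical_sq)
  have "(?a * cmod z)\<^sup>2 \<le> (cmod (z\<^sup>2 + of_real v))\<^sup>2"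
  proof -
    have "?a\<^sup>2 * (?a\<^sup>2 + ?s\<^sup>2) \<le> (?a\<^sup>2 - ?s\<^sup>2 + v)\<^sup>2 + 4 * ?a\<^sup>2 * ?s\<^sup>2"
    proof (cases "?s\<^sup>2 \<le> ?a\<^sup>2")
      case True
      have "?a\<^sup>2 * (?a\<^sup>2 + ?s\<^sup>2) \<le> (?a\<^sup>2 + ?s\<^sup>2) * (?a\<^sup>2 + ?s\<^sup>2)" by (intro mult_right_mono) auto
      also have "\<dots> = (?a\<^sup>2 - ?s\<^sup>2)\<^sup>2 + 4 * ?a\<^sup>2 * ?s\<^sup>2" by (simp add: power2_eq_square algebra_simps)
      also have "(?a\<^sup>2 - ?s\<^sup>2)\<^sup>2 \<le> (?a\<^sup>2 - ?s\<^sup>2 + v)\<^sup>2" using True v by (intro power_mono) auto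
      finally show ?thesis by simp
    next
      case False
      then have "?a\<^sup>2 * ?a\<^sup>2 \<le> ?a\<^sup>2 * ?s\<^sup>2" by (intro mult_left_mono) auto
      then show ?thesis by (simp add: algebra_simps) (smt (verit) zero_le_power2 zero_le_mult_iff mult.commute)
    qed
    moreover have "(?a * cmod z)\<^sup>2 = ?a\<^sup>2 * (?a\<^sup>2 + ?s\<^sup>2)" by (simp add: power_mult_distrib cmod_power2)
    moreover have "(cmod (z\<^sup>2 + of_real v))\<^sup>2 = (?a\<^sup>2 - ?s\<^sup>2 + v)\<^sup>2 + 4 * ?a\<^sup>2 * ?s\<^sup>2"
      unfolding cmod_power2 by (simp add: power2_eq_square algebra_simps)
    ultimately show ?thesis by simp
  qed
  then have "?a * cmod z \<le> cmod (z\<^sup>2 + of_real v)" by (rule power2_le_imp_le) simp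
  then show ?thesis using e by simp
qed

lemma norm_radical_ge_Re: "cmod (radical z (of_real v)) \<ge> Re z"
proof -
  have "(Re z)\<^sup>2 \<le> Re z * cmod z"
    using z complex_Re_le_cmod[of z] by (simp add: power2_eq_square)
  then have "(Re z)\<^sup>2 \<le> (cmod (radical z (of_real v)))\<^sup>2" using norm_radical_ge by linarith
  then show ?thesis by (rule power2_le_imp_le) simp
qed

text \<open>From v = |Q^2 - z^2| follows v \<le> |Q|^2 + |z|^2, and the remainder 1 + |z|^2 is
  absorbed by 1 \<le> |Q|^2 / (Re z)^2. The outcome is growth of Q like sqrt v at fixed z.\<close>

lemma norm_radical_ge_decay: "1 + v \<le> (cmod (radical z (of_real v)))\<^sup>2 * ((1 + 2 * (cmod z)\<^sup>2 + (Re z)\<^sup>2) / (Re z)\<^sup>2)"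
proof -
  let ?q = "(cmod (radical z (of_real v)))\<^sup>2"
  have "v = cmod ((radical z (of_real v))\<^sup>2 - z\<^sup>2)" using v by (simp add: radical_sq)
  also have "\<dots> \<le> ?q + (cmod z)\<^sup>2"
    using norm_triangle_ineq4[of "(radical z (of_real v))\<^sup>2" "z\<^sup>2"] by (simp add: norm_power)
  finally have "1 + v \<le> ?q + 1 * (1 + (cmod z)\<^sup>2)" by simp
  also have "1 \<le> ?q / (Re z)\<^sup>2"
    using power_mono[OF norm_radical_ge_Re, of 2] z by (simp add: field_simps)
  then have "?q + 1 * (1 + (cmod z)\<^sup>2) \<le> ?q + ?q / (Re z)\<^sup>2 * (1 + (cmod z)\<^sup>2)"
    by (intro add_left_mono mult_right_mono) auto
  also have "\<dots> \<le> ?q * ((1 + 2 * (cmod z)\<^sup>2 + (Re z)\<^sup>2) / (Re z)\<^sup>2)"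
    using z by (simp add: field_simps)
  finally show ?thesis .
qed

text \<open>Two factors of the radical absorb \<open>Re z * cmod z\<close>, the third absorbs
  another \<open>Re z\<close>. With Re z = sqrt t this becomes the bound 1/t on the Laplacian of the
  test wave.\<close>

lemma norm_second_derivative_le: "cmod (z / (radical z (of_real v)) ^ 3) \<le> 1 / (Re z)\<^sup>2"
proof -
  let ?q = "cmod (radical z (of_real v))"
  have q: "?q \<ge> Re z" "?q > 0" using norm_radical_ge_Re radical_nonzero by auto
  have "Re z * Re z * cmod z \<le> Re z * ?q\<^sup>2"
    using norm_radical_ge z by (simp add: mult.assoc)
  also have "\<dots> \<le> ?q * ?q\<^sup>2" using q by (intro mult_right_mono) auto
  finally have "cmod z * (Re z)\<^sup>2 \<le> ?q ^ 3" by (simp add: power2_eq_square power3_eq_cube algebra_simps)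
  then show ?thesis using z q by (simp add: norm_divide norm_power field_simps)
qed

section \<open>Complex derivatives of the potential in u and in z\<close>

lemma has_field_derivative_radical_u:
  "(radical z has_field_derivative 1 / (2 * radical z (of_real v))) (at (of_real v))"
  unfolding radical_def using radicand_not_nonpos by (auto intro!: derivative_eq_intros)

lemma has_field_derivative_radical_z:
  "((\<lambda>z. radical z (of_real v)) has_field_derivative z / radical z (of_real v)) (at z)"
  unfolding radical_def using radicand_not_nonpos by (auto intro!: derivative_eq_intros simp: field_simps)

lemma has_field_derivative_log_potential_u:
  "(log_potential z has_field_derivative
     1 / (2 * (radical z (of_real v) * (z + radical z (of_real v))))) (at (of_real v))"
  unfolding log_potential_def using radical_sum_not_nonpos radical_nonzero radical_sum_nonzero
  by (auto intro!: derivative_eq_intros has_field_derivative_radical_u simp: field_simps)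

lemma has_field_derivative_log_potential_z:
  "((\<lambda>z. log_potential z (of_real v)) has_field_derivative 1 / radical z (of_real v)) (at z)"
  unfolding log_potential_def using radical_sum_not_nonpos radical_nonzero radical_sum_nonzero
  by (auto intro!: derivative_eq_intros has_field_derivative_radical_z simp: field_simps)

lemma has_field_derivative_inverse_radical_z:
  "((\<lambda>z. 1 / radical z (of_real v)) has_field_derivative - (z / radical z (of_real v) ^ 3)) (at z)"
  using radical_nonzero
  by (auto intro!: derivative_eq_intros has_field_derivative_radical_z simp: field_simps power2_eq_square power3_eq_cube)

lemma has_field_derivative_potential_slope_u:
  "((\<lambda>u. 1 / (radical z u * (z + radical z u))) has_field_derivative
     - ((z + 2 * radical z (of_real v)) / (2 * radical z (of_real v) ^ 3 * (z + radical z (of_real v))\<^sup>2))) (at (of_real v))"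
proof -
  let ?Q = "radical z (of_real v)"
  have nz: "?Q \<noteq> 0" "z + ?Q \<noteq> 0" using radical_nonzero radical_sum_nonzero by auto
  have "((\<lambda>u. 1 / (radical z u * (z + radical z u))) has_field_derivative
      (0 * (?Q * (z + ?Q)) - 1 * (1 / (2 * ?Q) * (z + ?Q) + (0 + 1 / (2 * ?Q)) * ?Q)) / (?Q * (z + ?Q) * (?Q * (z + ?Q))))
      (at (of_real v))"
    by (intro DERIV_divide DERIV_mult DERIV_add DERIV_const has_field_derivative_radical_u) (use nz in auto)
  moreover have "(0 * (?Q * (z + ?Q)) - 1 * (1 / (2 * ?Q) * (z + ?Q) + (0 + 1 / (2 * ?Q)) * ?Q)) / (?Q * (z + ?Q) * (?Q * (z + ?Q)))
      = - ((z + 2 * ?Q) / (2 * ?Q ^ 3 * (z + ?Q)\<^sup>2))"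
  proof -
    have "(0 * (q * p) - 1 * (1 / (2 * q) * p + (0 + 1 / (2 * q)) * q)) / (q * p * (q * p)) = - ((p + q) / (2 * q ^ 3 * p\<^sup>2))"
      if "q \<noteq> 0" "p \<noteq> 0" for p q :: complex
      using that by (simp add: field_simps power2_eq_square power3_eq_cube)
    from this[OF nz] show ?thesis by (simp add: add.assoc)
  qed
  ultimately show ?thesis by simp
qed

end

lemma continuous_on_radical:
  assumes "continuous_on S f" "continuous_on S g" "\<And>p. p \<in> S \<Longrightarrow> Re (f p) > 0" "\<And>p. p \<in> S \<Longrightarrow> g p \<ge> 0"
  shows "continuous_on S (\<lambda>p. radical (f p) (of_real (g p)))"
  unfolding radical_def
  by (rule continuous_on_compose2[OF continuous_on_csqrt])
    (use assms radicand_not_nonpos in \<open>auto intro!: continuous_intros\<close>)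

subsection \<open>The real test waves\<close>

definition wave_pot :: "real \<Rightarrow> real \<Rightarrow> real^2 \<Rightarrow> real" where
  "wave_pot a s x = Re (log_potential (Complex a (- s)) (of_real ((norm x)\<^sup>2)))"

text \<open>The factor -i from z = a - i s turns the real part of the z-derivative
  \<open>1 / radical\<close> into its imaginary part.\<close>

definition wave_pot_s :: "real \<Rightarrow> real \<Rightarrow> real^2 \<Rightarrow> real" where
  "wave_pot_s a s x = Im (1 / radical (Complex a (- s)) (of_real ((norm x)\<^sup>2)))"

definition wave_pot_ss :: "real \<Rightarrow> real \<Rightarrow> real^2 \<Rightarrow> real" where
  "wave_pot_ss a s x = Re (Complex a (- s) / radical (Complex a (- s)) (of_real ((norm x)\<^sup>2)) ^ 3)"

text \<open>The factor 2 from the derivative of |x|^2 cancels the 1/2 in the u-derivative of the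
  potential.\<close>

definition wave_pot_i :: "2 \<Rightarrow> real \<Rightarrow> real \<Rightarrow> real^2 \<Rightarrow> real" where
  "wave_pot_i i a s x = (let z = Complex a (- s); Q = radical z (of_real ((norm x)\<^sup>2))
     in x $ i * Re (1 / (Q * (z + Q))))"

definition wave_pot_ii :: "2 \<Rightarrow> real \<Rightarrow> real \<Rightarrow> real^2 \<Rightarrow> real" where
  "wave_pot_ii i a s x = (let z = Complex a (- s); Q = radical z (of_real ((norm x)\<^sup>2))
     in Re (1 / (Q * (z + Q))) - (x $ i)\<^sup>2 * Re ((z + 2 * Q) / (Q ^ 3 * (z + Q)\<^sup>2)))"

lemma has_vector_derivative_Re:
  "(f has_vector_derivative f') F \<Longrightarrow> ((\<lambda>x. Re (f x)) has_vector_derivative Re f') F"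
  by (rule bounded_linear.has_vector_derivative[OF bounded_linear_Re])

lemma has_vector_derivative_Im:
  "(f has_vector_derivative f') F \<Longrightarrow> ((\<lambda>x. Im (f x)) has_vector_derivative Im f') F"
  by (rule bounded_linear.has_vector_derivative[OF bounded_linear_Im])

lemma Complex_line_derivative:
  "((\<lambda>s. Complex a (- s)) has_vector_derivative - \<i>) (at s)"
  unfolding Complex_eq by (auto intro!: derivative_eq_intros)

lemma norm_sq_line_derivative:
  fixes x :: "real^2"
  shows "((\<lambda>\<tau>. (norm (x + \<tau> *\<^sub>R axis i 1))\<^sup>2) has_vector_derivative 2 * x $ i) (at 0)"
proof -
  have "((\<lambda>\<tau>. (norm x)\<^sup>2 + 2 * \<tau> * x $ i + \<tau>\<^sup>2) has_real_derivative 2 * x $ i) (at 0)"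
    by (auto intro!: derivative_eq_intros)
  moreover have "(\<lambda>\<tau>. (norm (x + \<tau> *\<^sub>R axis i 1))\<^sup>2) = (\<lambda>\<tau>. (norm x)\<^sup>2 + 2 * \<tau> * x $ i + \<tau>\<^sup>2)"
    unfolding power2_norm_eq_inner
    by (auto simp: inner_add_left inner_add_right inner_axis inner_axis' power2_eq_square fun_eq_iff algebra_simps)
  ultimately show ?thesis by (simp add: has_real_derivative_iff_has_vector_derivative)
qed

lemma norm_sq_line_derivative_complex:
  fixes x :: "real^2"
  shows "((\<lambda>\<tau>. complex_of_real ((norm (x + \<tau> *\<^sub>R axis i 1))\<^sup>2)) has_vector_derivative of_real (2 * x $ i)) (at 0)"
  by (rule bounded_linear.has_vector_derivative[OF bounded_linear_of_real norm_sq_line_derivative])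

context
  fixes a s :: real and x :: "real^2"
  assumes a: "a > 0"
begin

lemma wave_pot_has_derivative_s: "((\<lambda>s. wave_pot a s x) has_vector_derivative wave_pot_s a s x) (at s)"
proof -
  let ?z = "Complex a (- s)" and ?u = "complex_of_real ((norm x)\<^sup>2)"
  have "((\<lambda>z. log_potential z ?u) \<circ> (\<lambda>s. Complex a (- s)) has_vector_derivative (- \<i> * (1 / radical ?z ?u))) (at s)"
    by (rule field_vector_diff_chain_at[OF Complex_line_derivative has_field_derivative_log_potential_z]) (use a in auto)
  moreover have "Re (- \<i> * w) = Im w" for w by simp
  ultimately show ?thesis
    using has_vector_derivative_Re unfolding wave_pot_def wave_pot_s_def o_def by metis
qed

lemma wave_pot_s_has_derivative_s: "((\<lambda>s. wave_pot_s a s x) has_vector_derivative wave_pot_ss a s x) (at s)"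
proof -
  let ?z = "Complex a (- s)" and ?u = "complex_of_real ((norm x)\<^sup>2)"
  have "((\<lambda>z. 1 / radical z ?u) \<circ> (\<lambda>s. Complex a (- s)) has_vector_derivative (- \<i> * - (?z / radical ?z ?u ^ 3))) (at s)"
    by (rule field_vector_diff_chain_at[OF Complex_line_derivative has_field_derivative_inverse_radical_z]) (use a in auto)
  moreover have "Im (- \<i> * - w) = Re w" for w by simp
  ultimately show ?thesis
    using has_vector_derivative_Im unfolding wave_pot_s_def wave_pot_ss_def o_def by metis
qed

lemma wave_pot_has_derivative_i:
  "((\<lambda>\<tau>. wave_pot a s (x + \<tau> *\<^sub>R axis i 1)) has_vector_derivative wave_pot_i i a s x) (at 0)"
proof -
  let ?z = "Complex a (- s)" and ?u = "complex_of_real ((norm x)\<^sup>2)"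
  let ?Q = "radical ?z ?u"
  have "(log_potential ?z \<circ> (\<lambda>\<tau>. complex_of_real ((norm (x + \<tau> *\<^sub>R axis i 1))\<^sup>2)) has_vector_derivative
      (of_real (2 * x $ i) * (1 / (2 * (?Q * (?z + ?Q)))))) (at 0)"
    by (rule field_vector_diff_chain_at[OF norm_sq_line_derivative_complex])
      (use a has_field_derivative_log_potential_u[of ?z "(norm x)\<^sup>2"] in auto)
  from has_vector_derivative_Re[OF this] have
    "((\<lambda>\<tau>. wave_pot a s (x + \<tau> *\<^sub>R axis i 1)) has_vector_derivative Re (of_real (2 * x $ i) * (1 / (2 * (?Q * (?z + ?Q)))))) (at 0)"
    by (simp add: wave_pot_def o_def)
  moreover have "of_real (2 * x $ i) * (1 / (2 * (?Q * (?z + ?Q)))) = of_real (x $ i) * (1 / (?Q * (?z + ?Q)))"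
    by simp
  ultimately show ?thesis
    unfolding wave_pot_i_def Let_def by (metis Re_complex_of_real Im_complex_of_real diff_zero mult_zero_left times_complex.sel(1))
qed

lemma wave_pot_i_has_derivative_i:
  "((\<lambda>\<tau>. wave_pot_i i a s (x + \<tau> *\<^sub>R axis i 1)) has_vector_derivative wave_pot_ii i a s x) (at 0)"
proof -
  let ?z = "Complex a (- s)" and ?u = "complex_of_real ((norm x)\<^sup>2)"
  let ?Q = "radical ?z ?u"
  let ?D = "(?z + 2 * ?Q) / (2 * ?Q ^ 3 * (?z + ?Q)\<^sup>2)"
  have "((\<lambda>u. 1 / (radical ?z u * (?z + radical ?z u))) \<circ> (\<lambda>\<tau>. complex_of_real ((norm (x + \<tau> *\<^sub>R axis i 1))\<^sup>2)) has_vector_derivative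
      (of_real (2 * x $ i) * - ?D)) (at 0)"
    by (rule field_vector_diff_chain_at[OF norm_sq_line_derivative_complex])
      (use a has_field_derivative_potential_slope_u[of ?z "(norm x)\<^sup>2"] in auto)
  from has_vector_derivative_Re[OF this]
  have h: "((\<lambda>\<tau>. Re (1 / (radical ?z (of_real ((norm (x + \<tau> *\<^sub>R axis i 1))\<^sup>2)) * (?z + radical ?z (of_real ((norm (x + \<tau> *\<^sub>R axis i 1))\<^sup>2))))))
      has_vector_derivative Re (of_real (2 * x $ i) * - ?D)) (at 0)" by (simp add: o_def)
  have x: "((\<lambda>\<tau>. (x + \<tau> *\<^sub>R axis i 1) $ i) has_vector_derivative 1) (at 0)"
    by (auto intro!: derivative_eq_intros simp: has_real_derivative_iff_has_vector_derivative[symmetric])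
  have "Re (of_real (2 * x $ i) * - ?D) = - x $ i * Re ((?z + 2 * ?Q) / (?Q ^ 3 * (?z + ?Q)\<^sup>2))"
  proof -
    have "of_real (2 * x $ i) * - ?D = of_real (- x $ i) * ((?z + 2 * ?Q) / (?Q ^ 3 * (?z + ?Q)\<^sup>2))" by simp
    then show ?thesis by (metis Re_complex_of_real Im_complex_of_real diff_zero mult_zero_left times_complex.sel(1))
  qed
  with has_vector_derivative_mult[OF x h] show ?thesis
    unfolding wave_pot_i_def wave_pot_ii_def Let_def by (simp add: algebra_simps power2_eq_square)
qed

text \<open>This is the wave equation for \<open>wave_pot\<close>. In two dimensions the sum is the
  real part of 2 / (Q (z + Q)) - |x|^2 (z + 2 Q) / (Q^3 (z + Q)^2), and |x|^2 = (Q - z) (Q + z)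
  collapses it to z / Q^3.\<close>

lemma laplacian_wave_pot: "(\<Sum>i\<in>UNIV. wave_pot_ii i a s x) = wave_pot_ss a s x"
proof -
  let ?z = "Complex a (- s)" and ?u = "complex_of_real ((norm x)\<^sup>2)"
  define z where "z = ?z"
  define Q where "Q = radical z ?u"
  have nz: "Q \<noteq> 0" "z + Q \<noteq> 0" unfolding Q_def z_def
    by (rule radical_nonzero; use a in simp) (rule radical_sum_nonzero; use a in simp)
  have "?u = Q\<^sup>2 - z\<^sup>2" unfolding Q_def by (subst radical_sq) (use a z_def in auto)
  then have u: "?u = (Q - z) * (z + Q)" by (simp add: power2_eq_square algebra_simps)
  have n: "(norm x)\<^sup>2 = (x $ 1)\<^sup>2 + (x $ 2)\<^sup>2"
    by (simp add: norm_vec_def L2_set_def sum_2)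
  have "(\<Sum>i\<in>UNIV. wave_pot_ii i a s x) = 2 * Re (1 / (Q * (z + Q))) - (norm x)\<^sup>2 * Re ((z + 2 * Q) / (Q ^ 3 * (z + Q)\<^sup>2))"
    unfolding wave_pot_ii_def Let_def sum_2 n Q_def z_def by (simp add: algebra_simps)
  also have "\<dots> = Re (of_real 2 * (1 / (Q * (z + Q))) - ?u * ((z + 2 * Q) / (Q ^ 3 * (z + Q)\<^sup>2)))"
  proof -
    have "Re (complex_of_real r * c) = r * Re c" for r c by simp
    then show ?thesis by (simp only: minus_complex.sel)
  qed
  also have "of_real 2 * (1 / (Q * (z + Q))) - ?u * ((z + 2 * Q) / (Q ^ 3 * (z + Q)\<^sup>2)) = z / Q ^ 3"
    unfolding u using nz by (simp add: divide_simps power2_eq_square power3_eq_cube) (simp add: algebra_simps)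
  finally show ?thesis by (simp add: wave_pot_ss_def z_def Q_def)
qed

lemma wave_pot_s_bound: "\<bar>wave_pot_s a s x\<bar> \<le> 1 / a"
proof -
  let ?q = "cmod (radical (Complex a (- s)) (of_real ((norm x)\<^sup>2)))"
  have q: "?q \<ge> a" using norm_radical_ge_Re[of "Complex a (- s)" "(norm x)\<^sup>2"] a by simp
  have "\<bar>wave_pot_s a s x\<bar> \<le> 1 / ?q"
    unfolding wave_pot_s_def using abs_Im_le_cmod by (metis norm_divide norm_one)
  also have "\<dots> \<le> 1 / a" by (rule frac_le) (use q a in auto)
  finally show ?thesis .
qed

lemma wave_pot_ss_bound: "\<bar>wave_pot_ss a s x\<bar> \<le> 1 / a\<^sup>2"
  using norm_second_derivative_le[of "Complex a (- s)" "(norm x)\<^sup>2"] a abs_Re_le_cmod order_trans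
  unfolding wave_pot_ss_def by fastforce

text \<open>The inequality |x| \<le> |z + Q| cancels one factor of the denominator.\<close>

lemma wave_pot_i_bound: "\<bar>wave_pot_i i a s x\<bar> \<le> 1 / cmod (radical (Complex a (- s)) (of_real ((norm x)\<^sup>2)))"
proof -
  let ?z = "Complex a (- s)" let ?Q = "radical ?z (of_real ((norm x)\<^sup>2))"
  have nz: "?Q \<noteq> 0" "?z + ?Q \<noteq> 0"
    by (rule radical_nonzero; use a in simp) (rule radical_sum_nonzero; use a in simp)
  have "(norm x)\<^sup>2 \<le> (cmod (?z + ?Q))\<^sup>2" by (rule norm_radical_sum_ge) (use a in auto)
  then have "norm x \<le> cmod (?z + ?Q)" by (rule power2_le_imp_le) simp
  then have x: "\<bar>x $ i\<bar> \<le> cmod (?z + ?Q)" using component_le_norm_cart[of x i] by linarith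
  have "\<bar>wave_pot_i i a s x\<bar> \<le> \<bar>x $ i\<bar> * cmod (1 / (?Q * (?z + ?Q)))"
    unfolding wave_pot_i_def Let_def abs_mult by (intro mult_left_mono abs_Re_le_cmod) auto
  also have "\<dots> \<le> cmod (?z + ?Q) * cmod (1 / (?Q * (?z + ?Q)))" using x by (intro mult_right_mono) auto
  also have "\<dots> = 1 / cmod ?Q" using nz by (simp add: norm_divide norm_mult)
  finally show ?thesis .
qed

lemma wave_pot_i_bound_const: "\<bar>wave_pot_i i a s x\<bar> \<le> 1 / a"
proof -
  let ?q = "cmod (radical (Complex a (- s)) (of_real ((norm x)\<^sup>2)))"
  have q: "?q \<ge> a" using norm_radical_ge_Re[of "Complex a (- s)" "(norm x)\<^sup>2"] a by simp
  have "1 / ?q \<le> 1 / a" by (rule frac_le) (use q a in auto)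
  then show ?thesis using wave_pot_i_bound[of i] by linarith
qed

text \<open>The uniform bound 1/a would control the truncation error only by a constant in S; the
  additional decay in x brings it down to log S / sqrt S.\<close>

lemma wave_pot_i_bound_decay:
  "\<bar>wave_pot_i i a s x\<bar> \<le> sqrt ((1 + 2 * (a\<^sup>2 + s\<^sup>2) + a\<^sup>2) / a\<^sup>2) / sqrt (1 + (norm x)\<^sup>2)"
proof -
  let ?q = "cmod (radical (Complex a (- s)) (of_real ((norm x)\<^sup>2)))"
  let ?D = "(1 + 2 * (a\<^sup>2 + s\<^sup>2) + a\<^sup>2) / a\<^sup>2"
  have q: "?q \<ge> a" using norm_radical_ge_Re[of "Complex a (- s)" "(norm x)\<^sup>2"] a by simp
  have "1 + (norm x)\<^sup>2 \<le> ?q\<^sup>2 * ?D"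
    using norm_radical_ge_decay[of "Complex a (- s)" "(norm x)\<^sup>2"] a by (simp add: cmod_power2)
  then have "sqrt (1 + (norm x)\<^sup>2) \<le> ?q * sqrt ?D"
    using real_sqrt_le_mono[of "1 + (norm x)\<^sup>2" "?q\<^sup>2 * ?D"] by (simp only: real_sqrt_mult real_sqrt_abs abs_norm_cancel)
  moreover have "sqrt (1 + (norm x)\<^sup>2) > 0" by (simp add: add_pos_nonneg)
  ultimately have "1 / ?q \<le> sqrt ?D / sqrt (1 + (norm x)\<^sup>2)"
  proof -
    have "?q > 0" using q a by linarith
    then show ?thesis using \<open>sqrt (1 + (norm x)\<^sup>2) \<le> ?q * sqrt ?D\<close> \<open>sqrt (1 + (norm x)\<^sup>2) > 0\<close>
      by (simp only: divide_le_eq le_divide_eq mult_1 mult_1_right times_divide_eq_left divide_divide_eq_left)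
        (simp add: mult.commute)
  qed
  then show ?thesis using wave_pot_i_bound[of i] by linarith
qed

end

section \<open>Value at the origin, joint continuity and exact radial integrals\<close>

lemma wave_pot_at_origin:
  assumes "a > 0"
  shows "wave_pot a s 0 = ln (4 * (a\<^sup>2 + s\<^sup>2)) / 2"
proof -
  let ?z = "Complex a (- s)"
  have "radical ?z 0 = ?z"
    unfolding radical_def using csqrt_square[of ?z] assms by (metis add_0_right complex.sel(1))
  then have "wave_pot a s 0 = Re (Ln (2 * ?z))"
    by (simp only: wave_pot_def log_potential_def mult_2 norm_zero zero_power2 of_real_0)
  also have "\<dots> = ln (cmod (2 * ?z))"
    using assms by (intro Re_Ln) (auto simp: complex_eq_iff)
  also have "\<dots> = ln (sqrt (4 * (a\<^sup>2 + s\<^sup>2)))"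
    by (simp add: norm_mult cmod_def real_sqrt_mult)
  also have "\<dots> = ln (4 * (a\<^sup>2 + s\<^sup>2)) / 2"
    using assms by (intro ln_sqrt) (simp add: add_pos_nonneg)
  finally show ?thesis .
qed

lemma continuous_wave_pot:
  fixes f :: "'p::topological_space \<Rightarrow> real" and g :: "'p \<Rightarrow> real^2"
  assumes a: "a > 0" and f: "continuous_on S f" and g: "continuous_on S g"
  shows "continuous_on S (\<lambda>p. wave_pot a (f p) (g p))"
    "continuous_on S (\<lambda>p. wave_pot_s a (f p) (g p))"
    "continuous_on S (\<lambda>p. wave_pot_ss a (f p) (g p))"
    "continuous_on S (\<lambda>p. wave_pot_i i a (f p) (g p))"
    "continuous_on S (\<lambda>p. wave_pot_ii i a (f p) (g p))"
proof -
  have z: "continuous_on S (\<lambda>p. Complex a (- f p))"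
    unfolding Complex_eq using f by (intro continuous_intros)
  have Q: "continuous_on S (\<lambda>p. radical (Complex a (- f p)) (of_real ((norm (g p))\<^sup>2)))"
    using a z g by (intro continuous_on_radical) (auto intro!: continuous_intros)
  have nz: "radical (Complex a (- f p)) (of_real ((norm (g p))\<^sup>2)) \<noteq> 0"
    "Complex a (- f p) + radical (Complex a (- f p)) (of_real ((norm (g p))\<^sup>2)) \<noteq> 0"
    "Complex a (- f p) + radical (Complex a (- f p)) (of_real ((norm (g p))\<^sup>2)) \<notin> \<real>\<^sub>\<le>\<^sub>0" for p
    using radical_nonzero[of "Complex a (- f p)" "(norm (g p))\<^sup>2"] radical_sum_nonzero[of "Complex a (- f p)" "(norm (g p))\<^sup>2"]
      radical_sum_not_nonpos[of "Complex a (- f p)" "(norm (g p))\<^sup>2"] a by auto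
  show "continuous_on S (\<lambda>p. wave_pot a (f p) (g p))"
    unfolding wave_pot_def log_potential_def using f z Q nz by (intro continuous_intros) auto
  show "continuous_on S (\<lambda>p. wave_pot_s a (f p) (g p))"
    unfolding wave_pot_s_def using f z Q nz by (intro continuous_intros) auto
  show "continuous_on S (\<lambda>p. wave_pot_ss a (f p) (g p))"
    unfolding wave_pot_ss_def using f z Q nz by (intro continuous_intros) auto
  show "continuous_on S (\<lambda>p. wave_pot_i i a (f p) (g p))"
    unfolding wave_pot_i_def Let_def using f z Q nz g by (intro continuous_intros) auto
  show "continuous_on S (\<lambda>p. wave_pot_ii i a (f p) (g p))"
    unfolding wave_pot_ii_def Let_def using f z Q nz g by (intro continuous_intros) auto
qed

text \<open>For w = 1/Q, (Im w)^2 = (|w|^2 - Re (w^2)) / 2, and w^2 = 1 / (v + c - i b) with v =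
  |x|^2. So the square is an explicit function \<open>f\<close> of v with antiderivative ln (1 + (v
  + c) / R v) / 2. The integral is pi times the difference of its limit (ln 2) / 2 and its value at
  0, where 1 + c / R 0 = 2 a^2 / (a^2 + s^2).\<close>

lemma nn_integral_wave_pot_s_sq:
  assumes "a > 0" "s > 0"
  shows "(\<integral>\<^sup>+x. ennreal ((wave_pot_s a s x)\<^sup>2) \<partial>lborel) = ennreal (pi / 2 * ln ((a\<^sup>2 + s\<^sup>2) / a\<^sup>2))"
proof -
  define b where "b = 2 * a * s"
  define c where "c = a\<^sup>2 - s\<^sup>2"
  have b: "b > 0" using assms by (simp add: b_def)
  define R where "R v = sqrt ((v + c)\<^sup>2 + b\<^sup>2)" for v
  have R2: "(R v)\<^sup>2 = (v + c)\<^sup>2 + b\<^sup>2" for v by (simp add: R_def)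
  have R: "R v > \<bar>v + c\<bar>" "R v > 0" for v
  proof -
    have "sqrt ((v + c)\<^sup>2) < R v" unfolding R_def using b by (intro real_sqrt_less_mono) simp
    then show "R v > \<bar>v + c\<bar>" by simp
    then show "R v > 0" by linarith
  qed
  define f where "f v = (R v - (v + c)) / (2 * (R v)\<^sup>2)" for v
  define F where "F v = ln (1 + (v + c) / R v) / 2" for v
  have psi: "(wave_pot_s a s x)\<^sup>2 = f ((norm x)\<^sup>2)" for x
  proof -
    let ?z = "Complex a (- s)" let ?u = "complex_of_real ((norm x)\<^sup>2)"
    let ?w = "1 / radical ?z ?u"
    have w2: "?w\<^sup>2 = 1 / Complex ((norm x)\<^sup>2 + c) (- b)"
    proof -
      have "?z\<^sup>2 + ?u = Complex ((norm x)\<^sup>2 + c) (- b)"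
        by (simp add: complex_eq_iff power2_eq_square b_def c_def)
      then show ?thesis using assms(1) radical_sq[of ?z "(norm x)\<^sup>2"] by (simp add: power_one_over)
    qed
    have "cmod (Complex ((norm x)\<^sup>2 + c) (- b)) = R ((norm x)\<^sup>2)"
      by (simp add: cmod_def R_def)
    then have n: "(cmod ?w)\<^sup>2 = 1 / R ((norm x)\<^sup>2)"
      by (metis w2 norm_power norm_divide norm_one)
    have "Re (?w\<^sup>2) = ((norm x)\<^sup>2 + c) / (R ((norm x)\<^sup>2))\<^sup>2"
      by (subst w2) (simp add: Re_divide R2)
    moreover have "Re (?w\<^sup>2) = (cmod ?w)\<^sup>2 - 2 * (Im ?w)\<^sup>2"
    proof -
      have "Re (w\<^sup>2) = (cmod w)\<^sup>2 - 2 * (Im w)\<^sup>2" for w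
        by (simp add: cmod_power2) (simp add: power2_eq_square)
      then show ?thesis .
    qed
    moreover have "i = (m - r) / 2" if "k = r" "k = l - 2 * i" "l = m" for i m r k l :: real
      using that by simp
    ultimately have "(Im ?w)\<^sup>2 = (1 / R ((norm x)\<^sup>2) - ((norm x)\<^sup>2 + c) / (R ((norm x)\<^sup>2))\<^sup>2) / 2"
      using n by blast
    also have "\<dots> = f ((norm x)\<^sup>2)"
      using R(2)[of "(norm x)\<^sup>2"] by (simp add: f_def field_simps power2_eq_square)
    finally show ?thesis by (simp only: wave_pot_s_def)
  qed
  have F': "DERIV F v :> f v" for v
  proof -
    have R': "(R has_real_derivative (v + c) / R v) (at v)"
      unfolding R_def using b by (auto intro!: derivative_eq_intros simp: add_nonneg_pos field_simps not_sum_power2_lt_zero)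
    have p: "1 + (v + c) / R v > 0" using R[of v] by (simp add: field_simps abs_if split: if_splits)
    have "(F has_real_derivative (1 / (1 + (v + c) / R v)) * ((1 * R v - (v + c) * ((v + c) / R v)) / (R v * R v)) / 2) (at v)"
    proof -
      have "((\<lambda>v. v + c) has_real_derivative 1) (at v)" by (auto intro!: derivative_eq_intros)
      from DERIV_add[OF DERIV_const[of 1] DERIV_divide[OF this R']]
      have "((\<lambda>v. 1 + (v + c) / R v) has_real_derivative (1 * R v - (v + c) * ((v + c) / R v)) / (R v * R v)) (at v)"
        using R(2)[of v] by simp
      from DERIV_cdivide[OF DERIV_chain2[OF DERIV_ln_divide[OF p] this], of 2] show ?thesis
        unfolding F_def .
    qed
    moreover have "(1 / (1 + y / r)) * ((1 * r - y * (y / r)) / (r * r)) / 2 = (r - y) / (2 * r\<^sup>2)"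
      if "r > 0" "r + y > 0" for r y :: real
    proof -
      have "1 * r - y * (y / r) = (r - y) * (r + y) / r" "1 + y / r = (r + y) / r"
        using that by (simp_all add: field_simps)
      then show ?thesis using that by (simp add: power2_eq_square)
    qed
    ultimately show ?thesis using R[of v] by (simp add: f_def)
  qed
  have F_lim: "(F \<longlongrightarrow> ln 2 / 2) at_top"
  proof -
    \<comment> \<open>For large v, R v / (v + c) = sqrt (1 + (b / (c + v))^2), which tends to
      1.\<close>
    have "filterlim (\<lambda>v. c + v) at_top at_top"
      by (rule filterlim_tendsto_add_at_top[OF tendsto_const filterlim_ident])
    then have "((\<lambda>v. b / (c + v)) \<longlongrightarrow> 0) at_top"
      by (intro tendsto_divide_0[OF tendsto_const] filterlim_at_top_imp_at_infinity)
    then have "((\<lambda>v. ln (1 + 1 / sqrt (1 + (b / (c + v))\<^sup>2)) / 2) \<longlongrightarrow> ln (1 + 1 / sqrt (1 + 0\<^sup>2)) / 2) at_top"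
      by (intro tendsto_intros) auto
    moreover have "eventually (\<lambda>v. ln (1 + 1 / sqrt (1 + (b / (c + v))\<^sup>2)) / 2 = F v) at_top"
      using eventually_gt_at_top[of "- c"]
    proof eventually_elim
      case (elim v)
      then have "sqrt (1 + (b / (c + v))\<^sup>2) = sqrt (((c + v)\<^sup>2 + b\<^sup>2) / (c + v)\<^sup>2)"
        by (simp add: field_simps)
      also have "\<dots> = R v / (v + c)"
        using elim by (simp add: real_sqrt_divide R_def add.commute)
      finally show ?case by (simp add: F_def)
    qed
    ultimately show ?thesis by (simp add: Lim_transform_eventually)
  qed
  have fm: "f \<in> borel_measurable borel" unfolding f_def R_def by measurable
  have "(\<integral>\<^sup>+x. ennreal ((wave_pot_s a s x)\<^sup>2) \<partial>lborel) = (\<integral>\<^sup>+x. ennreal (f ((norm (x::real^2))\<^sup>2)) \<partial>lborel)"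
    by (simp add: psi)
  also have "\<dots> = ennreal pi * (\<integral>\<^sup>+v. ennreal (f v) * indicator {0..} v \<partial>lborel)"
    using nn_integral_radial[of "\<lambda>v. ennreal (f v)"] fm by simp
  also have "(\<integral>\<^sup>+v. ennreal (f v) * indicator {0..} v \<partial>lborel) = ennreal (ln 2 / 2 - F 0)"
  proof (rule nn_integral_FTC_atLeast[OF fm F' _ F_lim])
    show "0 \<le> f v" for v unfolding f_def using R[of v] by (simp add: divide_nonneg_pos)
  qed
  also have "ln 2 / 2 - F 0 = ln ((a\<^sup>2 + s\<^sup>2) / a\<^sup>2) / 2"
  proof -
    have "R 0 = a\<^sup>2 + s\<^sup>2"
      unfolding R_def by (rule real_sqrt_unique) (auto simp: b_def c_def power2_eq_square algebra_simps)
    then have "1 + (0 + c) / R 0 = 2 * a\<^sup>2 / (a\<^sup>2 + s\<^sup>2)"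
      using assms by (simp add: c_def add_pos_pos field_simps)
    then have "F 0 = ln (2 * a\<^sup>2 / (a\<^sup>2 + s\<^sup>2)) / 2" by (simp add: F_def)
    also have "ln (2 * a\<^sup>2 / (a\<^sup>2 + s\<^sup>2)) = ln 2 - ln ((a\<^sup>2 + s\<^sup>2) / a\<^sup>2)"
      using assms by (simp add: ln_div ln_mult add_pos_pos)
    finally show ?thesis by (simp add: field_simps)
  qed
  finally show ?thesis by (simp add: ennreal_mult'[symmetric])
qed

text \<open>The truncation error contains two factors of size 1/|x| on a disc. Their product
  integrates to a logarithm, which the factor 1 / sqrt S of the cutoff gradient beats.\<close>

lemma nn_integral_disc_inverse:
  assumes "S \<ge> 0"
  shows "(\<integral>\<^sup>+x. ennreal (indicator {..S} ((norm (x::real^2))\<^sup>2) / (1 + (norm x)\<^sup>2)) \<partial>lborel) = ennreal (pi * ln (1 + S))"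
proof -
  have "(\<integral>\<^sup>+x. ennreal (indicator {..S} ((norm (x::real^2))\<^sup>2) / (1 + (norm x)\<^sup>2)) \<partial>lborel)
    = ennreal pi * (\<integral>\<^sup>+v. ennreal (indicator {..S} v / (1 + v)) * indicator {0..} v \<partial>lborel)"
    using nn_integral_radial[of "\<lambda>v. ennreal (indicator {..S} v / (1 + v))"] by simp
  also have "(\<integral>\<^sup>+v. ennreal (indicator {..S} v / (1 + v)) * indicator {0..} v \<partial>lborel)
    = (\<integral>\<^sup>+v. ennreal (1 / (1 + v)) * indicator {0..S} v \<partial>lborel)"
    by (intro nn_integral_cong) (auto simp: indicator_def)
  also have "\<dots> = ennreal (ln (1 + S) - ln (1 + 0))"
    by (rule nn_integral_FTC_Icc) (use assms in \<open>auto intro!: derivative_eq_intros\<close>)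
  finally show ?thesis by (simp add: ennreal_mult'[symmetric])
qed

subsection \<open>Cutoff\<close>

text \<open>\<open>S\<close> is the squared radius. The cube is the least integer power of the
  positive part that is twice continuously differentiable, as two integrations by parts require, and
  the dependence on |x|^2 avoids a singularity at the origin.\<close>

definition cutoff :: "real \<Rightarrow> real^2 \<Rightarrow> real" where
  "cutoff S x = (max 0 (1 - (norm x)\<^sup>2 / S)) ^ 3"

definition cutoff_i :: "2 \<Rightarrow> real \<Rightarrow> real^2 \<Rightarrow> real" where
  "cutoff_i i S x = 3 * (max 0 (1 - (norm x)\<^sup>2 / S))\<^sup>2 * (- 2 * x $ i / S)"

definition cutoff_ii :: "2 \<Rightarrow> real \<Rightarrow> real^2 \<Rightarrow> real" where
  "cutoff_ii i S x = 6 * max 0 (1 - (norm x)\<^sup>2 / S) * (2 * x $ i / S)\<^sup>2 - 6 * (max 0 (1 - (norm x)\<^sup>2 / S))\<^sup>2 / S"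

text \<open>The exponent is at least 2, so the difference quotient at 0 is a positive power of
  \<open>max 0 h\<close> and tends to 0.\<close>

lemma positive_part_power_derivative:
  "((\<lambda>u::real. (max 0 u) ^ Suc (Suc k)) has_real_derivative real (Suc (Suc k)) * (max 0 u) ^ Suc k) (at u)"
proof -
  consider "u > 0" | "u < 0" | "u = 0" by linarith
  then show ?thesis
  proof cases
    case 1
    have "((\<lambda>u::real. u ^ Suc (Suc k)) has_real_derivative real (Suc (Suc k)) * (max 0 u) ^ Suc k) (at u)"
      using 1 DERIV_pow[of "Suc (Suc k)" u UNIV] by simp
    then show ?thesis
      by (rule has_field_derivative_transform_within_open[of _ _ _ "{0<..}"]) (use 1 in auto)
  next
    case 2
    have "((\<lambda>u::real. 0) has_real_derivative real (Suc (Suc k)) * (max 0 u) ^ Suc k) (at u)"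
      using 2 by simp
    then show ?thesis
      by (rule has_field_derivative_transform_within_open[of _ _ _ "{..<0}"]) (use 2 in auto)
  next
    case 3
    have "((\<lambda>h::real. (max 0 h) ^ Suc k) \<longlongrightarrow> (max 0 0) ^ Suc k) (at 0)"
      by (intro tendsto_intros)
    moreover have "(max 0 h) ^ Suc (Suc k) / h = (max 0 h) ^ Suc k" if "h \<noteq> 0" for h :: real
      using that by (cases "h > 0") (auto simp: max_def)
    ultimately have "((\<lambda>h::real. (max 0 h) ^ Suc (Suc k) / h) \<longlongrightarrow> 0) (at 0)"
      by (subst tendsto_cong[of _ "\<lambda>h. (max 0 h) ^ Suc k"]) (auto simp: eventually_at_filter)
    then show ?thesis using 3 by (simp add: DERIV_def)
  qed
qed

lemma cutoff_argument_derivative: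
  fixes x :: "real^2"
  shows "((\<lambda>\<tau>. 1 - (norm (x + \<tau> *\<^sub>R axis i 1))\<^sup>2 / S) has_real_derivative - 2 * x $ i / S) (at 0)"
  using DERIV_diff[OF DERIV_const[of 1] DERIV_cdivide[of "\<lambda>\<tau>. (norm (x + \<tau> *\<^sub>R axis i 1))\<^sup>2" "2 * x $ i" 0 UNIV S]]
    norm_sq_line_derivative[of x i] unfolding has_real_derivative_iff_has_vector_derivative[symmetric]
  by simp

lemma cutoff_has_derivative_i:
  "((\<lambda>\<tau>. cutoff S (x + \<tau> *\<^sub>R axis i 1)) has_vector_derivative cutoff_i i S x) (at 0)"
proof -
  have "((\<lambda>\<tau>. (max 0 (1 - (norm (x + \<tau> *\<^sub>R axis i 1))\<^sup>2 / S)) ^ Suc (Suc 1)) has_real_derivative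
     real (Suc (Suc 1)) * (max 0 (1 - (norm (x + 0 *\<^sub>R axis i 1))\<^sup>2 / S)) ^ Suc 1 * (- 2 * x $ i / S)) (at 0)"
    by (rule DERIV_chain2[OF positive_part_power_derivative cutoff_argument_derivative])
  then show ?thesis
    by (simp add: cutoff_def cutoff_i_def has_real_derivative_iff_has_vector_derivative[symmetric] numeral_eq_Suc mult.assoc)
qed

lemma cutoff_i_has_derivative_i:
  "((\<lambda>\<tau>. cutoff_i i S (x + \<tau> *\<^sub>R axis i 1)) has_vector_derivative cutoff_ii i S x) (at 0)"
proof -
  have m: "((\<lambda>\<tau>. (max 0 (1 - (norm (x + \<tau> *\<^sub>R axis i 1))\<^sup>2 / S))\<^sup>2) has_real_derivative
     2 * max 0 (1 - (norm x)\<^sup>2 / S) * (- 2 * x $ i / S)) (at 0)"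
    using DERIV_chain2[OF positive_part_power_derivative[of 0] cutoff_argument_derivative[of x i S]]
    by (simp add: numeral_eq_Suc)
  have x: "((\<lambda>\<tau>. (x + \<tau> *\<^sub>R axis i 1) $ i) has_real_derivative 1) (at 0)"
    by (auto intro!: derivative_eq_intros)
  have "((\<lambda>\<tau>. cutoff_i i S (x + \<tau> *\<^sub>R axis i 1)) has_real_derivative
     (3 * (2 * max 0 (1 - (norm x)\<^sup>2 / S) * (- 2 * x $ i / S))) * (- 2 * x $ i / S)
      + (- 2 * 1 / S) * (3 * (max 0 (1 - (norm x)\<^sup>2 / S))\<^sup>2)) (at 0)"
    unfolding cutoff_i_def
    using DERIV_mult[OF DERIV_cmult[OF m, of 3] DERIV_cdivide[OF DERIV_cmult[OF x, of "- 2"], of S]] by simp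
  moreover have "(3 * (2 * max 0 (1 - (norm x)\<^sup>2 / S) * (- 2 * x $ i / S))) * (- 2 * x $ i / S)
      + (- 2 * 1 / S) * (3 * (max 0 (1 - (norm x)\<^sup>2 / S))\<^sup>2) = cutoff_ii i S x"
    by (simp add: cutoff_ii_def power2_eq_square)
  ultimately show ?thesis by (simp add: has_real_derivative_iff_has_vector_derivative)
qed

lemma continuous_cutoff:
  assumes "continuous_on A g"
  shows "continuous_on A (\<lambda>p. cutoff S (g p))" "continuous_on A (\<lambda>p. cutoff_i i S (g p))"
    "continuous_on A (\<lambda>p. cutoff_ii i S (g p))"
  unfolding cutoff_def cutoff_i_def cutoff_ii_def divide_inverse using assms
  by (auto intro!: continuous_intros)

context
  fixes S :: real and x :: "real^2"
  assumes S: "S \<ge> 1"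
begin

lemma cutoff_eq_0:
  assumes "(norm x)\<^sup>2 \<ge> S"
  shows "cutoff S x = 0" "cutoff_i i S x = 0" "cutoff_ii i S x = 0"
proof -
  have "max 0 (1 - (norm x)\<^sup>2 / S) = 0" using assms S by (simp add: max_def field_simps)
  then show "cutoff S x = 0" "cutoff_i i S x = 0" "cutoff_ii i S x = 0"
    unfolding cutoff_def cutoff_i_def cutoff_ii_def by simp_all
qed

lemma cutoff_arg_range: "0 \<le> max 0 (1 - (norm x)\<^sup>2 / S)" "max 0 (1 - (norm x)\<^sup>2 / S) \<le> 1"
  using S by auto

lemma cutoff_range: "0 \<le> cutoff S x" "cutoff S x \<le> 1"
  unfolding cutoff_def using cutoff_arg_range by (auto intro: power_le_one)

text \<open>Bernoulli's inequality gives 3 y with y = |x|^2 / S; passing from y to sqrt y makes the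
  loss linear in |x|, which matches the first moment that the data provide.\<close>

lemma cutoff_defect: "1 - cutoff S x \<le> 3 * norm x / sqrt S"
proof (cases "(norm x)\<^sup>2 \<le> S")
  case True
  define y where "y = (norm x)\<^sup>2 / S"
  have y: "0 \<le> y" "y \<le> 1" using True S by (auto simp: y_def)
  have "1 - (1 - y) ^ 3 \<le> 3 * y"
    using Bernoulli_inequality[of "- y" 3] y by simp
  also have "y \<le> sqrt y" using y by (simp add: real_le_rsqrt power2_eq_square mult_left_le)
  also have "sqrt y = norm x / sqrt S" by (simp add: y_def real_sqrt_divide)
  finally show ?thesis using y by (simp add: cutoff_def y_def[symmetric])
next
  case False
  then have "S \<le> (norm x)\<^sup>2" by simp
  then have "sqrt S \<le> norm x" by (metis norm_ge_zero real_sqrt_le_mono real_sqrt_abs abs_of_nonneg)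
  then have "1 \<le> norm x / sqrt S" using S by (simp add: field_simps)
  then show ?thesis using cutoff_range by simp
qed

lemma cutoff_i_bound: "\<bar>cutoff_i i S x\<bar> \<le> 6 / sqrt S * indicator {..S} ((norm x)\<^sup>2)"
proof (cases "(norm x)\<^sup>2 \<le> S")
  case True
  have "norm x \<le> sqrt S" using real_sqrt_le_mono[OF True] by simp
  then have x: "\<bar>x $ i\<bar> \<le> sqrt S" using component_le_norm_cart[of x i] by linarith
  have "\<bar>cutoff_i i S x\<bar> = 3 * (max 0 (1 - (norm x)\<^sup>2 / S))\<^sup>2 * (2 * \<bar>x $ i\<bar> / S)"
    unfolding cutoff_i_def using S by (simp add: abs_mult)
  also have "\<dots> \<le> 3 * 1 * (2 * sqrt S / S)"
    using x S cutoff_arg_range by (intro mult_mono divide_right_mono) (auto intro: power_le_one)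
  also have "\<dots> = 6 / sqrt S" using S by (simp add: field_simps)
  finally show ?thesis using True by simp
next
  case False
  then show ?thesis using cutoff_eq_0 by simp
qed

text \<open>On the support |x_i| \<le> sqrt S, so the two terms contribute 24 / S and 6 / S.\<close>

lemma cutoff_ii_bound: "\<bar>cutoff_ii i S x\<bar> \<le> 30 / S * indicator {..S} ((norm x)\<^sup>2)"
proof (cases "(norm x)\<^sup>2 \<le> S")
  case True
  have x: "(x $ i)\<^sup>2 \<le> S"
    using component_le_norm_cart[of x i] True power_mono[of "\<bar>x $ i\<bar>" "norm x" 2] by simp
  have "(2 * x $ i / S)\<^sup>2 = 4 * (x $ i)\<^sup>2 / S\<^sup>2" by (simp add: power2_eq_square)
  also have "\<dots> \<le> 4 * S / S\<^sup>2" using x by (intro divide_right_mono) auto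
  also have "\<dots> = 4 / S" using S by (simp add: power2_eq_square)
  finally have "6 * max 0 (1 - (norm x)\<^sup>2 / S) * (2 * x $ i / S)\<^sup>2 \<le> 6 * 1 * (4 / S)"
    using cutoff_arg_range S by (intro mult_mono) auto
  moreover have "6 * (max 0 (1 - (norm x)\<^sup>2 / S))\<^sup>2 / S \<le> 6 * 1 / S"
    using cutoff_arg_range S by (intro divide_right_mono mult_left_mono power_le_one) auto
  moreover have "6 * max 0 (1 - (norm x)\<^sup>2 / S) * (2 * x $ i / S)\<^sup>2 \<ge> 0" "6 * (max 0 (1 - (norm x)\<^sup>2 / S))\<^sup>2 / S \<ge> 0"
    using S by auto
  ultimately have "\<bar>cutoff_ii i S x\<bar> \<le> 6 * 1 * (4 / S) + 6 * 1 / S"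
    unfolding cutoff_ii_def by linarith
  then show ?thesis using True by simp
next
  case False
  then show ?thesis using cutoff_eq_0 by simp
qed

end

subsection \<open>The test wave vanishing at a given time\<close>

text \<open>The wave equation is invariant under s -> 2 t - s, so the odd part about s = t is again
  a wave. As it vanishes there, the terminal pairing contains n(t) but not its time
  derivative.\<close>

definition twave :: "real \<Rightarrow> real \<Rightarrow> real^2 \<Rightarrow> real" where
  "twave t s x = (wave_pot (sqrt t) (2 * t - s) x - wave_pot (sqrt t) s x) / 2"

definition twave_s :: "real \<Rightarrow> real \<Rightarrow> real^2 \<Rightarrow> real" where
  "twave_s t s x = - (wave_pot_s (sqrt t) (2 * t - s) x + wave_pot_s (sqrt t) s x) / 2"

definition twave_ss :: "real \<Rightarrow> real \<Rightarrow> real^2 \<Rightarrow> real" where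
  "twave_ss t s x = (wave_pot_ss (sqrt t) (2 * t - s) x - wave_pot_ss (sqrt t) s x) / 2"

definition twave_i :: "2 \<Rightarrow> real \<Rightarrow> real \<Rightarrow> real^2 \<Rightarrow> real" where
  "twave_i i t s x = (wave_pot_i i (sqrt t) (2 * t - s) x - wave_pot_i i (sqrt t) s x) / 2"

definition twave_ii :: "2 \<Rightarrow> real \<Rightarrow> real \<Rightarrow> real^2 \<Rightarrow> real" where
  "twave_ii i t s x = (wave_pot_ii i (sqrt t) (2 * t - s) x - wave_pot_ii i (sqrt t) s x) / 2"

lemma half_combination_bound:
  fixes p q B :: real
  assumes "\<bar>p\<bar> \<le> B" "\<bar>q\<bar> \<le> B"
  shows "\<bar>(p - q) / 2\<bar> \<le> B" "\<bar>- (p + q) / 2\<bar> \<le> B"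
  using assms by (auto simp: abs_le_iff)

lemma line_derivative_bound:
  fixes f :: "'a::real_vector \<Rightarrow> real"
  assumes "\<And>x. ((\<lambda>\<tau>. f (x + \<tau> *\<^sub>R e)) has_vector_derivative f' x) (at 0)" "\<And>x. \<bar>f' x\<bar> \<le> B"
  shows "\<bar>f (x + h *\<^sub>R e) - f x\<bar> \<le> B * \<bar>h\<bar>"
proof -
  have "norm (f (x + h *\<^sub>R e) - f (x + 0 *\<^sub>R e)) \<le> B * norm (h - 0)"
  proof (rule field_differentiable_bound[OF convex_UNIV])
    show "((\<lambda>\<tau>. f (x + \<tau> *\<^sub>R e)) has_real_derivative f' (x + s *\<^sub>R e)) (at s within UNIV)" for s
      using line_derivative_shift[OF assms(1)] by simp
  qed (use assms(2) in auto)
  then show ?thesis by simp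
qed

context
  fixes t :: real
  assumes t: "t \<ge> 1"
begin

lemma twave_has_derivative_s: "((\<lambda>s. twave t s x) has_vector_derivative twave_s t s x) (at s)"
proof -
  have a: "sqrt t > 0" using t by simp
  have "((\<lambda>s. wave_pot (sqrt t) (2 * t - s) x) has_real_derivative wave_pot_s (sqrt t) (2 * t - s) x * (- 1)) (at s)"
    by (rule DERIV_chain2[of "\<lambda>s. wave_pot (sqrt t) s x"])
      (use wave_pot_has_derivative_s[OF a] in \<open>auto intro!: derivative_eq_intros simp: has_real_derivative_iff_has_vector_derivative\<close>)
  moreover have "((\<lambda>s. wave_pot (sqrt t) s x) has_real_derivative wave_pot_s (sqrt t) s x) (at s)"
    using wave_pot_has_derivative_s[OF a] by (simp add: has_real_derivative_iff_has_vector_derivative)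
  ultimately show ?thesis
    unfolding has_real_derivative_iff_has_vector_derivative[symmetric] twave_def twave_s_def
    using t by (auto intro!: derivative_eq_intros)
qed

lemma twave_s_has_derivative_s: "((\<lambda>s. twave_s t s x) has_vector_derivative twave_ss t s x) (at s)"
proof -
  have a: "sqrt t > 0" using t by simp
  have "((\<lambda>s. wave_pot_s (sqrt t) (2 * t - s) x) has_real_derivative wave_pot_ss (sqrt t) (2 * t - s) x * (- 1)) (at s)"
    by (rule DERIV_chain2[of "\<lambda>s. wave_pot_s (sqrt t) s x"])
      (use wave_pot_s_has_derivative_s[OF a] in \<open>auto intro!: derivative_eq_intros simp: has_real_derivative_iff_has_vector_derivative\<close>)
  moreover have "((\<lambda>s. wave_pot_s (sqrt t) s x) has_real_derivative wave_pot_ss (sqrt t) s x) (at s)"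
    using wave_pot_s_has_derivative_s[OF a] by (simp add: has_real_derivative_iff_has_vector_derivative)
  ultimately show ?thesis
    unfolding has_real_derivative_iff_has_vector_derivative[symmetric] twave_s_def twave_ss_def
    using t by (auto intro!: derivative_eq_intros)
qed

lemma twave_has_derivative_i:
  "((\<lambda>\<tau>. twave t s (x + \<tau> *\<^sub>R axis i 1)) has_vector_derivative twave_i i t s x) (at 0)"
  using wave_pot_has_derivative_i[of "sqrt t"] t
  unfolding twave_def twave_i_def has_real_derivative_iff_has_vector_derivative[symmetric]
  by (intro DERIV_cdivide DERIV_diff) auto

lemma twave_i_has_derivative_i:
  "((\<lambda>\<tau>. twave_i i t s (x + \<tau> *\<^sub>R axis i 1)) has_vector_derivative twave_ii i t s x) (at 0)"
  using wave_pot_i_has_derivative_i[of "sqrt t"] t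
  unfolding twave_i_def twave_ii_def has_real_derivative_iff_has_vector_derivative[symmetric]
  by (intro DERIV_cdivide DERIV_diff) auto

lemma laplacian_twave: "(\<Sum>i\<in>UNIV. twave_ii i t s x) = twave_ss t s x"
  using laplacian_wave_pot[of "sqrt t"] t
  unfolding twave_ii_def twave_ss_def by (simp add: sum_subtractf flip: sum_divide_distrib)

lemma twave_terminal: "twave t t x = 0" "twave_s t t x = - wave_pot_s (sqrt t) t x"
  by (simp_all add: twave_def twave_s_def)

lemma twave_s_bound: "\<bar>twave_s t s x\<bar> \<le> 1"
proof -
  have "1 / sqrt t \<le> 1" using t by simp
  moreover have "\<bar>wave_pot_s (sqrt t) (2 * t - s) x\<bar> \<le> 1 / sqrt t" "\<bar>wave_pot_s (sqrt t) s x\<bar> \<le> 1 / sqrt t"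
    using wave_pot_s_bound[of "sqrt t"] t by auto
  ultimately show ?thesis unfolding twave_s_def by (meson half_combination_bound order_trans)
qed

lemma twave_ss_bound: "\<bar>twave_ss t s x\<bar> \<le> 1 / t"
proof -
  have "\<bar>wave_pot_ss (sqrt t) (2 * t - s) x\<bar> \<le> 1 / t" "\<bar>wave_pot_ss (sqrt t) s x\<bar> \<le> 1 / t"
    using wave_pot_ss_bound[of "sqrt t" "2 * t - s" x] wave_pot_ss_bound[of "sqrt t" s x] t by auto
  then show ?thesis unfolding twave_ss_def by (rule half_combination_bound)
qed

lemma twave_i_bound: "\<bar>twave_i i t s x\<bar> \<le> 1"
proof -
  have "1 / sqrt t \<le> 1" using t by simp
  moreover have "\<bar>wave_pot_i i (sqrt t) (2 * t - s) x\<bar> \<le> 1 / sqrt t" "\<bar>wave_pot_i i (sqrt t) s x\<bar> \<le> 1 / sqrt t"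
    using wave_pot_i_bound_const[of "sqrt t"] t by auto
  ultimately show ?thesis unfolding twave_i_def by (meson half_combination_bound order_trans)
qed

lemma twave_i_decay:
  assumes "1 \<le> s" "s \<le> t"
  shows "\<bar>twave_i i t s x\<bar> \<le> sqrt (1 + 11 * t\<^sup>2) / sqrt (1 + (norm x)\<^sup>2)"
proof -
  have "\<bar>wave_pot_i i (sqrt t) r x\<bar> \<le> sqrt (1 + 11 * t\<^sup>2) / sqrt (1 + (norm x)\<^sup>2)" if "0 \<le> r" "r \<le> 2 * t" for r
  proof -
    have "r\<^sup>2 \<le> (2 * t)\<^sup>2" using that by (intro power_mono) auto
    moreover have "t \<le> t\<^sup>2" using t by (simp add: power2_eq_square)
    \<comment> \<open>With r \<le> 2 t, which also covers the reflected time, the left side is at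
      most 1 + 3 t + 8 t^2, and t \<le> t^2 gives the 11.\<close>
    ultimately have "1 + 2 * (t + r\<^sup>2) + t \<le> 1 + 11 * t\<^sup>2" by simp
    then have "(1 + 2 * (t + r\<^sup>2) + t) / t \<le> (1 + 11 * t\<^sup>2) / 1"
      using t by (intro frac_le) auto
    then have "sqrt ((1 + 2 * ((sqrt t)\<^sup>2 + r\<^sup>2) + (sqrt t)\<^sup>2) / (sqrt t)\<^sup>2) \<le> sqrt (1 + 11 * t\<^sup>2)"
      using t by simp
    then have "sqrt ((1 + 2 * ((sqrt t)\<^sup>2 + r\<^sup>2) + (sqrt t)\<^sup>2) / (sqrt t)\<^sup>2) / sqrt (1 + (norm x)\<^sup>2)
        \<le> sqrt (1 + 11 * t\<^sup>2) / sqrt (1 + (norm x)\<^sup>2)"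
      by (rule divide_right_mono) simp
    then show ?thesis
      using wave_pot_i_bound_decay[of "sqrt t" i r x] t by (simp only: real_sqrt_gt_0_iff) (meson less_le_trans order_trans zero_less_one)
  qed
  from this[of s] this[of "2 * t - s"] show ?thesis
    using assms unfolding twave_i_def by (intro half_combination_bound) auto
qed

text \<open>The time derivative is at most 1 in size and is integrated backwards from the zero at s
  = t.\<close>

lemma twave_bound:
  assumes "1 \<le> s" "s \<le> t"
  shows "\<bar>twave t s x\<bar> \<le> t"
proof -
  have "norm (twave t s x - twave t t x) \<le> 1 * norm (s - t)"
  proof (rule field_differentiable_bound[OF convex_UNIV])
    show "((\<lambda>s. twave t s x) has_real_derivative twave_s t r x) (at r within UNIV)" for r
      using twave_has_derivative_s by (simp add: has_real_derivative_iff_has_vector_derivative)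
  qed (use twave_s_bound in auto)
  then show ?thesis using assms by (simp add: twave_terminal)
qed

text \<open>The path from 0 to x along the axes has two legs, each of length at most |x|, on which
  the slope is at most 1.\<close>

lemma twave_variation: "\<bar>twave t s x - twave t s 0\<bar> \<le> 2 * norm x"
proof -
  have eq: "x = (0 + x $ 1 *\<^sub>R axis 1 1) + x $ 2 *\<^sub>R axis 2 1"
    by (simp add: vec_eq_iff axis_def forall_2)
  have "\<bar>twave t s ((0 + x $ 1 *\<^sub>R axis 1 1) + x $ 2 *\<^sub>R axis 2 1) - twave t s (0 + x $ 1 *\<^sub>R axis 1 1)\<bar> \<le> 1 * \<bar>x $ 2\<bar>"
    by (rule line_derivative_bound[OF twave_has_derivative_i twave_i_bound])
  moreover have "\<bar>twave t s (0 + x $ 1 *\<^sub>R axis 1 1) - twave t s 0\<bar> \<le> 1 * \<bar>x $ 1\<bar>"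
    by (rule line_derivative_bound[OF twave_has_derivative_i twave_i_bound])
  moreover have "\<bar>x $ 1\<bar> \<le> norm x" "\<bar>x $ 2\<bar> \<le> norm x" by (auto intro: component_le_norm_cart)
  ultimately show ?thesis using eq by (smt (verit))
qed

text \<open>At the origin the potential is log |2 z|, and the squared moduli at the times 2 t - 1
  and 1 are in ratio at least t/2. One factor 1/2 is the root in the modulus, the other the half
  difference. Here the factor log t arises.\<close>

lemma twave_initial_origin: "twave t 1 0 \<ge> ln (t / 2) / 4"
proof -
  have "twave t 1 0 = (ln (4 * (t + (2 * t - 1)\<^sup>2)) - ln (4 * (t + 1))) / 4"
    using t by (simp add: twave_def wave_pot_at_origin)
  also have "ln (4 * (t + (2 * t - 1)\<^sup>2)) - ln (4 * (t + 1)) = ln ((t + (2 * t - 1)\<^sup>2) / (t + 1))"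
  proof -
    have "t + (2 * t - 1)\<^sup>2 > 0" "t + 1 > 0" using t by (auto intro!: add_pos_nonneg)
    then show ?thesis by (simp only: ln_mult_pos ln_div) simp
  qed
  finally have "twave t 1 0 = ln ((t + (2 * t - 1)\<^sup>2) / (t + 1)) / 4" .
  moreover have "ln ((t + (2 * t - 1)\<^sup>2) / (t + 1)) \<ge> ln (t / 2)"
  proof -
    have "t * (t + 1) \<le> t * (2 * t)" using t by (intro mult_left_mono) auto
    also have "\<dots> \<le> 2 * (t + (2 * t - 1)\<^sup>2)"
      using power_mono[of t "2 * t - 1" 2] t by (simp add: power2_eq_square)
    finally have "t / 2 \<le> (t + (2 * t - 1)\<^sup>2) / (t + 1)"
      using t by (simp add: field_simps)
    then show ?thesis
      by (intro ln_le_cancel_iff[THEN iffD2]) (use t in \<open>auto intro!: divide_pos_pos add_pos_nonneg\<close>)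
  qed
  ultimately show ?thesis by simp
qed

lemma continuous_twave:
  fixes f :: "'p::topological_space \<Rightarrow> real" and g :: "'p \<Rightarrow> real^2"
  assumes "continuous_on A f" "continuous_on A g"
  shows "continuous_on A (\<lambda>p. twave t (f p) (g p))" "continuous_on A (\<lambda>p. twave_s t (f p) (g p))"
    "continuous_on A (\<lambda>p. twave_ss t (f p) (g p))" "continuous_on A (\<lambda>p. twave_i i t (f p) (g p))"
    "continuous_on A (\<lambda>p. twave_ii i t (f p) (g p))"
proof -
  have a: "sqrt t > 0" using t by simp
  have f: "continuous_on A (\<lambda>p. 2 * t - f p)" using assms by (intro continuous_intros)
  note c = continuous_wave_pot[OF a assms] continuous_wave_pot[OF a f assms(2)]
  show "continuous_on A (\<lambda>p. twave t (f p) (g p))" "continuous_on A (\<lambda>p. twave_s t (f p) (g p))"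
    "continuous_on A (\<lambda>p. twave_ss t (f p) (g p))" "continuous_on A (\<lambda>p. twave_i i t (f p) (g p))"
    "continuous_on A (\<lambda>p. twave_ii i t (f p) (g p))"
    unfolding twave_def twave_s_def twave_ss_def twave_i_def twave_ii_def
    by (intro continuous_intros c; simp)+
qed

end

subsection \<open>The truncated duality pairing\<close>

text \<open>This is the Wronskian in time of \<open>u\<close> and the test wave, formally conserved
  for two free waves when the cutoff is 1; the cutoff confines the integrand to a bounded
  set.\<close>

definition pairing :: "real \<Rightarrow> real \<Rightarrow> (real \<Rightarrow> real^2 \<Rightarrow> real) \<Rightarrow> real \<Rightarrow> real" where
  "pairing S t u s = (LINT x|lborel. cutoff S x * (time_deriv u s x * twave t s x - u s x * twave_s t s x))"

text \<open>The second form, over a fixed compact box, is the one to which differentiation under the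
  integral sign applies.\<close>

lemma integrable_cutoff_mult:
  assumes "S \<ge> 1" "continuous_on UNIV h"
  shows "integrable lborel (\<lambda>x. cutoff S x * h x)"
    and "(LINT x|lborel. cutoff S x * h x) = integral (cbox (- (sqrt S *\<^sub>R One)) (sqrt S *\<^sub>R One)) (\<lambda>x. cutoff S x * h x)"
proof -
  let ?B = "cbox (- (sqrt S *\<^sub>R One)) (sqrt S *\<^sub>R One :: real^2)"
  have out: "cutoff S x = 0" if "x \<notin> ?B" for x
  proof (rule cutoff_eq_0(1)[OF assms(1)])
    obtain i :: "real^2" where i: "i \<in> Basis" "sqrt S < \<bar>x \<bullet> i\<bar>"
    proof -
      from \<open>x \<notin> ?B\<close> obtain i :: "real^2" where i: "i \<in> Basis" "\<not> (- sqrt S \<le> x \<bullet> i \<and> x \<bullet> i \<le> sqrt S)"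
        unfolding mem_box by (auto simp: inner_sum_left_Basis)
      then have "sqrt S < \<bar>x \<bullet> i\<bar>" by linarith
      with i(1) show ?thesis by (rule that)
    qed
    then have "sqrt S \<le> norm x" using Basis_le_norm[OF i(1), of x] by linarith
    then show "S \<le> (norm x)\<^sup>2" using assms(1) by (metis real_sqrt_le_iff real_sqrt_abs abs_norm_cancel)
  qed
  have c: "continuous_on ?B (\<lambda>x. cutoff S x * h x)"
    using assms(2) by (intro continuous_intros continuous_cutoff) (auto intro: continuous_on_subset)
  have "integrable lborel (\<lambda>x. indicator ?B x *\<^sub>R (cutoff S x * h x))"
    by (intro borel_integrable_compact c) auto
  moreover have eq: "(\<lambda>x. indicator ?B x *\<^sub>R (cutoff S x * h x)) = (\<lambda>x. cutoff S x * h x)"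
    using out by (force simp: indicator_def)
  ultimately show "integrable lborel (\<lambda>x. cutoff S x * h x)" by simp
  have "set_integrable lborel ?B (\<lambda>x. cutoff S x * h x)"
    unfolding set_integrable_def by (intro borel_integrable_compact c) auto
  from set_borel_integral_eq_integral(2)[OF this]
  show "(LINT x|lborel. cutoff S x * h x) = integral ?B (\<lambda>x. cutoff S x * h x)"
    unfolding set_lebesgue_integral_def eq .
qed

lemma Ck_half_slice_continuous:
  assumes "Ck_half k u" "s \<ge> 1"
  shows "continuous_on UNIV (u s)"
proof -
  have "continuous_on UNIV ((\<lambda>(t, x). u t x) \<circ> Pair s)"
    by (intro continuous_on_compose continuous_intros continuous_on_subset[OF Ck_half_continuous[OF assms(1)]])
      (use assms(2) in auto)
  then show ?thesis by (simp add: o_def)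
qed

text \<open>The products of first time derivatives cancel, as in any Wronskian.\<close>

lemma pairing_has_derivative:
  fixes u :: "real \<Rightarrow> real^2 \<Rightarrow> real"
  assumes S: "S \<ge> 1" and t: "t \<ge> 1" and u: "Ck_half 2 u" and s: "s \<in> {1..t}"
  shows "(pairing S t u has_real_derivative
    (LINT x|lborel. cutoff S x * (time_deriv (time_deriv u) s x * twave t s x - u s x * twave_ss t s x))) (at s within {1..t})"
proof -
  let ?B = "cbox (- (sqrt S *\<^sub>R One)) (sqrt S *\<^sub>R One :: real^2)"
  have u2: "Ck_half (Suc 1) u" using u by (simp add: numeral_2_eq_2)
  note u1 = Ck_half_time_deriv[OF u2]
  then have u1': "Ck_half (Suc 0) (time_deriv u)" by simp
  note u0 = Ck_half_time_deriv[OF u1']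
  define f where "f s x = cutoff S x * (time_deriv u s x * twave t s x - u s x * twave_s t s x)" for s x
  define f' where "f' s x = cutoff S x * (time_deriv (time_deriv u) s x * twave t s x - u s x * twave_ss t s x)" for s x
  have cont2: "continuous_on ({1..t} \<times> ?B) (\<lambda>p. v (fst p) (snd p))" if "Ck_half k v" for k and v :: "real \<Rightarrow> real^2 \<Rightarrow> real"
  proof -
    have "{1..t} \<times> ?B \<subseteq> halfspace" by (auto simp del: mem_box)
    from continuous_on_subset[OF Ck_half_continuous[OF that] this] show ?thesis by (simp add: case_prod_beta)
  qed
  have fst_snd: "continuous_on ({1..t} \<times> ?B) fst" "continuous_on ({1..t} \<times> ?B) snd"
    by (intro continuous_intros)+
  have slice: "continuous_on UNIV (\<lambda>x. time_deriv u r x * twave t r x - u r x * twave_s t r x)" 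
     "continuous_on UNIV (\<lambda>x. time_deriv (time_deriv u) r x * twave t r x - u r x * twave_ss t r x)" if "r \<in> {1..t}" for r
    using that by (auto intro!: continuous_intros continuous_twave[OF t]
        Ck_half_slice_continuous[OF u] Ck_half_slice_continuous[OF u1] Ck_half_slice_continuous[OF u0])
  have "((\<lambda>s. integral ?B (f s)) has_vector_derivative integral ?B (f' s)) (at s within {1..t})"
  proof (rule leibniz_rule_vector_derivative)
    fix r x assume r: "r \<in> {1..t}"
    have "((\<lambda>s. u s x) has_real_derivative time_deriv u r x) (at r within {1..t})"
      using has_time_deriv[OF u2, of r x] r unfolding has_real_derivative_iff_has_vector_derivative
      by (rule_tac has_vector_derivative_within_subset) auto
    moreover have "((\<lambda>s. time_deriv u s x) has_real_derivative time_deriv (time_deriv u) r x) (at r within {1..t})"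
      using has_time_deriv[OF u1', of r x] r unfolding has_real_derivative_iff_has_vector_derivative
      by (rule_tac has_vector_derivative_within_subset) auto
    moreover have "((\<lambda>s. twave t s x) has_real_derivative twave_s t r x) (at r within {1..t})"
      "((\<lambda>s. twave_s t s x) has_real_derivative twave_ss t r x) (at r within {1..t})"
      using twave_has_derivative_s[OF t] twave_s_has_derivative_s[OF t]
      unfolding has_real_derivative_iff_has_vector_derivative by (auto intro: has_vector_derivative_at_within)
    ultimately have "((\<lambda>s. f s x) has_real_derivative cutoff S x * ((time_deriv (time_deriv u) r x * twave t r x + twave_s t r x * time_deriv u r x)
      - (time_deriv u r x * twave_s t r x + twave_ss t r x * u r x))) (at r within {1..t})"
      unfolding f_def by (intro DERIV_cmult DERIV_diff DERIV_mult)
    then show "((\<lambda>s. f s x) has_vector_derivative f' r x) (at r within {1..t})"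
      unfolding has_real_derivative_iff_has_vector_derivative f'_def by (simp add: mult.commute)
  next
    fix r assume r: "r \<in> {1..t}"
    show "f r integrable_on ?B"
      unfolding f_def
      by (intro integrable_continuous continuous_on_mult continuous_cutoff continuous_on_id continuous_on_subset[OF slice(1)[OF r]]) auto
  next
    have "continuous_on ({1..t} \<times> ?B) (\<lambda>p. f' (fst p) (snd p))"
      unfolding f'_def by (intro continuous_intros continuous_cutoff continuous_twave[OF t] fst_snd cont2[OF u] cont2[OF u0])
    then show "continuous_on ({1..t} \<times> ?B) (\<lambda>(s, x). f' s x)" by (simp add: case_prod_beta)
  qed (use s in auto)
  moreover have pairing: "pairing S t u r = integral ?B (f r)" if "r \<in> {1..t}" for r
    unfolding pairing_def f_def using integrable_cutoff_mult(2)[OF S slice(1)[OF that]] .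
  ultimately have "(pairing S t u has_vector_derivative integral ?B (f' s)) (at s within {1..t})"
    using has_vector_derivative_transform[OF s, of "pairing S t u" "\<lambda>s. integral ?B (f s)"] by blast
  moreover have "(LINT x|lborel. f' s x) = integral ?B (f' s)"
    unfolding f'_def using integrable_cutoff_mult(2)[OF S slice(2)[OF s]] .
  ultimately show ?thesis
    unfolding f'_def[symmetric] has_real_derivative_iff_has_vector_derivative by simp
qed

section \<open>Variation of the pairing and size of the truncation error\<close>

lemma disc_inverse_integral:
  assumes "S \<ge> 0"
  shows "integrable lborel (\<lambda>x::real^2. indicator {..S} ((norm x)\<^sup>2) / (1 + (norm x)\<^sup>2))"
    "(LINT x|lborel. indicator {..S} ((norm (x::real^2))\<^sup>2) / (1 + (norm x)\<^sup>2)) = pi * ln (1 + S)"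
proof -
  have "has_bochner_integral lborel (\<lambda>x::real^2. indicator {..S} ((norm x)\<^sup>2) / (1 + (norm x)\<^sup>2)) (pi * ln (1 + S))"
    by (rule has_bochner_integral_nn_integral[OF _ _ _ nn_integral_disc_inverse[OF assms]])
      (use assms in auto)
  then show "integrable lborel (\<lambda>x::real^2. indicator {..S} ((norm x)\<^sup>2) / (1 + (norm x)\<^sup>2))"
    "(LINT x|lborel. indicator {..S} ((norm (x::real^2))\<^sup>2) / (1 + (norm x)\<^sup>2)) = pi * ln (1 + S)"
    by (auto simp: has_bochner_integral_iff)
qed

text \<open>The equation reads u_tt = \<Delta> (u + e), and Green's identity moves the Laplacian
  onto the product of cutoff and wave w. With m = u + e, the difference of m \<Delta> w and u w_ss
  leaves e w_ss, of size e/t. The rest is m times twice the inner product of both gradients plus w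
  times the Laplacian of the cutoff; it lives on |x|^2 \<le> S and is small by the decay of m, of
  the cutoff derivatives and of the gradient of w.\<close>

lemma pairing_derivative_bound:
  fixes u e :: "real \<Rightarrow> real^2 \<Rightarrow> real"
  assumes S: "S \<ge> 1" and t: "t \<ge> 1" and u: "Ck_half 2 u" and e: "Ck_half 2 e" and s: "s \<in> {1..t}"
    and eq: "\<And>x. time_deriv (time_deriv u) s x - laplacian (u s) x = laplacian (e s) x"
    and M: "\<And>x. \<bar>u s x + e s x\<bar> \<le> M / sqrt (1 + (norm x)\<^sup>2)"
    and e0: "\<And>x. e s x \<ge> 0" and e_int: "integrable lborel (e s)" and \<Lambda>: "(LINT x|lborel. e s x) \<le> \<Lambda>"
  shows "\<bar>LINT x|lborel. cutoff S x * (time_deriv (time_deriv u) s x * twave t s x - u s x * twave_ss t s x)\<bar>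
    \<le> \<Lambda> / t + M * (120 * t + 24 * sqrt (1 + 11 * t\<^sup>2)) * (pi * ln (1 + S) / sqrt S)"
proof -
  have s1: "s \<ge> 1" "s \<le> t" using s by auto
  define m where "m x = u s x + e s x" for x
  define m1 where "m1 i x = partial i (u s) x + partial i (e s) x" for i x
  define m2 where "m2 i x = partial i (partial i (u s)) x + partial i (partial i (e s)) x" for i x
  define p where "p x = cutoff S x * twave t s x" for x
  define p1 where "p1 i x = cutoff S x * twave_i i t s x + cutoff_i i S x * twave t s x" for i x
  define p2 where "p2 i x = (cutoff S x * twave_ii i t s x + cutoff_i i S x * twave_i i t s x)
     + (cutoff_i i S x * twave_i i t s x + cutoff_ii i S x * twave t s x)" for i x
  have regular: "continuous_on UNIV (v s)" "continuous_on UNIV (partial i (v s))" "continuous_on UNIV (partial i (partial i (v s)))"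
    "((\<lambda>\<tau>. v s (x + \<tau> *\<^sub>R axis i 1)) has_vector_derivative partial i (v s) x) (at 0)"
    "((\<lambda>\<tau>. partial i (v s) (x + \<tau> *\<^sub>R axis i 1)) has_vector_derivative partial i (partial i (v s)) x) (at 0)"
    if v: "Ck_half 2 v" for v :: "real \<Rightarrow> real^2 \<Rightarrow> real" and i x
  proof -
    have v2: "Ck_half (Suc 1) v" using v by (simp add: numeral_2_eq_2)
    have v1: "Ck_half (Suc 0) (\<lambda>t. partial i (v t))" using Ck_half_partial[OF v2] by simp
    show "continuous_on UNIV (v s)" "continuous_on UNIV (partial i (v s))" "continuous_on UNIV (partial i (partial i (v s)))"
      using Ck_half_slice_continuous[OF v s1(1)] Ck_half_slice_continuous[OF v1 s1(1)]
        Ck_half_slice_continuous[OF Ck_half_partial[OF v1] s1(1)] by auto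
    show "((\<lambda>\<tau>. v s (x + \<tau> *\<^sub>R axis i 1)) has_vector_derivative partial i (v s) x) (at 0)"
      by (rule partial_line_derivative[OF slice_differentiable[OF v2 s1(1)]])
    show "((\<lambda>\<tau>. partial i (v s) (x + \<tau> *\<^sub>R axis i 1)) has_vector_derivative partial i (partial i (v s)) x) (at 0)"
      by (rule partial_line_derivative[OF slice_differentiable[OF v1 s1(1)]])
  qed
  note ru = regular[OF u] and re = regular[OF e]
  have cont: "continuous_on UNIV m" "continuous_on UNIV (m1 i)" "continuous_on UNIV (m2 i)"
    "continuous_on UNIV p" "continuous_on UNIV (p1 i)" "continuous_on UNIV (p2 i)" for i
    unfolding m_def m1_def m2_def p_def p1_def p2_def
    by (intro continuous_intros continuous_cutoff continuous_twave[OF t] ru re)+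
  have green: "integrable lborel (\<lambda>x. m2 i x * p x)" "integrable lborel (\<lambda>x. m x * p2 i x)"
    "(LINT x|lborel. m2 i x * p x) = (LINT x|lborel. m x * p2 i x)" for i
  proof -
    have m1: "((\<lambda>\<tau>. m (x + \<tau> *\<^sub>R axis i 1)) has_vector_derivative m1 i x) (at 0)" for x
      unfolding m_def m1_def by (intro has_vector_derivative_add ru re)
    have m2: "((\<lambda>\<tau>. m1 i (x + \<tau> *\<^sub>R axis i 1)) has_vector_derivative m2 i x) (at 0)" for x
      unfolding m1_def m2_def by (intro has_vector_derivative_add ru re)
    have p1: "((\<lambda>\<tau>. p (x + \<tau> *\<^sub>R axis i 1)) has_vector_derivative p1 i x) (at 0)" for x
      using has_vector_derivative_mult[OF cutoff_has_derivative_i[of S x i] twave_has_derivative_i[OF t, of s x i]]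
      unfolding p_def p1_def by simp
    have p2: "((\<lambda>\<tau>. p1 i (x + \<tau> *\<^sub>R axis i 1)) has_vector_derivative p2 i x) (at 0)" for x
      using has_vector_derivative_add[OF
          has_vector_derivative_mult[OF cutoff_has_derivative_i[of S x i] twave_i_has_derivative_i[OF t, of i s x]]
          has_vector_derivative_mult[OF cutoff_i_has_derivative_i[of i S x] twave_has_derivative_i[OF t, of s x i]]]
      unfolding p1_def p2_def by simp
    have supp: "p x = 0 \<and> p1 i x = 0 \<and> p2 i x = 0" if "norm x > sqrt S" for x
    proof -
      have "S \<le> (norm x)\<^sup>2" using that S by (simp add: real_less_lsqrt less_imp_le sqrt_le_D)
      then show ?thesis using cutoff_eq_0[OF S] by (simp add: p_def p1_def p2_def)
    qed
    have ax: "norm (axis i 1 :: real^2) = 1" by (simp add: norm_axis_1)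
    note * = integral_second_line_derivative[OF m1 m2 p1 p2 cont(1-6) supp ax]
    show "integrable lborel (\<lambda>x. m2 i x * p x)" by (rule *(1))
    show "integrable lborel (\<lambda>x. m x * p2 i x)" by (rule *(2))
    show "(LINT x|lborel. m2 i x * p x) = (LINT x|lborel. m x * p2 i x)" by (rule *(3))
  qed
  have int_ss: "integrable lborel (\<lambda>x. cutoff S x * (u s x * twave_ss t s x))"
    by (intro integrable_cutoff_mult(1)[OF S] continuous_intros continuous_twave[OF t] ru)
  define K where "K = M * (120 * t + 24 * sqrt (1 + 11 * t\<^sup>2)) / sqrt S"
  define g where "g x = (\<Sum>i\<in>UNIV. m x * p2 i x) - cutoff S x * (u s x * twave_ss t s x)" for x
  have g_int: "integrable lborel g"
    unfolding g_def using green int_ss by (intro Bochner_Integration.integrable_diff Bochner_Integration.integrable_sum) auto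
  have "(LINT x|lborel. cutoff S x * (time_deriv (time_deriv u) s x * twave t s x - u s x * twave_ss t s x))
    = (LINT x|lborel. (\<Sum>i\<in>UNIV. m2 i x * p x) - cutoff S x * (u s x * twave_ss t s x))"
  proof (rule Bochner_Integration.integral_cong[OF refl])
    fix x
    have "(\<Sum>i\<in>UNIV. m2 i x) = time_deriv (time_deriv u) s x"
      using eq[of x] unfolding laplacian_def m2_def by (simp add: sum.distrib)
    then show "cutoff S x * (time_deriv (time_deriv u) s x * twave t s x - u s x * twave_ss t s x)
      = (\<Sum>i\<in>UNIV. m2 i x * p x) - cutoff S x * (u s x * twave_ss t s x)"
      by (simp only: sum_distrib_right[symmetric] p_def) (simp add: algebra_simps)
  qed
  also have "\<dots> = (\<Sum>i\<in>UNIV. LINT x|lborel. m2 i x * p x) - (LINT x|lborel. cutoff S x * (u s x * twave_ss t s x))"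
    using green int_ss by (subst Bochner_Integration.integral_diff) (auto simp: Bochner_Integration.integral_sum)
  also have "\<dots> = (LINT x|lborel. g x)"
    unfolding g_def using green int_ss by (subst Bochner_Integration.integral_diff) (auto simp: Bochner_Integration.integral_sum)
  finally have "\<bar>LINT x|lborel. cutoff S x * (time_deriv (time_deriv u) s x * twave t s x - u s x * twave_ss t s x)\<bar> = \<bar>LINT x|lborel. g x\<bar>"
    by simp
  also have "\<dots> \<le> (LINT x|lborel. \<bar>g x\<bar>)" by (rule integral_abs_bound)
  also have "\<dots> \<le> (LINT x|lborel. e s x / t + K * (indicator {..S} ((norm x)\<^sup>2) / (1 + (norm x)\<^sup>2)))"
  proof (rule integral_mono)
    show "integrable lborel (\<lambda>x. \<bar>g x\<bar>)" using g_int by simp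
    show "integrable lborel (\<lambda>x. e s x / t + K * (indicator {..S} ((norm x)\<^sup>2) / (1 + (norm x)\<^sup>2)))"
      using S by (intro Bochner_Integration.integrable_add integrable_divide integrable_mult_right
          e_int disc_inverse_integral(1)) auto
    fix x :: "real^2"
    define I where "I = (indicator {..S} ((norm x)\<^sup>2) :: real)"
    define D where "D = sqrt (1 + 11 * t\<^sup>2)"
    define y where "y = sqrt (1 + (norm x)\<^sup>2)"
    have y: "y \<ge> 1" "y\<^sup>2 = 1 + (norm x)\<^sup>2" unfolding y_def by auto
    have I: "0 \<le> I" "I \<le> 1" by (auto simp: I_def)
    have "g x = m x * (\<Sum>i\<in>UNIV. 2 * (cutoff_i i S x * twave_i i t s x) + cutoff_ii i S x * twave t s x) + cutoff S x * (e s x * twave_ss t s x)"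
    proof -
      have "(\<Sum>i\<in>UNIV. p2 i x) = (\<Sum>i\<in>UNIV. 2 * (cutoff_i i S x * twave_i i t s x) + cutoff_ii i S x * twave t s x) + cutoff S x * twave_ss t s x"
        unfolding laplacian_twave[OF t, symmetric] p2_def sum_distrib_left sum.distrib[symmetric]
        by (intro sum.cong) (auto simp: algebra_simps)
      then show ?thesis unfolding g_def sum_distrib_left[symmetric] by (simp add: m_def algebra_simps)
    qed
    moreover have c: "\<bar>cutoff S x * (e s x * twave_ss t s x)\<bar> \<le> e s x / t"
    proof -
      have "\<bar>cutoff S x * (e s x * twave_ss t s x)\<bar> = cutoff S x * (e s x * \<bar>twave_ss t s x\<bar>)"
        using cutoff_range[OF S] e0 by (simp add: abs_mult)
      also have "\<dots> \<le> 1 * (e s x * (1 / t))"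
        using cutoff_range[OF S] e0 twave_ss_bound[OF t] by (intro mult_mono) auto
      finally show ?thesis by simp
    qed
    moreover have d: "\<bar>\<Sum>i\<in>UNIV. 2 * (cutoff_i i S x * twave_i i t s x) + cutoff_ii i S x * twave t s x\<bar> \<le> (120 * t + 24 * D) / sqrt S * I / y"
    proof -
      \<comment> \<open>The 12 is twice the bound 6 on the cutoff gradient, and the 60 is produced
        below; the two coordinates double both.\<close>
      have "\<bar>2 * (cutoff_i i S x * twave_i i t s x) + cutoff_ii i S x * twave t s x\<bar> \<le> (60 * t + 12 * D) / sqrt S * I / y" for i
      proof -
        have "\<bar>cutoff_i i S x * twave_i i t s x\<bar> \<le> (6 / sqrt S * I) * (D / y)"
          unfolding abs_mult I_def D_def y_def
          by (intro mult_mono cutoff_i_bound[OF S] twave_i_decay[OF t s1]) (use S in auto)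
        moreover have "\<bar>cutoff_ii i S x * twave t s x\<bar> \<le> (30 / S * I) * t"
          unfolding abs_mult I_def by (intro mult_mono cutoff_ii_bound[OF S] twave_bound[OF t s1]) (use S in auto)
        \<comment> \<open>The second cutoff derivative gains 1/S but no decay in x. On the disc y
          \<le> 2 sqrt S, so one factor 1 / sqrt S can be traded for 2 / y, which supplies the
          second factor of the integrand 1 / y^2.\<close>
        moreover have "30 / S * I \<le> 60 / sqrt S * I / y"
        proof (cases "(norm x)\<^sup>2 \<le> S")
          case True
          have "y \<le> sqrt (4 * S)" unfolding y_def using True S by (intro real_sqrt_le_mono) linarith
          then have "y \<le> 2 * sqrt S" by (simp add: real_sqrt_mult)
          then have "y * sqrt S \<le> (2 * sqrt S) * sqrt S" by (rule mult_right_mono) (use S in auto)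
          also have "\<dots> = 2 * S" using S by (simp add: mult.assoc)
          finally have "y * sqrt S \<le> 2 * S" .
          then have "30 / S \<le> 60 / sqrt S / y" using S y by (simp add: field_simps)
          then show ?thesis using True by (simp add: I_def)
        next
          case False then show ?thesis by (simp add: I_def)
        qed
        then have "30 / S * I * t \<le> 60 / sqrt S * I / y * t" using t by (intro mult_right_mono) auto
        ultimately have "\<bar>2 * (cutoff_i i S x * twave_i i t s x) + cutoff_ii i S x * twave t s x\<bar>
           \<le> 2 * ((6 / sqrt S * I) * (D / y)) + 60 / sqrt S * I / y * t" by linarith
        also have "\<dots> = (60 * t + 12 * D) / sqrt S * I / y"
          by (simp add: add_divide_distrib[symmetric] algebra_simps)
        finally show ?thesis .
      qed
      then have "(\<Sum>i\<in>(UNIV::2 set). \<bar>2 * (cutoff_i i S x * twave_i i t s x) + cutoff_ii i S x * twave t s x\<bar>)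
        \<le> of_nat (card (UNIV::2 set)) * ((60 * t + 12 * D) / sqrt S * I / y)"
        by (intro sum_bounded_above)
      also have "of_nat (card (UNIV::2 set)) * ((60 * t + 12 * D) / sqrt S * I / y) = (120 * t + 24 * D) / sqrt S * I / y"
        by (simp add: add_divide_distrib[symmetric] algebra_simps)
      finally show ?thesis
        by (rule order_trans[OF sum_abs])
    qed
    moreover have "\<bar>m x\<bar> \<le> M / y" unfolding m_def y_def by (rule M)
    then have "\<bar>m x\<bar> * \<bar>\<Sum>i\<in>UNIV. 2 * (cutoff_i i S x * twave_i i t s x) + cutoff_ii i S x * twave t s x\<bar>
        \<le> M / y * ((120 * t + 24 * D) / sqrt S * I / y)"
      by (intro mult_mono d) (auto intro: order_trans)
    moreover have "\<bar>q\<bar> \<le> a + b" if "q = k * l + c" "\<bar>c\<bar> \<le> b" "\<bar>k\<bar> * \<bar>l\<bar> \<le> a" for q k l c a b :: real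
      using that abs_triangle_ineq[of "k * l" c] by (simp add: abs_mult)
    ultimately have "\<bar>g x\<bar> \<le> M / y * ((120 * t + 24 * D) / sqrt S * I / y) + e s x / t"
      by blast
    also have "M / y * ((120 * t + 24 * D) / sqrt S * I / y) = K * (I / y\<^sup>2)"
      by (simp add: K_def D_def power2_eq_square mult_ac)
    finally show "\<bar>g x\<bar> \<le> e s x / t + K * (indicator {..S} ((norm x)\<^sup>2) / (1 + (norm x)\<^sup>2))"
      unfolding y(2) I_def by simp
  qed
  also have "\<dots> = (LINT x|lborel. e s x) / t + K * (pi * ln (1 + S))"
  proof -
    have "(LINT x|lborel. e s x / t + K * (indicator {..S} ((norm x)\<^sup>2) / (1 + (norm x)\<^sup>2)))
      = (LINT x|lborel. e s x / t) + (LINT x|lborel. K * (indicator {..S} ((norm (x::real^2))\<^sup>2) / (1 + (norm x)\<^sup>2)))"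
    proof (rule Bochner_Integration.integral_add)
      show "integrable lborel (\<lambda>x. e s x / t)" using e_int by (rule integrable_divide)
      show "integrable lborel (\<lambda>x::real^2. K * (indicator {..S} ((norm x)\<^sup>2) / (1 + (norm x)\<^sup>2)))"
        using S by (intro integrable_mult_right disc_inverse_integral(1)) auto
    qed
    then show ?thesis
      using disc_inverse_integral(2)[of S] S by (simp only: integral_divide_zero integral_mult_right_zero)
  qed
  also have "\<dots> \<le> \<Lambda> / t + K * (pi * ln (1 + S))"
    using \<Lambda> t by (intro add_right_mono divide_right_mono) auto
  finally show ?thesis by (simp add: K_def)
qed

subsection \<open>Square integrability of the solution\<close>

text \<open>This is Cauchy-Schwarz in time, obtained from the nonnegative integral of (f' - D /
  L)^2, the squared deviation of the slope from its mean.\<close>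

lemma square_increment_le:
  fixes f f' :: "real \<Rightarrow> real"
  assumes "a < b" and "\<And>s. s \<in> {a..b} \<Longrightarrow> (f has_vector_derivative f' s) (at s within {a..b})"
    and cont: "continuous_on {a..b} f'"
  shows "ennreal ((f b - f a)\<^sup>2) \<le> ennreal (b - a) * (\<integral>\<^sup>+s. ennreal ((f' s)\<^sup>2) * indicator {a..b} s \<partial>lborel)"
proof -
  have f1: "(f' has_integral (f b - f a)) {a..b}"
    by (rule fundamental_theorem_of_calculus) (use assms in auto)
  define D where "D = f b - f a"
  define L where "L = b - a"
  have L: "L > 0" using assms by (simp add: L_def)
  have c2: "continuous_on {a..b} (\<lambda>s. (f' s)\<^sup>2)" using cont by (intro continuous_intros)
  define Q where "Q = integral {a..b} (\<lambda>s. (f' s)\<^sup>2)"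
  have q: "((\<lambda>s. (f' s)\<^sup>2) has_integral Q) {a..b}"
    unfolding Q_def using integrable_continuous_interval[OF c2] by (rule integrable_integral)
  have "((\<lambda>s. (f' s)\<^sup>2 - 2 * (D / L) * f' s + (D / L)\<^sup>2) has_integral (Q - 2 * (D / L) * D + (b - a) *\<^sub>R (D / L)\<^sup>2)) {a..b}"
    using has_integral_add[OF has_integral_diff[OF q has_integral_mult_right[OF f1, of "2 * (D / L)"]] has_integral_const_real[of "(D / L)\<^sup>2" a b]] assms(1)
    by (simp add: D_def content_real)
  then have "0 \<le> Q - 2 * (D / L) * D + (b - a) *\<^sub>R (D / L)\<^sup>2"
  proof (rule has_integral_nonneg)
    fix s
    have "(f' s)\<^sup>2 - 2 * (D / L) * f' s + (D / L)\<^sup>2 = (f' s - D / L)\<^sup>2"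
      by (simp add: power2_eq_square algebra_simps)
    then show "0 \<le> (f' s)\<^sup>2 - 2 * (D / L) * f' s + (D / L)\<^sup>2" by simp
  qed
  then have "D\<^sup>2 / L \<le> Q" using L by (simp add: L_def[symmetric] power2_eq_square field_simps)
  then have main: "D\<^sup>2 \<le> L * Q" using L by (simp add: field_simps)
  have "set_integrable lborel {a..b} (\<lambda>s. (f' s)\<^sup>2)"
    using borel_integrable_compact[of "{a..b}" "\<lambda>s. (f' s)\<^sup>2"] c2 by (simp add: set_integrable_def)
  then have i: "integrable lborel (\<lambda>s. indicator {a..b} s * (f' s)\<^sup>2)" and
    Qi: "Q = (LINT s|lborel. indicator {a..b} s * (f' s)\<^sup>2)"
    using set_borel_integral_eq_integral(2)[of "{a..b}" "\<lambda>s. (f' s)\<^sup>2"] unfolding Q_def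
    by (simp_all add: set_integrable_def set_lebesgue_integral_def)
  have "(\<integral>\<^sup>+s. ennreal ((f' s)\<^sup>2) * indicator {a..b} s \<partial>lborel) = (\<integral>\<^sup>+s. ennreal (indicator {a..b} s * (f' s)\<^sup>2) \<partial>lborel)"
    by (intro nn_integral_cong) (auto simp: indicator_def)
  also have "\<dots> = ennreal Q"
    unfolding Qi using i by (rule nn_integral_eq_integral) auto
  finally have "ennreal (b - a) * (\<integral>\<^sup>+s. ennreal ((f' s)\<^sup>2) * indicator {a..b} s \<partial>lborel) = ennreal (L * Q)"
    using L by (simp add: L_def[symmetric] ennreal_mult')
  then show ?thesis using main by (simp add: D_def ennreal_leI)
qed

text \<open>The Sobolev norms in \<open>kgz_bounds\<close> see n only through its derivatives, so
  n(t) is recovered from n(1) and the time integral of its time derivative. Cauchy-Schwarz in time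
  and exchange of the integrals then bound the square.\<close>

lemma slice_square_integrable:
  fixes u :: "real \<Rightarrow> real^2 \<Rightarrow> real"
  assumes u: "Ck_half (Suc k) u" and u1: "integrable lborel (\<lambda>x. (u 1 x)\<^sup>2)"
    and ut: "\<And>s. s \<ge> 1 \<Longrightarrow> integrable lborel (\<lambda>x. (time_deriv u s x)\<^sup>2)"
      "\<And>s. s \<ge> 1 \<Longrightarrow> (LINT x|lborel. (time_deriv u s x)\<^sup>2) \<le> \<Lambda>"
    and t: "t > 1"
  shows "integrable lborel (\<lambda>x. (u t x)\<^sup>2)"
proof -
  \<comment> \<open>Clamping the time at 1 extends the derivative continuously to all times, which
    gives joint measurability on the full product space.\<close>
  define v where "v s x = time_deriv u (max 1 s) x" for s x
  have "continuous_on UNIV ((\<lambda>(s, x). time_deriv u s x) \<circ> (\<lambda>p. (max 1 (fst p), snd p)))"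
    by (intro continuous_on_compose continuous_intros continuous_on_subset[OF Ck_half_continuous[OF Ck_half_time_deriv[OF u]]]) auto
  then have "(\<lambda>p. v (fst p) (snd p)) \<in> borel_measurable borel"
    by (intro borel_measurable_continuous_onI) (simp add: v_def o_def case_prod_beta)
  then have vm: "(\<lambda>(s, x). v s x) \<in> borel_measurable (lborel \<Otimes>\<^sub>M lborel)"
    by (simp add: case_prod_beta lborel_prod)
  then have vm': "(\<lambda>p. v (fst p) (snd p)) \<in> borel_measurable (lborel \<Otimes>\<^sub>M lborel)"
    by (simp add: case_prod_beta)
  have uc: "u s \<in> borel_measurable borel" if "s \<ge> 1" for s
    using Ck_half_slice_continuous[OF u that] by (rule borel_measurable_continuous_onI)
  have point: "ennreal ((u t x)\<^sup>2) \<le> 2 * ennreal ((u 1 x)\<^sup>2)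
      + 2 * (ennreal (t - 1) * (\<integral>\<^sup>+s. ennreal ((v s x)\<^sup>2) * indicator {1..t} s \<partial>lborel))" for x
  proof -
    have "continuous_on {1..t} ((\<lambda>(s, x). time_deriv u s x) \<circ> (\<lambda>s. (s, x)))"
      by (intro continuous_on_compose continuous_intros continuous_on_subset[OF Ck_half_continuous[OF Ck_half_time_deriv[OF u]]]) auto
    then have "continuous_on {1..t} (\<lambda>s. time_deriv u s x)" by (simp add: o_def)
    moreover have "((\<lambda>s. u s x) has_vector_derivative time_deriv u s x) (at s within {1..t})" if "s \<in> {1..t}" for s
      by (rule has_vector_derivative_within_subset[OF has_time_deriv[OF u]]) (use that in auto)
    ultimately have "ennreal ((u t x - u 1 x)\<^sup>2) \<le> ennreal (t - 1) * (\<integral>\<^sup>+s. ennreal ((time_deriv u s x)\<^sup>2) * indicator {1..t} s \<partial>lborel)"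
      using square_increment_le[OF t, of "\<lambda>s. u s x" "\<lambda>s. time_deriv u s x"] by blast
    also have "(\<integral>\<^sup>+s. ennreal ((time_deriv u s x)\<^sup>2) * indicator {1..t} s \<partial>lborel) = (\<integral>\<^sup>+s. ennreal ((v s x)\<^sup>2) * indicator {1..t} s \<partial>lborel)"
      by (intro nn_integral_cong) (auto simp: v_def indicator_def max_def)
    finally have D: "ennreal ((u t x - u 1 x)\<^sup>2) \<le> ennreal (t - 1) * (\<integral>\<^sup>+s. ennreal ((v s x)\<^sup>2) * indicator {1..t} s \<partial>lborel)" .
    have "(p + q)\<^sup>2 \<le> 2 * p\<^sup>2 + 2 * q\<^sup>2" for p q :: real
      using zero_le_power2[of "p - q"] by (simp add: power2_eq_square algebra_simps)
    from this[of "u 1 x" "u t x - u 1 x"]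
    have "ennreal ((u t x)\<^sup>2) \<le> ennreal (2 * (u 1 x)\<^sup>2 + 2 * (u t x - u 1 x)\<^sup>2)"
      by (intro ennreal_leI) simp
    also have "\<dots> = 2 * ennreal ((u 1 x)\<^sup>2) + 2 * ennreal ((u t x - u 1 x)\<^sup>2)"
      by (simp add: ennreal_plus ennreal_mult)
    finally show ?thesis using D by (meson add_left_mono mult_left_mono order_trans zero_le)
  qed
  have inner: "(\<integral>\<^sup>+x. ennreal ((v s x)\<^sup>2) * indicator {1..t} s \<partial>lborel) \<le> ennreal \<Lambda> * indicator {1..t} s" for s
  proof (cases "s \<in> {1..t}")
    case True
    then have "(\<integral>\<^sup>+x. ennreal ((v s x)\<^sup>2) \<partial>lborel) = ennreal (LINT x|lborel. (time_deriv u s x)\<^sup>2)"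
      using ut(1)[of s] by (subst nn_integral_eq_integral) (auto simp: v_def max_def)
    also have "\<dots> \<le> ennreal \<Lambda>" using ut(2)[of s] True by (simp add: ennreal_leI)
    finally show ?thesis using True by simp
  qed simp
  have meas: "(\<lambda>(x, s). ennreal ((v s x)\<^sup>2) * indicator {1..t} s) \<in> borel_measurable (lborel \<Otimes>\<^sub>M lborel)"
  proof -
    have "(\<lambda>p. (snd p, fst p)) \<in> (lborel :: (real^2) measure) \<Otimes>\<^sub>M (lborel :: real measure) \<rightarrow>\<^sub>M lborel \<Otimes>\<^sub>M lborel"
      by measurable
    from measurable_compose[OF this vm'] have [measurable]: "(\<lambda>p. v (snd p) (fst p)) \<in> borel_measurable ((lborel :: (real^2) measure) \<Otimes>\<^sub>M (lborel :: real measure))"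
      by simp
    show ?thesis unfolding case_prod_beta by measurable
  qed
  have Im: "(\<lambda>x. \<integral>\<^sup>+s. ennreal ((v s x)\<^sup>2) * indicator {1..t} s \<partial>lborel) \<in> borel_measurable lborel"
    using lborel.borel_measurable_nn_integral[OF meas] by simp
  have "(\<integral>\<^sup>+x. (\<integral>\<^sup>+s. ennreal ((v s x)\<^sup>2) * indicator {1..t} s \<partial>lborel) \<partial>lborel)
     = (\<integral>\<^sup>+s. (\<integral>\<^sup>+x. ennreal ((v s x)\<^sup>2) * indicator {1..t} s \<partial>lborel) \<partial>lborel)"
    using lborel_pair.Fubini'[OF meas] by simp
  also have "\<dots> \<le> (\<integral>\<^sup>+s. ennreal \<Lambda> * indicator {1..t} s \<partial>lborel)"
    by (intro nn_integral_mono inner)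
  also have "\<dots> = ennreal \<Lambda> * ennreal (t - 1)"
    using t by (subst nn_integral_cmult_indicator) auto
  also have "\<dots> < \<infinity>" by (simp add: ennreal_mult_less_top)
  finally have fin: "(\<integral>\<^sup>+x. (\<integral>\<^sup>+s. ennreal ((v s x)\<^sup>2) * indicator {1..t} s \<partial>lborel) \<partial>lborel) < \<infinity>" .
  have "(\<integral>\<^sup>+x. ennreal ((u t x)\<^sup>2) \<partial>lborel) \<le> (\<integral>\<^sup>+x. 2 * ennreal ((u 1 x)\<^sup>2)
      + 2 * (ennreal (t - 1) * (\<integral>\<^sup>+s. ennreal ((v s x)\<^sup>2) * indicator {1..t} s \<partial>lborel)) \<partial>lborel)"
    by (intro nn_integral_mono point)
  also have "\<dots> = 2 * (\<integral>\<^sup>+x. ennreal ((u 1 x)\<^sup>2) \<partial>lborel)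
      + 2 * (ennreal (t - 1) * (\<integral>\<^sup>+x. (\<integral>\<^sup>+s. ennreal ((v s x)\<^sup>2) * indicator {1..t} s \<partial>lborel) \<partial>lborel))"
    using uc[of 1] Im by (simp add: nn_integral_add nn_integral_cmult)
  also have "\<dots> < \<infinity>"
  proof -
    have "(\<integral>\<^sup>+x. ennreal ((u 1 x)\<^sup>2) \<partial>lborel) < \<infinity>" using u1 by (simp add: integrable_iff_bounded)
    then show ?thesis using fin by (simp add: ennreal_mult_less_top)
  qed
  finally show ?thesis
    using uc[of t] t by (intro integrableI_bounded) auto
qed

subsection \<open>Weighted integrability of the data\<close>

lemma integrable_japanese_neg4: "integrable lborel (\<lambda>x::real^2. 1 / (1 + (norm x)\<^sup>2)\<^sup>2)"
proof -
  have "(\<integral>\<^sup>+x. ennreal (1 / (1 + (norm (x::real^2))\<^sup>2)\<^sup>2) \<partial>lborel) = ennreal pi * (\<integral>\<^sup>+v. ennreal (1 / (1 + v)\<^sup>2) * indicator {0..} v \<partial>lborel)"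
    using nn_integral_radial[of "\<lambda>v. ennreal (1 / (1 + v)\<^sup>2)"] by simp
  also have "(\<integral>\<^sup>+v. ennreal (1 / (1 + v)\<^sup>2) * indicator {0..} v \<partial>lborel) = ennreal (0 - (- (1 / (1 + 0))))"
  proof (rule nn_integral_FTC_atLeast)
    show "((\<lambda>v::real. - (1 / (1 + v))) has_real_derivative 1 / (1 + v)\<^sup>2) (at v)" if "0 \<le> v" for v
      using that by (auto intro!: derivative_eq_intros simp: power2_eq_square)
    have "((\<lambda>v::real. 1 / (1 + v)) \<longlongrightarrow> 0) at_top"
      by (intro tendsto_divide_0[OF tendsto_const] filterlim_at_top_imp_at_infinity
          filterlim_tendsto_add_at_top[OF tendsto_const filterlim_ident])
    from tendsto_minus[OF this] show "((\<lambda>v::real. - (1 / (1 + v))) \<longlongrightarrow> 0) at_top" by simp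
  qed auto
  also have "ennreal pi * ennreal (0 - (- (1 / (1 + 0)))) < \<infinity>" by simp
  finally show ?thesis by (intro integrableI_bounded) auto
qed

text \<open>With <x> for the bracket, <x> |v| is the product of <x>^3 |v| and <x>^(-2), and p q
  \<le> p^2 + q^2 applies because <x>^(-4) is integrable in the plane. The exponent 3 is the weight
  k + 3 at order k = 0.\<close>

lemma weighted_L2_imp_L1:
  fixes v :: "real^2 \<Rightarrow> real"
  assumes "L2 (\<lambda>x. japanese x ^ 3 *\<^sub>R v x)" "v \<in> borel_measurable borel"
  shows "integrable lborel (\<lambda>x. norm x * \<bar>v x\<bar>)" "integrable lborel v" "integrable lborel (\<lambda>x. (v x)\<^sup>2)"
proof -
  have J: "japanese x \<ge> 1" "norm x \<le> japanese x" for x :: "real^2"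
    unfolding japanese_def by (auto intro: real_le_rsqrt)
  have w: "integrable lborel (\<lambda>x. (japanese x ^ 3 * v x)\<^sup>2)"
    using assms(1) by (simp add: L2_def power_mult_distrib)
  have bound: "japanese x * \<bar>v x\<bar> \<le> (japanese x ^ 3 * v x)\<^sup>2 + 1 / (1 + (norm x)\<^sup>2)\<^sup>2" for x
  proof -
    have j2: "(japanese x)\<^sup>2 = 1 + (norm x)\<^sup>2" by (simp add: japanese_def)
    have "p * q \<le> p\<^sup>2 + q\<^sup>2" for p q :: real
      using sum_squares_bound[of p q] sum_power2_ge_zero[of p q] by (simp only: mult.assoc)
    from this[of "japanese x ^ 3 * \<bar>v x\<bar>" "1 / (japanese x)\<^sup>2"]
    have "(japanese x ^ 3 * \<bar>v x\<bar>) * (1 / (japanese x)\<^sup>2) \<le> (japanese x ^ 3 * v x)\<^sup>2 + 1 / (1 + (norm x)\<^sup>2)\<^sup>2"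
      by (simp add: j2[symmetric] power_mult_distrib power_divide)
    moreover have "(japanese x ^ 3 * \<bar>v x\<bar>) * (1 / (japanese x)\<^sup>2) = japanese x * \<bar>v x\<bar>"
      using J[of x] by (simp add: power2_eq_square power3_eq_cube)
    ultimately show ?thesis by simp
  qed
  have dom: "integrable lborel (\<lambda>x. (japanese x ^ 3 * v x)\<^sup>2 + 1 / (1 + (norm x)\<^sup>2)\<^sup>2)"
    using w integrable_japanese_neg4 by simp
  show "integrable lborel (\<lambda>x. norm x * \<bar>v x\<bar>)"
  proof (rule Bochner_Integration.integrable_bound[OF dom])
    show "(\<lambda>x. norm x * \<bar>v x\<bar>) \<in> borel_measurable lborel" using assms(2) by simp
    have "norm x * \<bar>v x\<bar> \<le> (japanese x ^ 3 * v x)\<^sup>2 + 1 / (1 + (norm x)\<^sup>2)\<^sup>2" for x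
      using bound[of x] J[of x] mult_right_mono[of "norm x" "japanese x" "\<bar>v x\<bar>"] by linarith
    then show "AE x in lborel. norm (norm x * \<bar>v x\<bar>) \<le> norm ((japanese x ^ 3 * v x)\<^sup>2 + 1 / (1 + (norm x)\<^sup>2)\<^sup>2)"
      by (intro AE_I2) (simp add: abs_mult)
  qed
  show "integrable lborel v"
  proof (rule Bochner_Integration.integrable_bound[OF dom])
    show "v \<in> borel_measurable lborel" using assms(2) by simp
    have "1 * \<bar>v x\<bar> \<le> (japanese x ^ 3 * v x)\<^sup>2 + 1 / (1 + (norm x)\<^sup>2)\<^sup>2" for x
      using bound[of x] J[of x] mult_right_mono[of 1 "japanese x" "\<bar>v x\<bar>"] by linarith
    then show "AE x in lborel. norm (v x) \<le> norm ((japanese x ^ 3 * v x)\<^sup>2 + 1 / (1 + (norm x)\<^sup>2)\<^sup>2)"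
      by (intro AE_I2) simp
  qed
  show "integrable lborel (\<lambda>x. (v x)\<^sup>2)"
  proof (rule Bochner_Integration.integrable_bound[OF w])
    show "(\<lambda>x. (v x)\<^sup>2) \<in> borel_measurable lborel" using assms(2) by simp
    have "\<bar>v x\<bar> \<le> \<bar>japanese x ^ 3 * v x\<bar>" for x
      using J[of x] mult_right_mono[of 1 "japanese x ^ 3" "\<bar>v x\<bar>"] one_le_power[of "japanese x" 3] by (simp add: abs_mult)
    then show "AE x in lborel. norm ((v x)\<^sup>2) \<le> norm ((japanese x ^ 3 * v x)\<^sup>2)"
      by (intro AE_I2) (simp only: real_norm_def abs_power2 power2_abs[symmetric, of "v _"] power2_abs[symmetric, of "_ * v _"] power_mono abs_ge_zero)
  qed
qed

subsection \<open>Logarithmic growth\<close>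

text \<open>The wave vanishes at s = t, so only the product of u with the time derivative of the
  wave remains; the cutoff is at most 1 and Cauchy-Schwarz applies. For a^2 = s = t the exact norm
  has (a^2 + s^2) / a^2 = 1 + t.\<close>

lemma pairing_terminal_bound:
  fixes u :: "real \<Rightarrow> real^2 \<Rightarrow> real"
  assumes S: "S \<ge> 1" and t: "t \<ge> 1" and u: "Ck_half k u" and ut: "integrable lborel (\<lambda>x. (u t x)\<^sup>2)"
  shows "\<bar>pairing S t u t\<bar> \<le> L2norm (u t) * sqrt (pi / 2 * ln (1 + t))"
proof -
  let ?P = "wave_pot_s (sqrt t) t"
  have a: "sqrt t > 0" using t by simp
  have Pc: "continuous_on UNIV ?P"
    using continuous_wave_pot(2)[OF a continuous_on_const continuous_on_id] by simp
  have uc: "continuous_on UNIV (u t)" by (rule Ck_half_slice_continuous[OF u t])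
  have [measurable]: "?P \<in> borel_measurable borel" "u t \<in> borel_measurable borel"
    using Pc uc by (auto intro: borel_measurable_continuous_onI)
  define h where "h x = cutoff S x * (u t x * ?P x)" for x
  have h: "integrable lborel h"
    unfolding h_def by (intro integrable_cutoff_mult(1)[OF S] continuous_intros Pc uc)
  have p: "pairing S t u t = (LINT x|lborel. h x)"
    unfolding pairing_def h_def by (simp add: twave_terminal[OF t])
  let ?X = "LINT x|lborel. \<bar>h x\<bar>"
  have X0: "?X \<ge> 0" by (rule Bochner_Integration.integral_nonneg) simp
  have "ennreal ?X = (\<integral>\<^sup>+x. ennreal \<bar>h x\<bar> \<partial>lborel)"
    using h by (subst nn_integral_eq_integral) auto
  also have "\<dots> \<le> (\<integral>\<^sup>+x. ennreal \<bar>u t x\<bar> * ennreal \<bar>?P x\<bar> \<partial>lborel)"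
  proof (rule nn_integral_mono)
    fix x
    have "\<bar>h x\<bar> = cutoff S x * (\<bar>u t x\<bar> * \<bar>?P x\<bar>)"
      using cutoff_range[OF S] by (simp add: h_def abs_mult)
    also have "\<dots> \<le> 1 * (\<bar>u t x\<bar> * \<bar>?P x\<bar>)"
      using cutoff_range[OF S] by (intro mult_right_mono) auto
    finally have "ennreal \<bar>h x\<bar> \<le> ennreal (\<bar>u t x\<bar> * \<bar>?P x\<bar>)" by (intro ennreal_leI) simp
    then show "ennreal \<bar>h x\<bar> \<le> ennreal \<bar>u t x\<bar> * ennreal \<bar>?P x\<bar>" by (simp add: ennreal_mult)
  qed
  finally have "(ennreal ?X)\<^sup>2 \<le> (\<integral>\<^sup>+x. ennreal \<bar>u t x\<bar> * ennreal \<bar>?P x\<bar> \<partial>lborel)\<^sup>2"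
    by (rule power_mono) simp
  also have "\<dots> \<le> (\<integral>\<^sup>+x. (ennreal \<bar>u t x\<bar>)\<^sup>2 \<partial>lborel) * (\<integral>\<^sup>+x. (ennreal \<bar>?P x\<bar>)\<^sup>2 \<partial>lborel)"
    by (rule Cauchy_Schwarz_nn_integral) auto
  also have "(\<integral>\<^sup>+x. (ennreal \<bar>u t x\<bar>)\<^sup>2 \<partial>lborel) = ennreal (LINT x|lborel. (u t x)\<^sup>2)"
    using ut by (subst nn_integral_eq_integral[symmetric]) (auto simp: ennreal_power)
  also have "(\<integral>\<^sup>+x. (ennreal \<bar>?P x\<bar>)\<^sup>2 \<partial>lborel) = ennreal (pi / 2 * ln (1 + t))"
  proof -
    have "(\<integral>\<^sup>+x. (ennreal \<bar>?P x\<bar>)\<^sup>2 \<partial>lborel) = (\<integral>\<^sup>+x. ennreal ((?P x)\<^sup>2) \<partial>lborel)"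
      by (simp add: ennreal_power)
    also have "\<dots> = ennreal (pi / 2 * ln (((sqrt t)\<^sup>2 + t\<^sup>2) / (sqrt t)\<^sup>2))"
      by (rule nn_integral_wave_pot_s_sq) (use t in auto)
    also have "((sqrt t)\<^sup>2 + t\<^sup>2) / (sqrt t)\<^sup>2 = 1 + t"
      using t by (simp add: field_simps power2_eq_square)
    finally show ?thesis .
  qed
  finally have "(ennreal ?X)\<^sup>2 \<le> ennreal (LINT x|lborel. (u t x)\<^sup>2) * ennreal (pi / 2 * ln (1 + t))" .
  moreover have "(ennreal ?X)\<^sup>2 = ennreal (?X\<^sup>2)" using X0 by (rule ennreal_power)
  moreover have "ennreal (LINT x|lborel. (u t x)\<^sup>2) * ennreal (pi / 2 * ln (1 + t))
      = ennreal ((LINT x|lborel. (u t x)\<^sup>2) * (pi / 2 * ln (1 + t)))"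
    using t by (intro ennreal_mult[symmetric] Bochner_Integration.integral_nonneg) auto
  ultimately have "ennreal (?X\<^sup>2) \<le> ennreal ((LINT x|lborel. (u t x)\<^sup>2) * (pi / 2 * ln (1 + t)))"
    by (simp only:)
  moreover have "0 \<le> (LINT x|lborel. (u t x)\<^sup>2) * (pi / 2 * ln (1 + t))"
    using t by (intro mult_nonneg_nonneg Bochner_Integration.integral_nonneg) auto
  ultimately have "?X\<^sup>2 \<le> (LINT x|lborel. (u t x)\<^sup>2) * (pi / 2 * ln (1 + t))"
    using ennreal_le_iff by blast
  then have "sqrt (?X\<^sup>2) \<le> sqrt ((LINT x|lborel. (u t x)\<^sup>2) * (pi / 2 * ln (1 + t)))"
    by (rule real_sqrt_le_mono)
  then have "?X \<le> L2norm (u t) * sqrt (pi / 2 * ln (1 + t))"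
    by (simp only: real_sqrt_mult L2norm_def real_norm_def power2_abs real_sqrt_abs abs_of_nonneg[OF X0])
  moreover have "\<bar>pairing S t u t\<bar> \<le> ?X" unfolding p by (rule integral_abs_bound)
  ultimately show ?thesis by linarith
qed

text \<open>The wave is replaced by its value at the origin. Its gradient costs 2 |x|, the cutoff
  costs 3 |x| / sqrt S times the bound t on the wave, and the term with u costs at most |u|, since
  the time derivative of the wave is at most 1.\<close>

lemma pairing_initial_bound:
  fixes u :: "real \<Rightarrow> real^2 \<Rightarrow> real"
  assumes S: "S \<ge> 1" and t: "t \<ge> 1" and u: "Ck_half (Suc k) u"
    and u0: "integrable lborel (u 1)" and u1: "integrable lborel (time_deriv u 1)"
    and xu1: "integrable lborel (\<lambda>x. norm x * \<bar>time_deriv u 1 x\<bar>)"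
  shows "\<bar>pairing S t u 1 - twave t 1 0 * (LINT x|lborel. time_deriv u 1 x)\<bar>
    \<le> (2 + 3 * t / sqrt S) * (LINT x|lborel. norm x * \<bar>time_deriv u 1 x\<bar>) + (LINT x|lborel. \<bar>u 1 x\<bar>)"
proof -
  have c: "continuous_on UNIV (u 1)" "continuous_on UNIV (time_deriv u 1)"
    using Ck_half_slice_continuous[OF u] Ck_half_slice_continuous[OF Ck_half_time_deriv[OF u]] by auto
  let ?h = "\<lambda>x. cutoff S x * (time_deriv u 1 x * twave t 1 x - u 1 x * twave_s t 1 x)"
  have h: "integrable lborel ?h"
    by (intro integrable_cutoff_mult(1)[OF S] continuous_intros continuous_twave[OF t] c)
  have eq: "pairing S t u 1 - twave t 1 0 * (LINT x|lborel. time_deriv u 1 x) = (LINT x|lborel. ?h x - twave t 1 0 * time_deriv u 1 x)"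
    unfolding pairing_def using h u1 by simp
  have "\<bar>LINT x|lborel. ?h x - twave t 1 0 * time_deriv u 1 x\<bar> \<le> (LINT x|lborel. \<bar>?h x - twave t 1 0 * time_deriv u 1 x\<bar>)"
    by (rule integral_abs_bound)
  also have "\<dots> \<le> (LINT x|lborel. (2 + 3 * t / sqrt S) * (norm x * \<bar>time_deriv u 1 x\<bar>) + \<bar>u 1 x\<bar>)"
  proof (rule integral_mono)
    show "integrable lborel (\<lambda>x. \<bar>?h x - twave t 1 0 * time_deriv u 1 x\<bar>)" using h u1 by simp
    show "integrable lborel (\<lambda>x. (2 + 3 * t / sqrt S) * (norm x * \<bar>time_deriv u 1 x\<bar>) + \<bar>u 1 x\<bar>)"
      by (intro Bochner_Integration.integrable_add integrable_mult_right xu1 integrable_abs u0)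
    fix x :: "real^2"
    have 1: "\<bar>cutoff S x * twave t 1 x - twave t 1 0\<bar> \<le> (2 + 3 * t / sqrt S) * norm x"
    proof -
      have "\<bar>cutoff S x * twave t 1 x - twave t 1 0\<bar> = \<bar>(twave t 1 x - twave t 1 0) - (1 - cutoff S x) * twave t 1 x\<bar>"
        by (simp add: algebra_simps)
      also have "\<dots> \<le> \<bar>twave t 1 x - twave t 1 0\<bar> + (1 - cutoff S x) * \<bar>twave t 1 x\<bar>"
        using cutoff_range[OF S, of x] abs_triangle_ineq4[of "twave t 1 x - twave t 1 0" "(1 - cutoff S x) * twave t 1 x"]
        by (simp add: abs_mult)
      also have "\<dots> \<le> 2 * norm x + (3 * norm x / sqrt S) * t"
        using twave_variation[OF t, of 1 x] cutoff_defect[OF S, of x] twave_bound[OF t, of 1 x] t S cutoff_range[OF S, of x]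
        by (intro add_mono mult_mono) auto
      finally show ?thesis by (simp add: algebra_simps)
    qed
    have 2: "\<bar>cutoff S x * twave_s t 1 x\<bar> \<le> 1"
      using cutoff_range[OF S, of x] twave_s_bound[OF t, of 1 x] by (simp add: abs_mult mult_le_one)
    have "\<bar>?h x - twave t 1 0 * time_deriv u 1 x\<bar>
      = \<bar>(cutoff S x * twave t 1 x - twave t 1 0) * time_deriv u 1 x - (cutoff S x * twave_s t 1 x) * u 1 x\<bar>"
      by (simp add: algebra_simps)
    also have "\<dots> \<le> \<bar>cutoff S x * twave t 1 x - twave t 1 0\<bar> * \<bar>time_deriv u 1 x\<bar> + \<bar>cutoff S x * twave_s t 1 x\<bar> * \<bar>u 1 x\<bar>"
      using abs_triangle_ineq4 by (metis abs_mult)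
    also have "\<dots> \<le> ((2 + 3 * t / sqrt S) * norm x) * \<bar>time_deriv u 1 x\<bar> + 1 * \<bar>u 1 x\<bar>"
      using 1 2 by (intro add_mono mult_right_mono) auto
    finally show "\<bar>?h x - twave t 1 0 * time_deriv u 1 x\<bar> \<le> (2 + 3 * t / sqrt S) * (norm x * \<bar>time_deriv u 1 x\<bar>) + \<bar>u 1 x\<bar>"
      by (simp add: mult.assoc)
  qed
  also have "\<dots> = (LINT x|lborel. (2 + 3 * t / sqrt S) * (norm x * \<bar>time_deriv u 1 x\<bar>)) + (LINT x|lborel. \<bar>u 1 x\<bar>)"
    by (rule Bochner_Integration.integral_add) (intro integrable_mult_right xu1 integrable_abs u0)+
  finally show ?thesis unfolding eq by (simp only: integral_mult_right_zero)
qed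

section \<open>Removal of the truncation and the rate of growth\<close>

lemma ln_over_square_le:
  fixes k :: real
  assumes "k \<ge> 1"
  shows "ln (1 + k ^ 4) / sqrt (k ^ 4) \<le> 4 / k"
proof -
  have "1 + k ^ 4 \<le> (1 + k) ^ 4"
    using assms by (simp add: power4_eq_xxxx algebra_simps)
  then have "ln (1 + k ^ 4) \<le> ln ((1 + k) ^ 4)"
    using assms by (intro ln_le_cancel_iff[THEN iffD2]) (auto intro: add_pos_pos)
  also have "\<dots> = 4 * ln (1 + k)" using assms by (simp add: ln_realpow)
  also have "\<dots> \<le> 4 * k" using assms by (simp add: ln_add_one_self_le_self)
  finally have "ln (1 + k ^ 4) / k\<^sup>2 \<le> 4 * k / k\<^sup>2" by (rule divide_right_mono) simp
  moreover have "sqrt (k ^ 4) = k\<^sup>2"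
    by (rule real_sqrt_unique) (simp_all add: power_mult[symmetric])
  ultimately show ?thesis using assms by (simp add: power2_eq_square)
qed

lemma le_of_le_add_inverse:
  fixes x y c :: real
  assumes "\<And>k. k \<ge> 1 \<Longrightarrow> x \<le> y + c / real k"
  shows "x \<le> y"
proof (rule LIMSEQ_le_const)
  have "(\<lambda>k. y + c * (1 / real k)) \<longlonglongrightarrow> y + c * 0"
    by (intro tendsto_intros lim_1_over_n)
  then show "(\<lambda>k. y + c / real k) \<longlonglongrightarrow> y" by simp
  show "\<exists>N. \<forall>n\<ge>N. x \<le> y + c / real n" using assms by blast
qed

text \<open>Here t is fixed while the truncation radius grows, so constants that blow up with t are
  harmless: they multiply terms that tend to 0.\<close>

lemma wave_growth_estimate:
  fixes u e :: "real \<Rightarrow> real^2 \<Rightarrow> real"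
  assumes t: "t \<ge> 1" and u: "Ck_half 2 u" and e: "Ck_half 2 e"
    and eq: "\<And>s x. s \<ge> 1 \<Longrightarrow> time_deriv (time_deriv u) s x - laplacian (u s) x = laplacian (e s) x"
    and M: "\<And>s x. s \<in> {1..t} \<Longrightarrow> \<bar>u s x + e s x\<bar> \<le> M / sqrt (1 + (norm x)\<^sup>2)"
    and e0: "\<And>s x. e s x \<ge> 0" and e_int: "\<And>s. s \<ge> 1 \<Longrightarrow> integrable lborel (e s)"
    and \<Lambda>: "\<And>s. s \<ge> 1 \<Longrightarrow> (LINT x|lborel. e s x) \<le> \<Lambda>"
    and ut: "integrable lborel (\<lambda>x. (u t x)\<^sup>2)"
    and u0: "integrable lborel (u 1)" and u1: "integrable lborel (time_deriv u 1)"
    and xu1: "integrable lborel (\<lambda>x. norm x * \<bar>time_deriv u 1 x\<bar>)"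
  shows "ln (t / 2) / 4 * \<bar>LINT x|lborel. time_deriv u 1 x\<bar> \<le> L2norm (u t) * sqrt (pi / 2 * ln (1 + t))
    + (\<Lambda> + 2 * (LINT x|lborel. norm x * \<bar>time_deriv u 1 x\<bar>) + (LINT x|lborel. \<bar>u 1 x\<bar>))"
proof -
  define J where "J = (LINT x|lborel. time_deriv u 1 x)"
  define A1 where "A1 = (LINT x|lborel. norm x * \<bar>time_deriv u 1 x\<bar>)"
  define A0 where "A0 = (LINT x|lborel. \<bar>u 1 x\<bar>)"
  define K where "K = M * (120 * t + 24 * sqrt (1 + 11 * t\<^sup>2)) * pi"
  have A1: "A1 \<ge> 0" unfolding A1_def by (rule Bochner_Integration.integral_nonneg) simp
  have M0: "M \<ge> 0" using M[of 1 0] t by simp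
  have K0: "K \<ge> 0" unfolding K_def using M0 t by (intro mult_nonneg_nonneg add_nonneg_nonneg) auto
  have L0: "\<Lambda> \<ge> 0"
    using \<Lambda>[of 1] Bochner_Integration.integral_nonneg[of lborel "e 1"] e0 by (metis order_trans order_refl)
  have main: "twave t 1 0 * \<bar>J\<bar> \<le> (L2norm (u t) * sqrt (pi / 2 * ln (1 + t)) + (\<Lambda> + 2 * A1 + A0))
      + ((t - 1) * K * 4 + 3 * t * A1) / real k" if k: "k \<ge> 1" for k
  proof -
    \<comment> \<open>A fourth power makes sqrt S = k^2, so that ln (1 + S) / sqrt S is at most 4 /
      k and all truncation errors are a constant over k.\<close>
    define S where "S = real k ^ 4"
    have k1: "real k \<ge> 1" using k by simp
    have S: "S \<ge> 1" unfolding S_def using k1 by (rule one_le_power)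
    have sS: "sqrt S = (real k)\<^sup>2" unfolding S_def by (rule real_sqrt_unique) (simp_all add: power_mult[symmetric])
    have "norm (pairing S t u t - pairing S t u 1) \<le> (\<Lambda> / t + K * (4 / real k)) * norm (t - 1)"
    proof (rule field_differentiable_bound)
      show "convex {1..t}" by simp
      show "(pairing S t u has_real_derivative
        (LINT x|lborel. cutoff S x * (time_deriv (time_deriv u) s x * twave t s x - u s x * twave_ss t s x))) (at s within {1..t})"
        if "s \<in> {1..t}" for s by (rule pairing_has_derivative[OF S t u that])
      show "norm (LINT x|lborel. cutoff S x * (time_deriv (time_deriv u) s x * twave t s x - u s x * twave_ss t s x)) \<le> \<Lambda> / t + K * (4 / real k)"
        if s: "s \<in> {1..t}" for s
      proof -
        have "s \<ge> 1" using s by simp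
        have "\<bar>LINT x|lborel. cutoff S x * (time_deriv (time_deriv u) s x * twave t s x - u s x * twave_ss t s x)\<bar>
          \<le> \<Lambda> / t + M * (120 * t + 24 * sqrt (1 + 11 * t\<^sup>2)) * (pi * ln (1 + S) / sqrt S)"
          by (rule pairing_derivative_bound[OF S t u e s eq[OF \<open>s \<ge> 1\<close>] M[OF s] e0 e_int[OF \<open>s \<ge> 1\<close>] \<Lambda>[OF \<open>s \<ge> 1\<close>]])
        also have "M * (120 * t + 24 * sqrt (1 + 11 * t\<^sup>2)) * (pi * ln (1 + S) / sqrt S) = K * (ln (1 + S) / sqrt S)"
          by (simp add: K_def)
        also have "\<dots> \<le> K * (4 / real k)"
          using ln_over_square_le[OF k1] K0 unfolding S_def by (rule mult_left_mono)
        finally show ?thesis by simp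
      qed
    qed (use t in auto)
    also have "\<dots> = (t - 1) / t * \<Lambda> + (t - 1) * K * 4 / real k"
      using t by (simp add: field_simps)
    \<comment> \<open>The bound 1/t on the Laplacian of the wave, over a time span t - 1, keeps the
      contribution of the source below a constant.\<close>
    also have "(t - 1) / t * \<Lambda> \<le> 1 * \<Lambda>"
      using t L0 by (intro mult_right_mono) auto
    finally have d: "\<bar>pairing S t u t - pairing S t u 1\<bar> \<le> \<Lambda> + (t - 1) * K * 4 / real k" by simp
    have i: "\<bar>pairing S t u 1 - twave t 1 0 * J\<bar> \<le> (2 + 3 * t / sqrt S) * A1 + A0"
      unfolding J_def A1_def A0_def using u by (intro pairing_initial_bound[OF S t _ u0 u1 xu1, of 1]) (simp add: numeral_2_eq_2)
    have f: "\<bar>pairing S t u t\<bar> \<le> L2norm (u t) * sqrt (pi / 2 * ln (1 + t))"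
      by (rule pairing_terminal_bound[OF S t u ut])
    have "3 * t / sqrt S \<le> 3 * t / real k"
      unfolding sS using t k1 by (intro divide_left_mono) (auto simp: power2_eq_square)
    then have "(2 + 3 * t / sqrt S) * A1 \<le> (2 + 3 * t / real k) * A1" using A1 by (intro mult_right_mono) auto
    also have "\<dots> = 2 * A1 + 3 * t * A1 / real k" by (simp add: algebra_simps)
    finally have r: "(2 + 3 * t / sqrt S) * A1 \<le> 2 * A1 + 3 * t * A1 / real k" .
    have "twave t 1 0 * \<bar>J\<bar> \<le> \<bar>twave t 1 0 * J\<bar>" by (simp add: abs_mult mult_right_mono)
    then have "twave t 1 0 * \<bar>J\<bar> \<le> L2norm (u t) * sqrt (pi / 2 * ln (1 + t)) + (\<Lambda> + (t - 1) * K * 4 / real k) + (2 * A1 + 3 * t * A1 / real k + A0)"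
      using d i f r by linarith
    then show ?thesis by (simp add: add_divide_distrib)
  qed
  have "twave t 1 0 * \<bar>J\<bar> \<le> L2norm (u t) * sqrt (pi / 2 * ln (1 + t)) + (\<Lambda> + 2 * A1 + A0)"
    by (rule le_of_le_add_inverse[OF main])
  moreover have "ln (t / 2) / 4 * \<bar>J\<bar> \<le> twave t 1 0 * \<bar>J\<bar>"
    using twave_initial_origin[OF t] by (rule mult_right_mono) simp
  ultimately show ?thesis unfolding J_def A1_def A0_def by linarith
qed

text \<open>For t \<ge> 4, ln (t / 2) \<ge> (ln t) / 2, so the left side is at least J (ln t) / 8;
  half of this absorbs \<open>C0\<close> once t \<ge> exp (16 C0 / J). On the right ln (1 + t) \<le>
  2 ln t, and cancelling sqrt (ln t) leaves 1 / (16 sqrt pi).\<close>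

lemma sqrt_ln_growth:
  fixes f :: "real \<Rightarrow> real"
  assumes J: "J > 0"
    and bound: "\<And>t. t \<ge> 2 \<Longrightarrow> ln (t / 2) / 4 * J \<le> f t * sqrt (pi / 2 * ln (1 + t)) + C0"
    and f0: "\<And>t. f t \<ge> 0"
  shows "\<forall>\<^sub>F t in at_top. f t \<ge> 1 / (16 * sqrt pi) * ln t powr (1/2) * J"
  using eventually_ge_at_top[of "max 4 (exp (16 * C0 / J))"]
proof eventually_elim
  case (elim t)
  then have t4: "t \<ge> 4" and "t \<ge> exp (16 * C0 / J)" by auto
  then have "ln t \<ge> 16 * C0 / J" by (metis exp_gt_zero ln_exp ln_le_cancel_iff less_le_trans)
  then have C0: "C0 \<le> ln t * J / 16" using J by (simp add: field_simps)
  define l where "l = ln t"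
  have l0: "l > 0" using t4 by (simp add: l_def)
  have "ln (t / 2) \<ge> l / 2"
  proof -
    have "ln 4 \<le> l" unfolding l_def using t4 by simp
    moreover have "ln (4::real) = 2 * ln 2" using ln_realpow[of "2::real" 2] by simp
    moreover have "ln (t / 2) = l - ln 2" unfolding l_def using t4 by (simp add: ln_div)
    ultimately show ?thesis by linarith
  qed
  then have "l / 2 / 4 * J \<le> ln (t / 2) / 4 * J" using J by (intro mult_right_mono divide_right_mono) auto
  then have "l / 2 / 4 * J \<le> f t * sqrt (pi / 2 * ln (1 + t)) + l * J / 16"
    using bound[of t] t4 C0 unfolding l_def by linarith
  then have "l * J / 16 \<le> f t * sqrt (pi / 2 * ln (1 + t))" by (simp add: field_simps)
  also have "\<dots> \<le> f t * sqrt (pi * l)"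
  proof -
    have "4 * t \<le> t * t" using t4 by (intro mult_right_mono) auto
    then have "1 + t \<le> t\<^sup>2" unfolding power2_eq_square using t4 by linarith
    then have "ln (1 + t) \<le> ln (t\<^sup>2)" using t4 by (intro ln_le_cancel_iff[THEN iffD2]) auto
    then have "ln (1 + t) \<le> 2 * l" unfolding l_def using t4 by (simp add: ln_realpow)
    then show ?thesis using f0[of t] by (intro mult_left_mono real_sqrt_le_mono) (auto simp: field_simps)
  qed
  finally have "l * J / 16 \<le> f t * (sqrt pi * sqrt l)" by (simp add: real_sqrt_mult)
  then have "(sqrt l * sqrt l) * J / 16 \<le> f t * (sqrt pi * sqrt l)" using l0 by simp
  then have "sqrt l * (sqrt l * J / 16) \<le> sqrt l * (f t * sqrt pi)" by (simp add: mult_ac)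
  then have "sqrt l * J / 16 \<le> f t * sqrt pi" using l0 by (simp only: mult_le_cancel_left_pos real_sqrt_gt_0_iff)
  then have "1 / (16 * sqrt pi) * sqrt l * J \<le> f t" by (simp add: field_simps)
  then show ?case using l0 by (simp add: l_def powr_half_sqrt)
qed

text \<open>Up to time t the light cone stays in a bounded region, so both brackets dominate that of
  x, the second one up to a factor depending on t; the two half powers then combine to a full
  inverse power.\<close>

lemma kgz_pointwise_decay:
  fixes n :: real and v :: "real^2"
  assumes s: "1 \<le> s" "s \<le> t" and A: "A \<ge> 0"
    and n: "\<bar>n\<bar> \<le> A * japanese (s + norm x) powr (- 1/2) * japanese (s - norm x) powr (- 1/2)"
    and v: "norm v \<le> A * japanese (s + norm x) powr (- 1)"
  shows "\<bar>n + (norm v)\<^sup>2\<bar> \<le> (A * sqrt (sqrt (2 * (1 + t\<^sup>2))) + A\<^sup>2) / sqrt (1 + (norm x)\<^sup>2)"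
proof -
  define r where "r = norm x"
  have r: "r \<ge> 0" by (simp add: r_def)
  define J1 where "J1 = japanese (s + r)"
  define J2 where "J2 = japanese (s - r)"
  define y where "y = sqrt (1 + r\<^sup>2)"
  define q where "q = sqrt (2 * (1 + t\<^sup>2))"
  have pos: "J1 > 0" "J2 > 0" "q > 0" "y \<ge> 1" unfolding J1_def J2_def q_def y_def japanese_def by (auto simp: add_pos_nonneg)
  have yJ1: "y \<le> J1"
    unfolding y_def J1_def japanese_def using s r by (intro real_sqrt_le_mono add_left_mono power_mono) auto
  have "1 + r\<^sup>2 \<le> 2 * (1 + t\<^sup>2) * (1 + (s - r)\<^sup>2)"
  proof -
    \<comment> \<open>The right side minus the left side is (2 s - r)^2.\<close>
    have "r\<^sup>2 \<le> 2 * s\<^sup>2 + 2 * (s - r)\<^sup>2"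
      using zero_le_power2[of "2 * s - r"] by (simp add: power2_eq_square algebra_simps)
    moreover have "s\<^sup>2 \<le> t\<^sup>2" using s by (intro power_mono) auto
    moreover have "0 \<le> t\<^sup>2 * (s - r)\<^sup>2" by simp
    moreover have "2 * (1 + t\<^sup>2) * (1 + (s - r)\<^sup>2) = 2 + 2 * t\<^sup>2 + 2 * (s - r)\<^sup>2 + 2 * (t\<^sup>2 * (s - r)\<^sup>2)"
      by (simp add: algebra_simps)
    ultimately show ?thesis by linarith
  qed
  then have "y \<le> sqrt (2 * (1 + t\<^sup>2) * (1 + (s - r)\<^sup>2))" unfolding y_def by (rule real_sqrt_le_mono)
  then have yJ2: "y \<le> q * J2" by (simp add: real_sqrt_mult q_def J2_def japanese_def)
  have "y * y \<le> J1 * (q * J2)" using yJ1 yJ2 pos by (intro mult_mono) auto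
  then have "sqrt (y * y) \<le> sqrt (q * (J1 * J2))" by (intro real_sqrt_le_mono) (simp add: mult_ac)
  then have "y \<le> sqrt q * sqrt (J1 * J2)" using pos by (simp add: real_sqrt_mult)
  then have key: "1 / sqrt (J1 * J2) \<le> sqrt q / y" using pos by (simp add: field_simps)
  have "J1 powr (- 1/2) * J2 powr (- 1/2) = 1 / sqrt (J1 * J2)"
    using pos by (simp add: powr_minus_divide powr_half_sqrt real_sqrt_mult)
  then have "\<bar>n\<bar> \<le> A * (1 / sqrt (J1 * J2))"
    using n by (simp add: J1_def J2_def r_def mult.assoc)
  also have "\<dots> \<le> A * (sqrt q / y)" using key A by (rule mult_left_mono)
  finally have 1: "\<bar>n\<bar> \<le> A * sqrt q / y" by simp
  have "norm v \<le> A / J1" using v pos by (simp add: J1_def r_def powr_minus_divide)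
  also have "\<dots> \<le> A / y" using yJ1 pos A by (intro divide_left_mono) auto
  finally have "(norm v)\<^sup>2 \<le> (A / y)\<^sup>2" by (rule power_mono) simp
  also have "\<dots> = A\<^sup>2 / y * (1 / y)" by (simp add: power2_eq_square)
  also have "\<dots> \<le> A\<^sup>2 / y * 1" using pos by (intro mult_left_mono) auto
  finally have 2: "(norm v)\<^sup>2 \<le> A\<^sup>2 / y" by simp
  have "\<bar>n + (norm v)\<^sup>2\<bar> \<le> A * sqrt q / y + A\<^sup>2 / y"
    using 1 2 abs_triangle_ineq[of n "(norm v)\<^sup>2"] by simp
  then show ?thesis by (simp add: add_divide_distrib y_def q_def r_def)
qed

subsection \<open>Consequences of the energy bounds\<close>

lemma Hnorm_nonneg: "0 \<le> Hnorm m f"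
  unfolding Hnorm_def by (simp add: sum_nonneg)

lemma L2norm_nonneg: "0 \<le> L2norm f"
  unfolding L2norm_def by simp

lemma L2norm_sq: "(L2norm f)\<^sup>2 = (LINT x|lborel. (norm (f x))\<^sup>2)"
  unfolding L2norm_def by (intro real_sqrt_pow2 Bochner_Integration.integral_nonneg) simp

lemma Ck_half_norm_sq:
  fixes E :: "real \<Rightarrow> real^2 \<Rightarrow> real^2"
  assumes "Ck_half k E"
  shows "Ck_half k (\<lambda>s x. (norm (E s x))\<^sup>2)"
proof -
  have "Ck_on k halfspace (\<lambda>p. inner ((\<lambda>(t, x). E t x) p) ((\<lambda>(t, x). E t x) p))"
    by (rule Ck_on_bilinear[OF bounded_bilinear_inner _ assms assms]) simp
  then show ?thesis
    by (rule Ck_on_cong[THEN iffD1, rotated]) (auto simp: power2_norm_eq_inner)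
qed

lemma spacetime_grad_measurable:
  assumes "Ck_half (Suc k) u" "s \<ge> 1"
  shows "spacetime_grad u s \<in> borel_measurable borel"
proof -
  have "continuous_on UNIV (\<lambda>x. (time_deriv u s x, \<chi> i. partial i (u s) x))"
    by (intro continuous_on_Pair continuous_on_vec_lambda
        Ck_half_slice_continuous[OF Ck_half_time_deriv[OF assms(1)] assms(2)]
        Ck_half_slice_continuous[OF Ck_half_partial[OF assms(1)] assms(2)])
  then have "(\<lambda>x. (time_deriv u s x, \<chi> i. partial i (u s) x)) \<in> borel_measurable borel"
    by (rule borel_measurable_continuous_onI)
  moreover have "spacetime_grad u s = (\<lambda>x. (time_deriv u s x, \<chi> i. partial i (u s) x))"
    by (rule ext) (simp add: spacetime_grad_def gradient_def)
  ultimately show ?thesis by simp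
qed

theorem proposition1p7:
  fixes N :: nat and C' :: real
  assumes "N \<ge> 16" and "C' > 0"
  shows "\<exists>\<epsilon>0>0. \<forall>\<epsilon>\<le>\<epsilon>0. \<forall>n0 n1 E0 E1 n E.
    small_data N \<epsilon> n0 n1 E0 E1 \<longrightarrow>
    kgz_solution n0 n1 E0 E1 n E \<longrightarrow>
    kgz_bounds N C' \<epsilon> n E \<longrightarrow>
    (LINT x|lborel. n1 x) \<noteq> 0 \<longrightarrow>
    (\<exists>C>0. \<forall>\<^sub>F t in at_top. L2norm (n t) \<ge> C * ln t powr (1/2) * \<bar>LINT x|lborel. n1 x\<bar>) \<and>
    (\<exists>C>0. \<forall>\<^sub>F t in at_top. L2norm (spacetime_grad n t) \<le> C * \<epsilon>)"
\<comment> \<open>Smallness is what makes the bounds \<open>kgz_bounds\<close> available; with these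
  given for the fixed \<open>C'\<close>, the threshold 1 serves.\<close>
proof (rule exI[of _ "1::real"], intro conjI allI impI)
  fix \<epsilon> :: real and n0 n1 :: "real^2 \<Rightarrow> real" and E0 E1 :: "real^2 \<Rightarrow> real^2"
    and n :: "real \<Rightarrow> real^2 \<Rightarrow> real" and E :: "real \<Rightarrow> real^2 \<Rightarrow> real^2"
  assume data: "small_data N \<epsilon> n0 n1 E0 E1" and sol: "kgz_solution n0 n1 E0 E1 n E"
    and bounds: "kgz_bounds N C' \<epsilon> n E" and mean: "(LINT x|lborel. n1 x) \<noteq> 0"
  define A where "A = C' * \<epsilon>"
  have n: "Ck_half 2 n" and E: "Ck_half 2 E"
    and wave: "\<And>s x. s \<ge> 1 \<Longrightarrow> neg_box n s x = laplacian (\<lambda>y. (norm (E s y))\<^sup>2) x"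
    and init: "AE x in lborel. n 1 x = n0 x" "AE x in lborel. time_deriv n 1 x = n1 x"
    using sol unfolding kgz_solution_def by auto
  have n': "Ck_half (Suc 1) n" using n by (simp add: numeral_2_eq_2)
  have b: "\<bar>n s x\<bar> \<le> A * japanese (s + norm x) powr (- 1/2) * japanese (s - norm x) powr (- 1/2)"
    "norm (E s x) \<le> A * japanese (s + norm x) powr (- 1)"
    "in_H N (spacetime_grad n s)" "in_H (N + 2) (E s)"
    "Hnorm N (spacetime_grad n s) + Hnorm (N + 2) (E s) + Hnorm (N + 1) (time_deriv E s) \<le> A"
    if "s \<ge> 1" for s x
    using bounds that unfolding kgz_bounds_def A_def by blast+
  have A: "A \<ge> 0"
    using b(5)[of 1] Hnorm_nonneg[of N "spacetime_grad n 1"] Hnorm_nonneg[of "N + 2" "E 1"]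
      Hnorm_nonneg[of "N + 1" "time_deriv E 1"] by linarith
  have grad: "L2 (spacetime_grad n s)" "L2norm (spacetime_grad n s) \<le> A" if s: "s \<ge> 1" for s
  proof -
    have m: "spacetime_grad n s \<in> borel_measurable lborel"
      using spacetime_grad_measurable[OF n' s] by simp
    show "L2 (spacetime_grad n s)" by (rule in_H_imp_L2(1)[OF b(3)[OF s] m])
    show "L2norm (spacetime_grad n s) \<le> A"
      using in_H_imp_L2(2)[OF b(3)[OF s] m] b(5)[OF s] Hnorm_nonneg[of "N + 2" "E s"]
        Hnorm_nonneg[of "N + 1" "time_deriv E s"] by linarith
  qed
  have "\<forall>\<^sub>F t in at_top. L2norm (spacetime_grad n t) \<le> C' * \<epsilon>"
    using eventually_ge_at_top[of 1] by eventually_elim (use grad in \<open>simp add: A_def\<close>)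
  with \<open>C' > 0\<close> show "\<exists>C>0. \<forall>\<^sub>F t in at_top. L2norm (spacetime_grad n t) \<le> C * \<epsilon>" by blast
  have tm: "time_deriv n s \<in> borel_measurable borel" if "s \<ge> 1" for s
    by (rule borel_measurable_continuous_onI[OF Ck_half_slice_continuous[OF Ck_half_time_deriv[OF n'] that]])
  have nm: "n s \<in> borel_measurable borel" if "s \<ge> 1" for s
    by (rule borel_measurable_continuous_onI[OF Ck_half_slice_continuous[OF n that]])
  have nt: "integrable lborel (\<lambda>x. (time_deriv n s x)\<^sup>2)" "(LINT x|lborel. (time_deriv n s x)\<^sup>2) \<le> A\<^sup>2" if s: "s \<ge> 1" for s
  proof -
    have le: "(time_deriv n s x)\<^sup>2 \<le> (norm (spacetime_grad n s x))\<^sup>2" for x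
      by (simp add: spacetime_grad_def norm_Pair)
    have i: "integrable lborel (\<lambda>x. (norm (spacetime_grad n s x))\<^sup>2)" using grad(1)[OF s] by (simp add: L2_def)
    show i': "integrable lborel (\<lambda>x. (time_deriv n s x)\<^sup>2)"
      by (rule Bochner_Integration.integrable_bound[OF i]) (use tm[OF s] le in auto)
    have "(LINT x|lborel. (time_deriv n s x)\<^sup>2) \<le> (L2norm (spacetime_grad n s))\<^sup>2"
      unfolding L2norm_sq using i' i le by (rule integral_mono)
    also have "\<dots> \<le> A\<^sup>2" using grad(2)[OF s] L2norm_nonneg by (rule power_mono)
    finally show "(LINT x|lborel. (time_deriv n s x)\<^sup>2) \<le> A\<^sup>2" .
  qed
  have e: "integrable lborel (\<lambda>x. (norm (E s x))\<^sup>2)" "(LINT x|lborel. (norm (E s x))\<^sup>2) \<le> A\<^sup>2" if s: "s \<ge> 1" for s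
  proof -
    have m: "E s \<in> borel_measurable lborel"
      using borel_measurable_continuous_onI[OF Ck_half_slice_continuous[OF E s]] by simp
    show "integrable lborel (\<lambda>x. (norm (E s x))\<^sup>2)"
      using in_H_imp_L2(1)[OF b(4)[OF s] m] by (simp add: L2_def)
    have "L2norm (E s) \<le> A"
      using in_H_imp_L2(2)[OF b(4)[OF s] m] b(5)[OF s] Hnorm_nonneg[of N "spacetime_grad n s"]
        Hnorm_nonneg[of "N + 1" "time_deriv E s"] by linarith
    then show "(LINT x|lborel. (norm (E s x))\<^sup>2) \<le> A\<^sup>2"
      unfolding L2norm_sq[symmetric] using L2norm_nonneg by (rule power_mono)
  qed
  have sob: "in_weighted_sobolev (\<lambda>k. k + 3) (N + 1) n0" "in_weighted_sobolev (\<lambda>k. k + 3) N n1"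
    using data unfolding small_data_def by auto
  have "L2 (\<lambda>x. japanese x ^ 3 *\<^sub>R n 1 x)"
    using in_weighted_sobolev_imp_L2[OF sob(1) init(1)] nm[of 1] by simp
  note u0 = weighted_L2_imp_L1[OF this nm[OF order_refl]]
  have "L2 (\<lambda>x. japanese x ^ 3 *\<^sub>R time_deriv n 1 x)"
    using in_weighted_sobolev_imp_L2[OF sob(2) init(2)] tm[of 1] by simp
  note u1 = weighted_L2_imp_L1[OF this tm[OF order_refl]]
  have mean_eq: "(LINT x|lborel. time_deriv n 1 x) = (LINT x|lborel. n1 x)"
  proof (rule integral_cong_AE[OF _ _ init(2)])
    show "time_deriv n 1 \<in> borel_measurable lborel" using tm[of 1] by simp
    \<comment> \<open>The integral of a function that is not integrable is 0 by default, so the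
      nonzero mean forces \<open>n1\<close> to be integrable and hence measurable.\<close>
    show "n1 \<in> borel_measurable lborel"
      using mean not_integrable_integral_eq borel_measurable_integrable by blast
  qed
  define C0 where "C0 = A\<^sup>2 + 2 * (LINT x|lborel. norm x * \<bar>time_deriv n 1 x\<bar>) + (LINT x|lborel. \<bar>n 1 x\<bar>)"
  have "\<forall>\<^sub>F t in at_top. L2norm (n t) \<ge> 1 / (16 * sqrt pi) * ln t powr (1/2) * \<bar>LINT x|lborel. n1 x\<bar>"
  proof (rule sqrt_ln_growth)
    fix t :: real assume "t \<ge> 2"
    then have t: "t \<ge> 1" "t > 1" by auto
    show "ln (t / 2) / 4 * \<bar>LINT x|lborel. n1 x\<bar> \<le> L2norm (n t) * sqrt (pi / 2 * ln (1 + t)) + C0"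
      unfolding C0_def mean_eq[symmetric]
    proof (rule wave_growth_estimate[OF t(1) n Ck_half_norm_sq[OF E]])
      show "time_deriv (time_deriv n) s x - laplacian (n s) x = laplacian (\<lambda>x. (norm (E s x))\<^sup>2) x" if "s \<ge> 1" for s x
        using wave[OF that] by (simp add: neg_box_def)
      show "\<bar>n s x + (norm (E s x))\<^sup>2\<bar> \<le> (A * sqrt (sqrt (2 * (1 + t\<^sup>2))) + A\<^sup>2) / sqrt (1 + (norm x)\<^sup>2)"
        if "s \<in> {1..t}" for s x
        by (rule kgz_pointwise_decay[OF _ _ A b(1,2)]) (use that in auto)
      show "integrable lborel (\<lambda>x. (n t x)\<^sup>2)"
        by (rule slice_square_integrable[OF n' u0(3) nt t(2)])
    qed (use e u0 u1 in auto)
  qed (use mean L2norm_nonneg in auto)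
  moreover have "1 / (16 * sqrt pi) > 0" by simp
  ultimately show "\<exists>C>0. \<forall>\<^sub>F t in at_top. L2norm (n t) \<ge> C * ln t powr (1/2) * \<bar>LINT x|lborel. n1 x\<bar>"
    by blast
qed simp

end
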